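(* There is an absolute constant $c>0$ such that the following holds. Let $m,n\ge 1$, let $A^1,\dots,A^m,C\in\mathbb{S}^n$ and $b\in\mathbb{R}^m$ have integer entries, suppose that $A^1,\dots,A^m$ are linearly independent and that there exists $(X,y,S)\in\mathbb{S}^n\times\mathbb{R}^m\times\mathbb{S}^n$ with $\langle A^i,X\rangle=b_i$ for all $i$, $\sum_{i=1}^m y_iA^i+S=C$, $X\succ0$ and $S\succ 0$. Let $\xi:(0,\infty)\to\mathbb{S}^n\times\mathbb{R}^m\times\mathbb{S}^n$ be the central path. Then there exists a positive integer $\rho$ such that $\mu\mapsto\xi(\mu^{\rho})$ is analytic at $\mu=0$, and the optimal (i.e. least) such $\rho$ satisfies $$\rho\le 2^{c(m^2+n^2m+n^4)}.$$
   Context: $\mathbb{S}^n$ is the space of real symmetric $n\times n$ matrices with inner product $\langle C,X\rangle=\operatorname{Tr}(CX)$; $\succ0$ means positive definite. Central path: under the stated assumptions, for every $\mu>0$ there is a unique $\xi(\mu)=(X(\mu),y(\mu),S(\mu))\in\mathbb{S}^n\times\mathbb{R}^m\times\mathbb{S}^n$ with $\langle A^i,X\rangle=b_i$ ($i=1,\dots,m$), $\sum_{i=1}^m y_iA^i+S=C$, $XS=\mu I_n$, $X\succ0$, $S\succ 0$. The map $\xi$ is the central path of the primal-dual pair of semidefinite optimization problems $\inf\{\langle C,X\rangle:\langle A^i,X\rangle=b_i,\ X\succeq0\}$ and $\sup\{b^Ty:\sum_i y_iA^i+S=C,\ S\succeq0\}$. It is analytic and semi-algebraic on $(0,\infty)$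 and converges as $\mu\downarrow0$. "$\xi(\mu^\rho)$ is analytic at $\mu=0$" means that the function $\mu\mapsto \xi(\mu^\rho)$, defined for $\mu>0$, agrees for all sufficiently small $\mu>0$ with a function given by a power series in $\mu$ convergent in a neighborhood of $0$. *)

theory Defs
  imports Complex_Main "Jordan_Normal_Form.Matrix"
begin

definition sym_mats :: "nat \<Rightarrow> real mat set" where
  "sym_mats n = {X \<in> carrier_mat n n. transpose_mat X = X}"

definition mat_trace :: "real mat \<Rightarrow> real" where
  "mat_trace X = (\<Sum>i<dim_row X. X $$ (i, i))"

definition trace_inner :: "real mat \<Rightarrow> real mat \<Rightarrow> real" where
  "trace_inner C X = mat_trace (C * X)"

definition pos_def :: "nat \<Rightarrow> real mat \<Rightarrow> bool" where
  "pos_def n X \<longleftrightarrow>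
     X \<in> sym_mats n \<and> (\<forall>v \<in> carrier_vec n. v \<noteq> 0\<^sub>v n \<longrightarrow> v \<bullet> (X *\<^sub>v v) > 0)"

text \<open>The type of matrices carries no global addition monoid, so a linear combination of a
  family \<open>A 0, \<dots>, A (m - 1)\<close> of \<open>n \<times> n\<close> matrices is written out entrywise. Families and
  coordinates are indexed from 0 throughout.\<close>

definition lin_comb :: "nat \<Rightarrow> nat \<Rightarrow> (nat \<Rightarrow> real mat) \<Rightarrow> real vec \<Rightarrow> real mat" where
  "lin_comb n m A y = mat n n (\<lambda>(j, k). \<Sum>i<m. y $ i * A i $$ (j, k))"

definition lin_indep_family :: "nat \<Rightarrow> nat \<Rightarrow> (nat \<Rightarrow> real mat) \<Rightarrow> bool" where
  "lin_indep_family n m A \<longleftrightarrow>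
     (\<forall>y \<in> carrier_vec m. lin_comb n m A y = 0\<^sub>m n n \<longrightarrow> y = 0\<^sub>v m)"

definition integral_data ::
    "nat \<Rightarrow> nat \<Rightarrow> (nat \<Rightarrow> real mat) \<Rightarrow> real vec \<Rightarrow> real mat \<Rightarrow> bool" where
  "integral_data n m A b C \<longleftrightarrow>
     (\<forall>i<m. A i \<in> sym_mats n \<and> elements_mat (A i) \<subseteq> \<int>) \<and>
     C \<in> sym_mats n \<and> elements_mat C \<subseteq> \<int> \<and>
     b \<in> carrier_vec m \<and> (\<forall>i<m. b $ i \<in> \<int>)"

type_synonym pd_triple = "real mat \<times> real vec \<times> real mat"

definition strictly_feasible ::
    "nat \<Rightarrow> nat \<Rightarrow> (nat \<Rightarrow> real mat) \<Rightarrow> real vec \<Rightarrow> real mat \<Rightarrow> pd_triple \<Rightarrow> bool" where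
  "strictly_feasible n m A b C = (\<lambda>(X, y, S).
     X \<in> sym_mats n \<and> y \<in> carrier_vec m \<and> S \<in> sym_mats n \<and>
     (\<forall>i<m. trace_inner (A i) X = b $ i) \<and>
     lin_comb n m A y + S = C \<and>
     pos_def n X \<and> pos_def n S)"

text \<open>Only the values of \<open>\<xi>\<close> at positive arguments are constrained.\<close>

definition is_central_path ::
    "nat \<Rightarrow> nat \<Rightarrow> (nat \<Rightarrow> real mat) \<Rightarrow> real vec \<Rightarrow> real mat \<Rightarrow> (real \<Rightarrow> pd_triple) \<Rightarrow> bool"
  where
  "is_central_path n m A b C \<xi> \<longleftrightarrow>
     (\<forall>\<mu>>0. strictly_feasible n m A b C (\<xi> \<mu>) \<and>
        (case \<xi> \<mu> of (X, y, S) \<Rightarrow> X * S = \<mu> \<cdot>\<^sub>m 1\<^sub>m n))"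

text \<open>One-sided notion: a function on \<open>(0, \<infinity>)\<close> agrees for all small positive arguments with a
  power series converging in a (two-sided) neighbourhood of 0.\<close>

definition analytic_at_0 :: "(real \<Rightarrow> real) \<Rightarrow> bool" where
  "analytic_at_0 f \<longleftrightarrow>
     (\<exists>a. (\<forall>\<^sub>F t in nhds 0. summable (\<lambda>k. a k * t ^ k)) \<and>
          (\<forall>\<^sub>F t in at_right 0. f t = (\<Sum>k. a k * t ^ k)))"

definition curve_analytic_at_0 :: "nat \<Rightarrow> nat \<Rightarrow> (real \<Rightarrow> pd_triple) \<Rightarrow> bool" where
  "curve_analytic_at_0 n m \<zeta> \<longleftrightarrow>
     (\<forall>j<n. \<forall>k<n. analytic_at_0 (\<lambda>t. fst (\<zeta> t) $$ (j, k))) \<and>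
     (\<forall>i<m. analytic_at_0 (\<lambda>t. fst (snd (\<zeta> t)) $ i)) \<and>
     (\<forall>j<n. \<forall>k<n. analytic_at_0 (\<lambda>t. snd (snd (\<zeta> t)) $$ (j, k)))"

definition analytic_reparam :: "nat \<Rightarrow> nat \<Rightarrow> (real \<Rightarrow> pd_triple) \<Rightarrow> nat \<Rightarrow> bool" where
  "analytic_reparam n m \<xi> \<rho> \<longleftrightarrow> \<rho> > 0 \<and> curve_analytic_at_0 n m (\<lambda>\<mu>. \<xi> (\<mu> ^ \<rho>))"

end

(* The dual coordinates y_1, ..., y_m of the central path satisfy tr(A^i S(y)^-1) = b_i / mu, i.e. the
   m polynomial equations H_i(y, 1/mu) = tr(A^i adj S(y)) - (b_i / mu) det S(y) = 0.  Counting
   monomials, any linear form l = u.y satisfies a nontrivial identity sum q H^alpha mu^-gamma l^beta = 0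
   with exponents at most D = (3 (n+1) m)^(m+1).  Its terms of least order in H give, because the
   Jacobian of H in y is a nonsingular Gram matrix times det S, a nonzero polynomial of degree at most D
   in l that vanishes along the central path.

   A continuous function annihilated by a polynomial over C[mu] continues holomorphically in log mu
   to a left half-plane: lift through the covering given by the roots of a squarefree annihilator.
   Two of the D + 1 translates by multiples of 2 pi i agree, so the continuation is 2 pi i rho-periodic with
   rho <= D.  For generic u this gives a common period of all y_i, i.e. the y_i(mu^rho) are meromorphic at 0;
   they are analytic because the path stays bounded.  Finally S is affine in y and
   X = mu adj S / det S is bounded. *)

theory Submission
  imports
    "HOL-Complex_Analysis.Complex_Analysis"
    "HOL-Computational_Algebra.Computational_Algebra"
    "Jordan_Normal_Form.Determinant"
    Defs
begin

unbundle no vec_syntax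
unbundle no inner_syntax
no_notation fps_nth (infixl "$" 75)
hide_const (open) Module.smult

section \<open>Squarefree annihilating polynomials\<close>

text \<open>The equations H may have unwanted solution sets of positive dimension: wherever S(y) has
  rank at most n - 2, adj S and det S both vanish, whatever mu is. A global count of solutions or a
  resultant could therefore degenerate. Instead the relation is examined along lines through path
  points, where the Jacobian is invertible, so that only the local behaviour at the path matters. A
  line can be chosen on which the H_i leave 0 with any prescribed speeds; one choice of speeds, the
  same for all mu, keeps the extracted polynomial nonzero.

  Using only y and 1/mu, not the entries of X and S, leaves m + 1 variables; this is the exponent m
  + 1 in D.

  Each y_i alone has a period of at most D, but the least common multiple of m such periods could be
  far larger. Hence every real linear form u.y is annihilated with the same D: the failure of each
  candidate rho in 1..D to be a common period is then visible in a single generic form.\<close>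

definition eval_coeffs :: "complex poly poly \<Rightarrow> complex \<Rightarrow> complex poly" where
  "eval_coeffs P x = map_poly (\<lambda>c. poly c x) P"

lemma coeff_eval_coeffs [simp]: "coeff (eval_coeffs P x) j = poly (coeff P j) x"
  unfolding eval_coeffs_def by (simp add: coeff_map_poly)

lemma eval_coeffs_add [simp]: "eval_coeffs (P + Q) x = eval_coeffs P x + eval_coeffs Q x"
  by (rule poly_eqI) simp

lemma eval_coeffs_mult [simp]: "eval_coeffs (P * Q) x = eval_coeffs P x * eval_coeffs Q x"
  by (rule poly_eqI) (simp add: coeff_mult poly_sum)

lemma eval_coeffs_smult [simp]: "eval_coeffs (smult c P) x = smult (poly c x) (eval_coeffs P x)"
  by (rule poly_eqI) simp

lemma eval_coeffs_pderiv [simp]: "eval_coeffs (pderiv P) x = pderiv (eval_coeffs P x)"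
  by (rule poly_eqI) (simp add: coeff_pderiv)

lemma eval_coeffs_const [simp]: "eval_coeffs [:c:] x = [:poly c x:]"
  by (rule poly_eqI) (simp add: coeff_pCons split: nat.split)

lemma degree_eval_coeffs_le: "degree (eval_coeffs P x) \<le> degree P"
  by (rule degree_le) (simp add: coeff_eq_0)

lemma degree_eval_coeffs: "poly (lead_coeff P) x \<noteq> 0 \<Longrightarrow> degree (eval_coeffs P x) = degree P"
  by (rule antisym[OF degree_eval_coeffs_le le_degree]) simp

lemma poly_nonzero_punctured_nhd:
  fixes c :: "complex poly"
  assumes "c \<noteq> 0"
  obtains e where "e > 0" "\<And>z. z \<noteq> 0 \<Longrightarrow> norm z < e \<Longrightarrow> poly c z \<noteq> 0"
proof -
  have "finite {z. poly c z = 0}" using assms by (rule poly_roots_finite)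
  then obtain e where "e > 0" "\<forall>z\<in>{z. poly c z = 0}. z \<noteq> 0 \<longrightarrow> e \<le> dist 0 z"
    using finite_set_avoid by metis
  then show ?thesis using that[of e] by force
qed

lemma poly_nonzero_at_right_0:
  fixes c :: "complex poly"
  assumes "c \<noteq> 0"
  shows "\<forall>\<^sub>F x in at_right 0. poly c (of_real x) \<noteq> 0"
proof -
  obtain e where "e > 0" "\<And>z. z \<noteq> 0 \<Longrightarrow> norm z < e \<Longrightarrow> poly c z \<noteq> 0"
    using poly_nonzero_punctured_nhd[OF assms] by blast
  then show ?thesis
    unfolding eventually_at_right_field by (intro exI[of _ e]) auto
qed

text \<open>The inner variable is the argument \<mu>, the outer one the value
  \<open>f \<mu>\<close>. Coefficients are complex so that the specialised polynomials split. Only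
  the germ at 0+ counts, so finitely many bad \<mu> can be discarded.\<close>

definition annihilates :: "(real \<Rightarrow> real) \<Rightarrow> complex poly poly \<Rightarrow> bool" where
  "annihilates f P \<longleftrightarrow>
     (\<forall>\<^sub>F x in at_right 0. poly (eval_coeffs P (of_real x)) (of_real (f x)) = 0)"

lemma annihilates_degree_pos:
  assumes "annihilates f P" "P \<noteq> 0"
  shows "degree P > 0"
proof (rule ccontr)
  assume "\<not> degree P > 0"
  then obtain c where c: "P = [:c:]" by (metis degree_eq_zeroE not_gr_zero)
  then have "\<forall>\<^sub>F x in at_right 0. poly c (complex_of_real x) \<noteq> 0"
    using assms poly_nonzero_at_right_0[of c] by simp
  moreover have "\<forall>\<^sub>F x in at_right 0. poly c (complex_of_real x) = 0"
    using assms c by (simp add: annihilates_def)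
  ultimately have "\<forall>\<^sub>F x in at_right (0::real). False"
    by eventually_elim simp
  then show False by simp
qed

text \<open>Among the annihilating polynomials one of least degree is squarefree over
  \<open>\<complex>(\<mu>)\<close>: otherwise the quotient by its common factor with the derivative, found here as an
  element of least degree in the ideal they generate, would still annihilate.\<close>

lemma annihilator_squarefree:
  assumes "annihilates f P" "P \<noteq> 0"
  obtains Q A B r where "annihilates f Q" "Q \<noteq> 0" "degree Q \<le> degree P"
    "r \<noteq> 0" "A * Q + B * pderiv Q = [:r:]"
proof -
  define N where "N Q \<longleftrightarrow> annihilates f Q \<and> Q \<noteq> 0" for Q
  define Q where "Q = arg_min degree N"
  have "N P" using assms by (simp add: N_def)
  then have NQ: "N Q" and Qmin: "\<And>R. N R \<Longrightarrow> degree Q \<le> degree R"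
    unfolding Q_def by (auto intro: arg_min_natI arg_min_nat_le)
  define I where "I G \<longleftrightarrow> G \<noteq> 0 \<and> (\<exists>A B. G = A * Q + B * pderiv Q)" for G
  define G where "G = arg_min degree I"
  have "Q = 1 * Q + 0 * pderiv Q" by simp
  then have "I Q" unfolding I_def using NQ N_def by blast
  then have IG: "I G" and Gmin: "\<And>R. I R \<Longrightarrow> degree G \<le> degree R"
    unfolding G_def by (auto intro: arg_min_natI arg_min_nat_le)
  obtain A B where AB: "G = A * Q + B * pderiv Q" using IG I_def by auto
  have G0: "G \<noteq> 0" using IG I_def by auto
  have divides: "\<exists>c H. c \<noteq> 0 \<and> smult c F = G * H" if F: "F = Q \<or> F = pderiv Q" for F
  proof -
    \<comment> \<open>Coefficients lie in a ring, so \<open>F\<close> must be scaled by a power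
      \<open>c\<close> of the leading coefficient of \<open>G\<close> before division. The remainder
      lies in the ideal, hence is 0 by minimality of \<open>G\<close>.\<close>
    obtain q r where qr: "pseudo_divmod F G = (q, r)" by fastforce
    define c where "c = coeff G (degree G) ^ (Suc (degree F) - degree G)"
    have 1: "smult c F = G * q + r" and 2: "r = 0 \<or> degree r < degree G"
      using pseudo_divmod[OF G0 qr] by (auto simp: c_def)
    have c0: "c \<noteq> 0" using G0 by (simp add: c_def)
    have "r = [:c:] * F - G * q" using 1 by simp
    then have "(\<exists>A B. r = A * Q + B * pderiv Q)"
    proof -
      assume r: "r = [:c:] * F - G * q"
      show ?thesis
      proof (cases "F = Q")
        case True
        then have "r = ([:c:] - A * q) * Q + (- (B * q)) * pderiv Q"
          using r AB by (simp add: algebra_simps)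
        then show ?thesis by blast
      next
        case False
        then have "r = (- (A * q)) * Q + ([:c:] - B * q) * pderiv Q"
          using r AB F by (simp add: algebra_simps)
        then show ?thesis by blast
      qed
    qed
    then have "r = 0" using 2 Gmin[of r] unfolding I_def by fastforce
    then show ?thesis using 1 c0 by auto
  qed
  obtain c H where c: "c \<noteq> 0" "smult c Q = G * H" using divides by blast
  obtain c' K where c': "c' \<noteq> 0" "smult c' (pderiv Q) = G * K" using divides by blast
  have Q0: "Q \<noteq> 0" using NQ by (simp add: N_def)
  have H0: "H \<noteq> 0"
  proof
    assume "H = 0"
    then have "smult c Q = 0" by (simp add: c(2))
    then show False using c(1) Q0 by simp
  qed
  have dGH: "degree Q = degree G + degree H"
    using arg_cong[OF c(2), of degree] c(1) H0 G0 by (simp add: degree_mult_eq)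
  have Qd: "degree Q > 0" using NQ annihilates_degree_pos[of f Q] by (simp add: N_def)
  have "annihilates f H"
  proof -
    have "\<forall>\<^sub>F x in at_right 0. poly (eval_coeffs Q (of_real x)) (of_real (f x)) = 0"
      using NQ by (simp add: N_def annihilates_def)
    moreover have "\<forall>\<^sub>F x in at_right 0. poly (lead_coeff Q) (of_real x) \<noteq> 0"
      using NQ by (intro poly_nonzero_at_right_0) (simp add: N_def)
    moreover note poly_nonzero_at_right_0[OF c(1)] poly_nonzero_at_right_0[OF c'(1)]
    ultimately have "\<forall>\<^sub>F x in at_right 0. poly (eval_coeffs H (of_real x)) (of_real (f x)) = 0"
    proof eventually_elim
      case (elim x)
      define X where "X = complex_of_real x"
      note elim = elim[folded X_def]
      have dp: "degree (eval_coeffs Q X) > 0" using degree_eval_coeffs[OF elim(2)] Qd by simp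
      have 1: "smult (poly c X) (eval_coeffs Q X) = eval_coeffs G X * eval_coeffs H X"
        using c(2) eval_coeffs_smult[of c Q X] by simp
      have 2: "smult (poly c' X) (pderiv (eval_coeffs Q X)) = eval_coeffs G X * eval_coeffs K X"
        using c'(2) eval_coeffs_smult[of c' "pderiv Q" X] by simp
      \<comment> \<open>At a fixed \<open>x\<close> where \<open>c\<close> and \<open>c'\<close> do
        not vanish, these are identities between polynomials in one variable. Dividing out the
        common factor with the derivative keeps every root, so \<open>f x\<close> is still a root of
        \<open>H\<close>.\<close>
      have "rsquarefree (smult (1 / poly c X) (eval_coeffs H X)) \<and>
        (\<forall>a. (poly (smult (1 / poly c X) (eval_coeffs H X)) a = 0) = (poly (eval_coeffs Q X) a = 0))"
      proof (rule poly_squarefree_decomp)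
        show "pderiv (eval_coeffs Q X) \<noteq> 0" using dp by (simp add: pderiv_eq_0_iff)
        show "eval_coeffs Q X = smult (1 / poly c X) (eval_coeffs H X) * eval_coeffs G X"
          using arg_cong[OF 1, of "smult (1 / poly c X)"] elim(3) by (simp add: mult.commute)
        show "pderiv (eval_coeffs Q X) = smult (1 / poly c' X) (eval_coeffs K X) * eval_coeffs G X"
          using arg_cong[OF 2, of "smult (1 / poly c' X)"] elim(4) by (simp add: mult.commute)
        show "eval_coeffs G X = eval_coeffs A X * eval_coeffs Q X + eval_coeffs B X * pderiv (eval_coeffs Q X)"
          unfolding AB by simp
      qed
      then show ?case using elim by (simp add: X_def)
    qed
    then show ?thesis by (simp add: annihilates_def)
  qed
  \<comment> \<open>Minimality of \<open>Q\<close> now forces \<open>G\<close> to be constant in the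
    outer variable, which turns its representation into the Bezout identity.\<close>
  then have "degree Q \<le> degree H" using Qmin H0 by (simp add: N_def)
  then have "degree G = 0" using dGH by simp
  then obtain r where "G = [:r:]" by (rule degree_eq_zeroE)
  then show ?thesis
    using that[of Q r A B] NQ AB G0 Qmin[OF \<open>N P\<close>] by (auto simp: N_def)
qed

section \<open>Roots of a continuous family of squarefree polynomials\<close>

text \<open>Constant degree prevents roots from escaping to infinity, squarefreeness prevents them
  from colliding; hence the roots form a covering of \<open>U\<close> with \<open>d\<close>
  sheets.\<close>

locale squarefree_family =
  fixes q :: "complex \<Rightarrow> complex poly" and U :: "complex set" and d :: nat
  assumes open_U: "open U"
    and deg: "w \<in> U \<Longrightarrow> degree (q w) = d"
    and d_pos: "d > 0"
    and sqf: "w \<in> U \<Longrightarrow> rsquarefree (q w)"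
    and cont: "continuous_on U (\<lambda>w. coeff (q w) j)"
begin

abbreviation "roots w \<equiv> {z. poly (q w) z = 0}"

lemma nonzero: "w \<in> U \<Longrightarrow> q w \<noteq> 0"
  using deg d_pos by fastforce

lemma finite_roots: "w \<in> U \<Longrightarrow> finite (roots w)"
  using nonzero poly_roots_finite by blast

lemma poly_factored:
  assumes "w \<in> U"
  shows "poly (q w) x = lead_coeff (q w) * (\<Prod>z\<in>roots w. x - z)"
  using arg_cong[OF complex_poly_decompose_rsquarefree[OF sqf[OF assms]], of "\<lambda>p. poly p x"]
  by (simp add: poly_prod)

lemma card_roots:
  assumes "w \<in> U"
  shows "card (roots w) = d"
proof -
  have "degree (smult (lead_coeff (q w)) (\<Prod>z\<in>roots w. [:-z, 1:])) = card (roots w)"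
    using nonzero[OF assms] by (simp add: degree_prod_eq_sum_degree)
  then show ?thesis
    unfolding complex_poly_decompose_rsquarefree[OF sqf[OF assms]] using deg[OF assms] by simp
qed

lemma poly_eq_sum: "w \<in> U \<Longrightarrow> poly (q w) x = (\<Sum>j\<le>d. coeff (q w) j * x ^ j)"
  using deg by (simp add: poly_altdef)

text \<open>The product of the distances from \<open>z\<close> to the roots of \<open>q v\<close> is
  the norm of \<open>q v\<close> at \<open>z\<close> over that of the leading coefficient. It is 0
  at \<open>v = w\<close>, so by continuity it stays below \<open>e ^ d\<close> nearby, and then
  some factor is below \<open>e\<close>.\<close>

lemma root_nearby:
  assumes w: "w \<in> U" and z: "poly (q w) z = 0" and e: "e > 0"
  obtains r where "r > 0" "ball w r \<subseteq> U"
    "\<And>v. v \<in> ball w r \<Longrightarrow> \<exists>z'. poly (q v) z' = 0 \<and> dist z' z < e"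
proof -
  define h where "h v = norm (poly (q v) z) - norm (coeff (q v) d) * e ^ d" for v
  have "continuous_on U (\<lambda>v. norm (\<Sum>j\<le>d. coeff (q v) j * z ^ j) - norm (coeff (q v) d) * e ^ d)"
    by (intro continuous_intros cont)
  then have "continuous_on U h"
    by (rule continuous_on_eq) (simp add: h_def poly_eq_sum)
  moreover have lc0: "coeff (q w) d \<noteq> 0"
    using nonzero[OF w] deg[OF w] leading_coeff_0_iff by metis
  then have "h w < 0"
    using lc0 z e by (simp add: h_def)
  ultimately have "\<forall>\<^sub>F v in at w. h v < 0"
    using w open_U by (metis at_within_open continuous_on_def order_tendstoD(2))
  then have "\<forall>\<^sub>F v in nhds w. h v < 0"
    using \<open>h w < 0\<close> by (simp add: eventually_nhds_conv_at)
  then have "\<forall>\<^sub>F v in nhds w. h v < 0 \<and> v \<in> U"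
    using open_U w by (simp add: eventually_conj_iff eventually_nhds_in_open)
  then obtain r where r: "r > 0" "\<And>v. dist v w < r \<Longrightarrow> h v < 0 \<and> v \<in> U"
    by (auto simp: eventually_nhds_metric)
  show ?thesis
  proof (rule that[OF r(1)])
    show "ball w r \<subseteq> U" using r by (auto simp: dist_commute)
    fix v assume "v \<in> ball w r"
    then have v: "h v < 0" "v \<in> U" using r by (auto simp: dist_commute)
    show "\<exists>z'. poly (q v) z' = 0 \<and> dist z' z < e"
    proof (rule ccontr)
      assume "\<not> ?thesis"
      then have "\<And>z'. z' \<in> roots v \<Longrightarrow> e \<le> norm (z - z')"
        by (auto simp: dist_norm norm_minus_commute not_less)
      then have "(\<Prod>z'\<in>roots v. e) \<le> (\<Prod>z'\<in>roots v. norm (z - z'))"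
        using e by (intro prod_mono) auto
      then have "norm (coeff (q v) d) * e ^ d \<le> norm (coeff (q v) d) * (\<Prod>z'\<in>roots v. norm (z - z'))"
        using card_roots[OF v(2)] by (intro mult_left_mono) auto
      also have "\<dots> = norm (poly (q v) z)"
        by (simp add: poly_factored[OF v(2), of z] deg[OF v(2)] norm_mult prod_norm)
      finally show False using v(1) by (simp add: h_def)
    qed
  qed
qed


text \<open>With \<open>e\<close> at most half the least distance between roots of
  \<open>q w\<close>, the \<open>d\<close> discs of radius \<open>e\<close> around them are
  disjoint. Each contains a root of \<open>q v\<close>, and \<open>q v\<close> has only
  \<open>d\<close> roots, so each contains exactly one and none lies outside.\<close>

lemma unique_roots_nearby:
  assumes w: "w \<in> U"
  obtains r e where "r > 0" "e > 0" "ball w r \<subseteq> U"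
    "\<And>v z. v \<in> ball w r \<Longrightarrow> z \<in> roots w \<Longrightarrow> \<exists>!z'. z' \<in> roots v \<and> dist z' z < e"
    "\<And>v z'. v \<in> ball w r \<Longrightarrow> z' \<in> roots v \<Longrightarrow> \<exists>z\<in>roots w. dist z' z < e"
    "\<And>z1 z2 x. z1 \<in> roots w \<Longrightarrow> z2 \<in> roots w \<Longrightarrow> dist x z1 < e \<Longrightarrow> dist x z2 < e \<Longrightarrow> z1 = z2"
proof -
  obtain e where e: "e > 0" and sep: "\<And>z1 z2. z1 \<in> roots w \<Longrightarrow> z2 \<in> roots w \<Longrightarrow> z1 \<noteq> z2 \<Longrightarrow> 2 * e \<le> dist z1 z2"
  proof -
    have "\<exists>e>0. \<forall>z1\<in>roots w. z1 \<noteq> z2 \<longrightarrow> e \<le> dist z2 z1" for z2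
      using finite_set_avoid[OF finite_roots[OF w]] by blast
    then obtain \<epsilon> where \<epsilon>: "\<And>z2. \<epsilon> z2 > 0" "\<And>z1 z2. z1 \<in> roots w \<Longrightarrow> z1 \<noteq> z2 \<Longrightarrow> \<epsilon> z2 \<le> dist z2 z1"
      by metis
    define e where "e = Min (insert 1 (\<epsilon> ` roots w)) / 2"
    have e0: "e > 0" using finite_roots[OF w] \<epsilon>(1) by (simp add: e_def)
    have e1: "2 * e \<le> \<epsilon> z" if "z \<in> roots w" for z
      using finite_roots[OF w] that by (simp add: e_def Min_le_iff)
    show ?thesis
    proof (rule that[OF e0])
      fix z1 z2 assume "z1 \<in> roots w" "z2 \<in> roots w" "z1 \<noteq> z2"
      then show "2 * e \<le> dist z1 z2"
        using order_trans[OF e1 \<epsilon>(2)[of z2 z1]] by simp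
    qed
  qed
  have sep': "z1 = z2" if "z1 \<in> roots w" "z2 \<in> roots w" "dist x z1 < e" "dist x z2 < e" for z1 z2 x
    using sep[OF that(1,2)] that(3,4) dist_triangle3[of z1 z2 x] by linarith
  have "\<exists>r. r > 0 \<and> ball w r \<subseteq> U \<and> (\<forall>v\<in>ball w r. \<exists>z'. poly (q v) z' = 0 \<and> dist z' z < e)"
    if "z \<in> roots w" for z
  proof -
    have "poly (q w) z = 0" using that by simp
    then obtain r where "r > 0" "ball w r \<subseteq> U"
      "\<And>v. v \<in> ball w r \<Longrightarrow> \<exists>z'. poly (q v) z' = 0 \<and> dist z' z < e"
      using root_nearby[OF w _ e, of z] by blast
    then show ?thesis by blast
  qed
  then obtain \<rho> where \<rho>: "\<And>z. z \<in> roots w \<Longrightarrow> \<rho> z > 0 \<and> ball w (\<rho> z) \<subseteq> U \<and>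
      (\<forall>v\<in>ball w (\<rho> z). \<exists>z'. poly (q v) z' = 0 \<and> dist z' z < e)"
    using bchoice[of "roots w" "\<lambda>z r. r > 0 \<and> ball w r \<subseteq> U \<and>
      (\<forall>v\<in>ball w r. \<exists>z'. poly (q v) z' = 0 \<and> dist z' z < e)"] by blast
  have ne: "roots w \<noteq> {}" using card_roots[OF w] d_pos by force
  define r where "r = Min (\<rho> ` roots w)"
  have r0: "r > 0" using finite_roots[OF w] ne \<rho> by (simp add: r_def)
  have r\<rho>: "ball w r \<subseteq> ball w (\<rho> z)" if "z \<in> roots w" for z
    using finite_roots[OF w] that by (intro subset_ball) (simp add: r_def)
  have rU: "ball w r \<subseteq> U" using ne r\<rho> \<rho> by blast
  have ex: "\<exists>z'. z' \<in> roots v \<and> dist z' z < e" if "v \<in> ball w r" "z \<in> roots w" for v z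
    using r\<rho>[OF that(2)] that \<rho>[OF that(2)] by blast
  have all: "\<exists>g. bij_betw g (roots w) (roots v) \<and> (\<forall>z\<in>roots w. dist (g z) z < e)" if v: "v \<in> ball w r" for v
  proof -
    obtain g where g: "\<And>z. z \<in> roots w \<Longrightarrow> g z \<in> roots v \<and> dist (g z) z < e"
      using bchoice[of "roots w" "\<lambda>z z'. z' \<in> roots v \<and> dist z' z < e"] ex[OF v] by blast
    have inj: "inj_on g (roots w)"
    proof (rule inj_onI)
      fix x y assume "x \<in> roots w" "y \<in> roots w" "g x = g y"
      then show "x = y" using g[of x] g[of y] sep'[of x y "g x"] by simp
    qed
    have "v \<in> U" using v rU by blast
    then have "g ` roots w = roots v"
      using g card_roots[OF w] card_roots[of v] card_image[OF inj]
      by (intro card_subset_eq finite_roots) auto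
    then show ?thesis using inj g unfolding bij_betw_def by blast
  qed
  show ?thesis
  proof (rule that[OF r0 e rU])
    fix v z assume v: "v \<in> ball w r" and z: "z \<in> roots w"
    obtain g where g: "bij_betw g (roots w) (roots v)" "\<forall>z\<in>roots w. dist (g z) z < e"
      using all[OF v] by blast
    have uniq: "z' = g z" if z': "z' \<in> roots v" "dist z' z < e" for z'
    proof -
      obtain z2 where "z2 \<in> roots w" "z' = g z2"
      proof -
        have "z' \<in> g ` roots w" using z' g(1) by (simp add: bij_betw_def)
        then show ?thesis using that by (auto simp del: mem_Collect_eq)
      qed
      then show ?thesis using g(2) z' z sep'[of z2 z z'] by blast
    qed
    have "g z \<in> roots v" using g(1) z bij_betwE by blast
    then show "\<exists>!z'. z' \<in> roots v \<and> dist z' z < e"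
      using g(2) z uniq by (intro ex1I[of _ "g z"]) blast+
  next
    fix v z' assume v: "v \<in> ball w r" and z': "z' \<in> roots v"
    obtain g where g: "bij_betw g (roots w) (roots v)" "\<forall>z\<in>roots w. dist (g z) z < e"
      using all[OF v] by blast
    have "z' \<in> g ` roots w" using z' g(1) by (simp add: bij_betw_def)
    then obtain z where z: "z' = g z" "z \<in> roots w" by (rule imageE)
    then show "\<exists>z\<in>roots w. dist z' z < e"
      using g(2) by (intro bexI[of _ z]) simp_all
  qed (rule sep')
qed

definition root_space :: "(complex \<times> complex) set" where
  "root_space = {(w, z). w \<in> U \<and> poly (q w) z = 0}"

text \<open>Over a small ball the sheets are the parts of \<open>root_space\<close> close to the
  individual roots of \<open>q w\<close>; the inverse of the projection on a sheet sends
  \<open>v\<close> to the unique root of \<open>q v\<close> near the chosen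
  \<open>z\<close>.\<close>

lemma root_covering: "covering_space root_space fst U"
  unfolding covering_space_def
proof (intro conjI ballI)
  show "continuous_on root_space fst" by (intro continuous_intros)
  show "fst ` root_space = U"
  proof
    show "U \<subseteq> fst ` root_space"
    proof
      fix w assume w: "w \<in> U"
      then have "roots w \<noteq> {}" using card_roots[OF w] d_pos by force
      then show "w \<in> fst ` root_space" using w by (force simp: root_space_def)
    qed
  qed (auto simp: root_space_def)
  fix w assume w: "w \<in> U"
  obtain r e where re: "r > 0" "e > 0" "ball w r \<subseteq> U"
    and uniq: "\<And>v z. v \<in> ball w r \<Longrightarrow> z \<in> roots w \<Longrightarrow> \<exists>!z'. z' \<in> roots v \<and> dist z' z < e"
    and ex: "\<And>v z'. v \<in> ball w r \<Longrightarrow> z' \<in> roots v \<Longrightarrow> \<exists>z\<in>roots w. dist z' z < e"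
    and sep: "\<And>z1 z2 x. z1 \<in> roots w \<Longrightarrow> z2 \<in> roots w \<Longrightarrow> dist x z1 < e \<Longrightarrow> dist x z2 < e \<Longrightarrow> z1 = z2"
    using unique_roots_nearby[OF w] by blast
  define V where "V = ball w r"
  define sheet where "sheet z = root_space \<inter> (ball w r \<times> ball z e)" for z
  have VU: "V \<subseteq> U" using re by (simp add: V_def)
  show "\<exists>T. w \<in> T \<and> openin (top_of_set U) T \<and>
      (\<exists>v. \<Union> v = root_space \<inter> fst -` T \<and> (\<forall>u\<in>v. openin (top_of_set root_space) u) \<and>
        pairwise disjnt v \<and> (\<forall>u\<in>v. \<exists>q. homeomorphism u T fst q))"
  proof (intro exI[of _ V] exI[of _ "sheet ` roots w"] conjI ballI)
    show "w \<in> V" using re by (simp add: V_def)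
    show "openin (top_of_set U) V" by (rule open_subset[OF VU]) (simp add: V_def)
    show "\<Union> (sheet ` roots w) = root_space \<inter> fst -` V"
    proof
      show "root_space \<inter> fst -` V \<subseteq> \<Union> (sheet ` roots w)"
      proof
        fix p assume p: "p \<in> root_space \<inter> fst -` V"
        obtain v z' where vz: "p = (v, z')" by fastforce
        with p have "v \<in> ball w r" "z' \<in> roots v" by (auto simp: V_def root_space_def)
        then obtain z where "z \<in> roots w" "dist z' z < e" using ex by blast
        then show "p \<in> \<Union> (sheet ` roots w)"
          using p vz by (auto simp: sheet_def V_def dist_commute)
      qed
    qed (auto simp: sheet_def V_def)
    show "pairwise disjnt (sheet ` roots w)"
    proof (rule pairwise_imageI)
      fix z1 z2 assume z: "z1 \<in> roots w" "z2 \<in> roots w" "z1 \<noteq> z2"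
      then show "disjnt (sheet z1) (sheet z2)"
        using sep[OF z(1,2)] by (auto simp: sheet_def disjnt_iff dist_commute)
    qed
  next
    fix u assume "u \<in> sheet ` roots w"
    then obtain z where z: "z \<in> roots w" "u = sheet z" by blast
    show "openin (top_of_set root_space) u"
      unfolding z sheet_def by (intro openin_open_Int open_Times open_ball)
    define g where "g v = (THE z'. z' \<in> roots v \<and> dist z' z < e)" for v
    have g: "g v \<in> roots v \<and> dist (g v) z < e" if "v \<in> V" for v
      unfolding g_def using uniq[OF that[unfolded V_def] z(1)] by (rule theI')
    have g_eq: "z' = g v" if "v \<in> V" "z' \<in> roots v" "dist z' z < e" for v z'
      using uniq[OF that(1)[unfolded V_def] z(1)] g[OF that(1)] that by blast
    have contg: "continuous_on V g"
      unfolding continuous_on_iff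
    proof (intro ballI allI impI)
      fix v \<epsilon> assume v: "v \<in> V" and \<epsilon>: "(\<epsilon>::real) > 0"
      \<comment> \<open>The second term keeps a root within \<open>\<epsilon>'\<close> of
        \<open>g v\<close> inside the disc around \<open>z\<close>, where uniqueness identifies it
        with \<open>g v'\<close>.\<close>
      define \<epsilon>' where "\<epsilon>' = min \<epsilon> (e - dist (g v) z)"
      have "\<epsilon>' > 0" using g[OF v] \<epsilon> by (simp add: \<epsilon>'_def)
      then obtain s where s: "s > 0" "\<And>v'. v' \<in> ball v s \<Longrightarrow> \<exists>z'. poly (q v') z' = 0 \<and> dist z' (g v) < \<epsilon>'"
      proof -
        have "v \<in> U" "poly (q v) (g v) = 0" using v VU g[OF v] by auto
        then show ?thesis using root_nearby[of v "g v" \<epsilon>'] \<open>\<epsilon>' > 0\<close> that by blast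
      qed
      show "\<exists>s>0. \<forall>v'\<in>V. dist v' v < s \<longrightarrow> dist (g v') (g v) < \<epsilon>"
      proof (intro exI[of _ s] conjI ballI impI s(1))
        fix v' assume v': "v' \<in> V" "dist v' v < s"
        then obtain z' where z': "poly (q v') z' = 0" "dist z' (g v) < \<epsilon>'"
          using s(2)[of v'] by (auto simp: dist_commute)
        have "dist z' z < e"
          using z'(2) dist_triangle[of z' z "g v"] by (simp add: \<epsilon>'_def)
        then have "z' = g v'" using g_eq v' z' by simp
        then show "dist (g v') (g v) < \<epsilon>" using z' by (simp add: \<epsilon>'_def)
      qed
    qed
    have "homeomorphism (sheet z) V fst (\<lambda>v. (v, g v))"
      unfolding homeomorphism_def
    proof (intro conjI ballI)
      show "continuous_on (sheet z) fst" "continuous_on V (\<lambda>v. (v, g v))"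
        by (intro continuous_intros contg)+
      have in_sheet: "(v, g v) \<in> sheet z" if "v \<in> V" for v
        using g[OF that] that VU by (auto simp: sheet_def root_space_def V_def dist_commute)
      have sheet_g: "p = (fst p, g (fst p)) \<and> fst p \<in> V" if "p \<in> sheet z" for p
        using that g_eq[of "fst p" "snd p"]
        by (auto simp: sheet_def root_space_def V_def dist_commute)
      show "fst ` sheet z = V" using in_sheet sheet_g by force
      show "(\<lambda>v. (v, g v)) ` V = sheet z" using in_sheet sheet_g by force
      show "(fst p, g (fst p)) = p" if "p \<in> sheet z" for p using sheet_g[OF that] by simp
      show "fst (v, g v) = v" if "v \<in> V" for v by simp
    qed
    then show "\<exists>q. homeomorphism u V fst q" using z by blast
  qed
qed

text \<open>A section is a lift of the identity of \<open>U\<close> through the covering, available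
  because \<open>U\<close> is simply connected and, being open, locally path connected.\<close>

lemma root_section_exists:
  assumes "simply_connected U" "w \<in> U" "poly (q w) z = 0"
  obtains F where "continuous_on U F" "\<And>v. v \<in> U \<Longrightarrow> poly (q v) (F v) = 0" "F w = z"
proof -
  have "(w, z) \<in> root_space" using assms by (simp add: root_space_def)
  then obtain g where g: "continuous_on U g" "g \<in> U \<rightarrow> root_space" "g w = (w, z)"
      "\<And>y. y \<in> U \<Longrightarrow> fst (g y) = y"
    by (rule covering_space_lift_strong[OF root_covering _ assms(2,1)
          open_imp_locally_path_connected[OF open_U] continuous_on_id, of "(w,z)"]) auto
  show ?thesis
  proof (rule that[of "\<lambda>v. snd (g v)"])
    show "continuous_on U (\<lambda>v. snd (g v))" by (intro continuous_intros g)
    fix v assume v: "v \<in> U"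
    then have "g v \<in> root_space" using g(2) by blast
    then show "poly (q v) (snd (g v)) = 0"
      using g(4)[OF v] by (auto simp: root_space_def)
  qed (simp add: g)
qed

text \<open>Both maps lift the inclusion of the connected set \<open>T\<close>. Taking for
  \<open>T\<close> a real ray identifies a section with a given real function; taking
  \<open>T = U\<close> yields periodicity.\<close>

lemma root_section_unique:
  assumes "T \<subseteq> U" "connected T" "a \<in> T" "x \<in> T" "F a = G a"
    and "continuous_on T F" "\<And>v. v \<in> T \<Longrightarrow> poly (q v) (F v) = 0"
    and "continuous_on T G" "\<And>v. v \<in> T \<Longrightarrow> poly (q v) (G v) = 0"
  shows "F x = G x"
proof -
  have "(x, F x) = (x, G x)"
    by (rule covering_space_lift_unique[OF root_covering _ continuous_on_id[of T],
          of "\<lambda>v. (v, F v)" a "\<lambda>v. (v, G v)"])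
       (use assms in \<open>auto simp: root_space_def intro!: continuous_intros\<close>)
  then show ?thesis by simp
qed

text \<open>With \<open>z = F w\<close>, dividing the difference of \<open>q v\<close> at
  \<open>F v\<close> and at \<open>z\<close> by \<open>F v - z\<close> leaves the continuous factor
  \<open>K\<close>. Its value at \<open>w\<close> is the derivative of \<open>q w\<close> at a
  simple root, hence nonzero, so the difference quotient of \<open>F\<close> converges because
  \<open>L\<close>, the value of \<open>q v\<close> at the fixed \<open>z\<close>, is
  holomorphic.\<close>

lemma root_section_holomorphic:
  assumes hol: "\<And>j. (\<lambda>w. coeff (q w) j) holomorphic_on U"
    and F: "continuous_on U F" "\<And>v. v \<in> U \<Longrightarrow> poly (q v) (F v) = 0"
  shows "F holomorphic_on U"
  unfolding holomorphic_on_open[OF open_U]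
proof (intro ballI)
  fix w assume w: "w \<in> U"
  define c where "c j = (\<lambda>v. coeff (q v) j)" for j
  define z where "z = F w"
  define K where "K v = (\<Sum>j\<le>d. c j v * (\<Sum>i<j. z ^ (j - Suc i) * F v ^ i))" for v
  define L where "L v = (\<Sum>j\<le>d. c j v * z ^ j)" for v
  have "L holomorphic_on U" unfolding L_def c_def by (intro holomorphic_intros hol)
  then obtain D where D: "(L has_field_derivative D) (at w)"
    using w open_U holomorphic_on_open by blast
  have Fw: "isCont F w" and cw: "\<And>j. isCont (c j) w"
    using F(1) cont w open_U by (auto simp: c_def continuous_on_eq_continuous_at)
  have "isCont K w" unfolding K_def by (intro continuous_intros Fw cw)
  have key: "(F v - z) * K v = - L v" if "v \<in> U" for v
  proof -
    have "0 = (\<Sum>j\<le>d. c j v * F v ^ j)"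
      using F(2)[OF that] poly_eq_sum[OF that] by (simp add: c_def)
    then have "- L v = (\<Sum>j\<le>d. c j v * (F v ^ j - z ^ j))"
      by (simp add: L_def right_diff_distrib sum_subtractf)
    also have "\<dots> = (F v - z) * K v"
      unfolding K_def
      by (subst sum_distrib_left, intro sum.cong refl) (simp add: power_diff_sumr2[of "F v"] mult_ac)
    finally show ?thesis by simp
  qed
  have Kw: "K w = poly (pderiv (q w)) z"
  proof -
    have "K w = (\<Sum>j\<le>d. of_nat j * c j w * z ^ (j - 1))"
      unfolding K_def
    proof (intro sum.cong refl)
      fix j
      have "(\<Sum>i<j. z ^ (j - Suc i) * F w ^ i) = (\<Sum>i<j. z ^ (j - 1))"
        by (intro sum.cong refl) (auto simp: z_def simp flip: power_add)
      then show "c j w * (\<Sum>i<j. z ^ (j - Suc i) * F w ^ i) = of_nat j * c j w * z ^ (j - 1)"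
        by simp
    qed
    also have "\<dots> = poly (pderiv (q w)) z"
    proof -
      have "((\<lambda>x. \<Sum>j\<le>d. c j w * x ^ j) has_field_derivative
          (\<Sum>j\<le>d. of_nat j * c j w * z ^ (j - 1))) (at z)"
        by (auto intro!: derivative_eq_intros sum.cong)
      moreover have "(\<lambda>x. \<Sum>j\<le>d. c j w * x ^ j) = poly (q w)"
        using poly_eq_sum[OF w] by (auto simp: c_def)
      ultimately have "(poly (q w) has_field_derivative
          (\<Sum>j\<le>d. of_nat j * c j w * z ^ (j - 1))) (at z)"
        by simp
      then show ?thesis by (rule DERIV_unique[OF _ poly_DERIV])
    qed
    finally show ?thesis .
  qed
  have "K w \<noteq> 0" using Kw F(2)[OF w] sqf[OF w] by (simp add: rsquarefree_roots z_def)
  have Lw: "L w = 0" using key[OF w] by (simp add: z_def)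
  have "((\<lambda>v. - ((L v - L w) / (v - w)) / K v) \<longlongrightarrow> - D / K w) (at w)"
    using D \<open>K w \<noteq> 0\<close> \<open>isCont K w\<close>
    by (intro tendsto_intros) (auto simp: has_field_derivative_iff isCont_def)
  moreover have "\<forall>\<^sub>F v in at w. K v \<noteq> 0"
    using \<open>isCont K w\<close> \<open>K w \<noteq> 0\<close> by (simp add: isCont_def tendsto_imp_eventually_ne)
  then have "\<forall>\<^sub>F v in at w. - ((L v - L w) / (v - w)) / K v = (F v - F w) / (v - w)"
    using eventually_at_in_open[OF open_U w]
  proof eventually_elim
    case (elim v)
    then have "L v = - ((F v - F w) * K v)" using key[of v] by (simp add: z_def)
    then show ?case using elim Lw by simp
  qed
  ultimately have "((\<lambda>v. (F v - F w) / (v - w)) \<longlongrightarrow> - D / K w) (at w)"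
    by (rule Lim_transform_eventually)
  then show "\<exists>f'. (F has_field_derivative f') (at w)"
    by (auto simp: has_field_derivative_iff)
qed

end

section \<open>Puiseux expansions\<close>

text \<open>In the coordinate \<open>w = log \<mu>\<close>, adding \<open>turns k\<close> means
  circling \<mu> = 0 \<open>k\<close> times.\<close>

definition turns :: "nat \<Rightarrow> complex" where
  "turns k = \<i> * (of_nat k * (of_real pi * 2))"

lemma exp_add_turns [simp]: "exp (w + turns k) = exp w"
  unfolding turns_def using exp_plus_2pin[of w "int k"] by simp

lemma Re_turns [simp]: "Re (turns k) = 0"
  by (simp add: turns_def)

lemma turns_add: "turns (j + k) = turns j + turns k"
  by (simp add: turns_def algebra_simps)

lemma turns_0 [simp]: "turns 0 = 0"
  by (simp add: turns_def)

section \<open>Uniform bounds for roots and the continued branch\<close>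

lemma norm_poly_le_sum_coeffs:
  fixes p :: "complex poly"
  assumes "norm z \<le> 1"
  shows "norm (poly p z) \<le> (\<Sum>i\<le>degree p. norm (coeff p i))"
  unfolding poly_altdef
proof (rule order_trans[OF norm_sum sum_mono])
  fix i
  have "norm z ^ i \<le> 1" using assms by (simp add: power_le_one)
  then show "norm (coeff p i * z ^ i) \<le> norm (coeff p i)"
    by (simp add: norm_mult norm_power mult_left_le)
qed

text \<open>Cauchy's root bound, multiplied by the leading coefficient so that it stays uniform when
  that coefficient tends to 0. For a root of norm above 1, isolate the top term and cancel
  \<open>norm z ^ (d - 1)\<close>.\<close>

lemma lead_coeff_mult_root_le:
  fixes p :: "complex poly"
  assumes root: "poly p z = 0" and d: "degree p = d" "d > 0"
    and M: "(\<Sum>j\<le>d. norm (coeff p j)) \<le> M"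
  shows "norm (coeff p d * z) \<le> M"
proof (cases "norm z \<le> 1")
  case True
  have "norm (coeff p d * z) \<le> norm (coeff p d)"
    using True by (simp add: norm_mult mult_left_le)
  also have "\<dots> \<le> (\<Sum>j\<le>d. norm (coeff p j))"
    by (rule member_le_sum) auto
  finally show ?thesis using M by simp
next
  case False
  obtain k where k: "d = Suc k" using d(2) gr0_implies_Suc by blast
  have "0 = (\<Sum>j\<le>d. coeff p j * z ^ j)" using root d by (simp add: poly_altdef)
  then have "coeff p d * z ^ d = - (\<Sum>j\<le>k. coeff p j * z ^ j)"
    by (simp add: k eq_neg_iff_add_eq_0 add.commute)
  then have "norm (coeff p d * z ^ d) \<le> (\<Sum>j\<le>k. norm (coeff p j) * norm z ^ j)"
    by (simp add: norm_mult norm_power order_trans[OF norm_sum] sum_mono)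
  also have "\<dots> \<le> (\<Sum>j\<le>k. norm (coeff p j) * norm z ^ k)"
    using False by (intro sum_mono mult_left_mono power_increasing) auto
  also have "\<dots> = (\<Sum>j\<le>k. norm (coeff p j)) * norm z ^ k"
    by (simp add: sum_distrib_right)
  finally have "norm (coeff p d * z) * norm z ^ k \<le> (\<Sum>j\<le>k. norm (coeff p j)) * norm z ^ k"
    by (simp add: k norm_mult norm_power mult.assoc)
  then have "norm (coeff p d * z) \<le> (\<Sum>j\<le>k. norm (coeff p j))"
    using False by (simp add: mult_le_cancel_right) (smt (verit) norm_ge_zero zero_less_power)
  also have "\<dots> \<le> (\<Sum>j\<le>d. norm (coeff p j))" by (simp add: k)
  finally show ?thesis using M by simp
qed

lemma holomorphic_on_poly_exp:
  "(\<lambda>w. poly (p :: complex poly) (exp w)) holomorphic_on S"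
  unfolding poly_altdef by (intro holomorphic_intros)

text \<open>The preimage of a punctured disc under \<open>exp\<close>; being convex it is simply
  connected, and it is invariant under \<open>turns\<close>.\<close>

abbreviation left_half :: "real \<Rightarrow> complex set" where
  "left_half R \<equiv> {w. Re w < R}"

text \<open>Besides the period, the pair \<open>c\<close>, \<open>M\<close> is delivered: it bounds
  the growth of \<open>F\<close> as \<mu> tends to 0 and so excludes an essential singularity
  later.\<close>

theorem puiseux_branch:
  fixes f :: "real \<Rightarrow> real"
  assumes e0: "e0 > 0" and contf: "continuous_on {0<..<e0} f"
    and P: "annihilates f P" "P \<noteq> 0"
  obtains R F \<rho> c M where "F holomorphic_on left_half R"
    "\<And>x. x < R \<Longrightarrow> F (of_real x) = of_real (f (exp x))"
    "\<rho> \<ge> 1" "\<rho> \<le> degree P" "\<And>w. w \<in> left_half R \<Longrightarrow> F (w + turns \<rho>) = F w"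
    "c \<noteq> 0" "\<And>w. w \<in> left_half R \<Longrightarrow> norm (poly c (exp w) * F w) \<le> M"
proof -
  obtain Q A B r where Q: "annihilates f Q" "Q \<noteq> 0" "degree Q \<le> degree P"
    and r: "r \<noteq> 0" "A * Q + B * pderiv Q = [:r:]"
    using annihilator_squarefree[OF P] .
  define d where "d = degree Q"
  have d0: "d > 0" using annihilates_degree_pos[OF Q(1,2)] by (simp add: d_def)
  have lc0: "lead_coeff Q \<noteq> 0" using Q(2) by simp
  obtain e1 where e1: "e1 > 0" "\<And>z. z \<noteq> 0 \<Longrightarrow> norm z < e1 \<Longrightarrow> poly r z \<noteq> 0"
    using poly_nonzero_punctured_nhd[OF r(1)] by blast
  obtain e2 where e2: "e2 > 0" "\<And>z. z \<noteq> 0 \<Longrightarrow> norm z < e2 \<Longrightarrow> poly (lead_coeff Q) z \<noteq> 0"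
    using poly_nonzero_punctured_nhd[OF lc0] by blast
  obtain e3 where e3: "e3 > 0"
      "\<And>x. 0 < x \<Longrightarrow> x < e3 \<Longrightarrow> poly (eval_coeffs Q (of_real x)) (of_real (f x)) = 0"
    using Q(1) unfolding annihilates_def eventually_at_right_field by auto
  \<comment> \<open>For \<mu> below \<epsilon>: \<open>f\<close> is continuous (\<open>e0\<close>),
    the coefficient bound applies (1), \<open>q w\<close> is squarefree (\<open>e1\<close>) of
    constant degree (\<open>e2\<close>), and \<open>f\<close> is a root (\<open>e3\<close>).\<close>
  define \<epsilon> where "\<epsilon> = min (min e0 1) (min e1 (min e2 e3))"
  have \<epsilon>0: "\<epsilon> > 0" using e0 e1 e2 e3 by (simp add: \<epsilon>_def)
  define R where "R = ln \<epsilon>"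
  define U where "U = left_half R"
  have exp_lt: "exp x < \<epsilon>" if "x < R" for x
    using that \<epsilon>0 by (simp add: R_def) (metis exp_less_cancel_iff exp_ln)
  have norm_exp_lt: "norm (exp w) < \<epsilon>" if "w \<in> U" for w
    using that exp_lt[of "Re w"] by (simp add: U_def)
  define q where "q w = eval_coeffs Q (exp w)" for w
  have degq: "degree (q w) = d" if "w \<in> U" for w
    using norm_exp_lt[OF that] e2(2)[of "exp w"] degree_eval_coeffs[of Q "exp w"]
    by (simp add: q_def d_def \<epsilon>_def)
  interpret squarefree_family q U d
  proof
    show "open U" by (simp add: U_def open_halfspace_Re_lt)
    show "d > 0" by (rule d0)
    fix w assume w: "w \<in> U"
    show "degree (q w) = d" by (rule degq[OF w])
    \<comment> \<open>A common root of \<open>q w\<close> and its derivative would make the left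
      side of the Bezout identity vanish, but \<open>r\<close> does not.\<close>
    have "poly r (exp w) \<noteq> 0"
      using norm_exp_lt[OF w] e1(2)[of "exp w"] by (simp add: \<epsilon>_def)
    moreover have "eval_coeffs A (exp w) * q w + eval_coeffs B (exp w) * pderiv (q w) = [:poly r (exp w):]"
      using arg_cong[OF r(2), of "\<lambda>P. eval_coeffs P (exp w)"] by (simp add: q_def)
    then have "poly (eval_coeffs A (exp w)) a * poly (q w) a + poly (eval_coeffs B (exp w)) a * poly (pderiv (q w)) a
        = poly r (exp w)" for a
      by (metis poly_add poly_mult poly_const_conv)
    ultimately show "rsquarefree (q w)"
      unfolding rsquarefree_roots by (metis add_0 mult_zero_right)
  next
    fix j show "continuous_on U (\<lambda>w. coeff (q w) j)"
      unfolding q_def coeff_eval_coeffs by (intro continuous_intros)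
  qed
  define x0 where "x0 = R - 1"
  define w0 where "w0 = complex_of_real x0"
  have w0: "w0 \<in> U" by (simp add: w0_def x0_def U_def)
  have f_root: "poly (q (of_real x)) (of_real (f (exp x))) = 0" if "x < R" for x
    using e3(2)[of "exp x"] exp_lt[OF that] by (simp add: q_def \<epsilon>_def flip: exp_of_real)
  have "simply_connected U"
    unfolding U_def by (intro convex_imp_simply_connected convex_halfspace_Re_lt)
  moreover have "poly (q w0) (of_real (f (exp x0))) = 0"
    unfolding w0_def by (rule f_root) (simp add: x0_def)
  ultimately obtain F where F: "continuous_on U F" "\<And>v. v \<in> U \<Longrightarrow> poly (q v) (F v) = 0"
      "F w0 = of_real (f (exp x0))"
    using root_section_exists[OF _ w0] by metis
  have holF: "F holomorphic_on U"
    by (rule root_section_holomorphic[OF _ F(1,2)])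
       (auto simp: q_def intro: holomorphic_on_poly_exp)
  \<comment> \<open>\<open>F\<close> was fixed only at \<open>w0\<close>. On the real ray
    \<open>f\<close> composed with \<open>exp\<close> is another continuous section through the same
    value, so the two coincide.\<close>
  have F_real: "F (of_real x) = of_real (f (exp x))" if x: "x < R" for x
  proof -
    define T where "T = complex_of_real ` {..<R}"
    have "F (of_real x) = (\<lambda>w. of_real (f (exp (Re w)))) (of_real x)"
    proof (rule root_section_unique[of T w0 "of_real x" F "\<lambda>w. of_real (f (exp (Re w)))"])
      show "T \<subseteq> U" by (auto simp: T_def U_def)
      show "connected T" unfolding T_def
        by (intro connected_continuous_image continuous_intros) simp
      show "w0 \<in> T" unfolding T_def w0_def by (rule imageI) (simp add: x0_def)
      show "complex_of_real x \<in> T" using x by (simp add: T_def)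
      show "F w0 = of_real (f (exp (Re w0)))" using F(3) by (simp add: w0_def)
      show "continuous_on T F" using F(1) \<open>T \<subseteq> U\<close> continuous_on_subset by blast
      show "poly (q v) (F v) = 0" if "v \<in> T" for v using F(2) that \<open>T \<subseteq> U\<close> by blast
      show "continuous_on T (\<lambda>w. complex_of_real (f (exp (Re w))))"
      proof (intro continuous_intros continuous_on_compose2[OF contf])
        show "(\<lambda>w. exp (Re w)) ` T \<subseteq> {0<..<e0}"
          using exp_lt by (fastforce simp: T_def \<epsilon>_def)
      qed
      show "poly (q v) (of_real (f (exp (Re v)))) = 0" if "v \<in> T" for v
        using that f_root by (auto simp: T_def)
    qed
    then show ?thesis by simp
  qed
  have q_per: "q (w + turns k) = q w" for w k by (simp add: q_def)
  have U_per: "w + turns k \<in> U" if "w \<in> U" for w k using that by (simp add: U_def)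
  \<comment> \<open>The \<open>d + 1\<close> values are all roots of the one polynomial
    \<open>q w0\<close>, which has only \<open>d\<close>.\<close>
  have "\<not> inj_on (\<lambda>k. F (w0 + turns k)) {..d}"
  proof
    assume inj: "inj_on (\<lambda>k. F (w0 + turns k)) {..d}"
    have "(\<lambda>k. F (w0 + turns k)) ` {..d} \<subseteq> roots w0"
      using F(2)[OF U_per[OF w0]] by (auto simp: q_per)
    then have "card {..d} \<le> card (roots w0)"
      using inj finite_roots[OF w0] card_inj_on_le by blast
    then show False using card_roots[OF w0] by simp
  qed
  then obtain j k where "j \<le> d" "k \<le> d" "j \<noteq> k" "F (w0 + turns j) = F (w0 + turns k)"
    by (auto simp: inj_on_def)
  then obtain j k where jk: "j < k" "k \<le> d" "F (w0 + turns j) = F (w0 + turns k)"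
    by (metis linorder_neqE_nat)
  define \<rho> where "\<rho> = k - j"
  \<comment> \<open>Since \<open>q\<close> is invariant under \<open>turns\<close>, the translate of
    \<open>F\<close> is again a section; agreement at the single point \<open>w0 + turns j\<close>
    spreads over all of \<open>U\<close>.\<close>
  have per: "F (w + turns \<rho>) = F w" if w: "w \<in> U" for w
  proof -
    have "(\<lambda>w. F (w + turns \<rho>)) w = F w"
    proof (rule root_section_unique[of U "w0 + turns j" w "\<lambda>w. F (w + turns \<rho>)" F])
      show "connected U" unfolding U_def by (intro convex_connected convex_halfspace_Re_lt)
      show "w0 + turns j \<in> U" by (rule U_per[OF w0])
      have shift: "w0 + turns j + turns \<rho> = w0 + turns k"
        using jk by (simp add: \<rho>_def add.assoc flip: turns_add)
      show "F (w0 + turns j + turns \<rho>) = F (w0 + turns j)" unfolding shift using jk by simp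
      show "continuous_on U (\<lambda>w. F (w + turns \<rho>))"
        by (intro continuous_intros continuous_on_compose2[OF F(1)]) (auto intro: U_per)
      show "poly (q v) (F (v + turns \<rho>)) = 0" if "v \<in> U" for v
        using F(2)[OF U_per[OF that]] by (simp add: q_per)
    qed (use w F in auto)
    then show ?thesis by simp
  qed
  define M where "M = (\<Sum>j\<le>d. \<Sum>i\<le>degree (coeff Q j). norm (coeff (coeff Q j) i))"
  have bound: "norm (poly (lead_coeff Q) (exp w) * F w) \<le> M" if w: "w \<in> U" for w
  proof -
    have "norm (exp w) \<le> 1" using norm_exp_lt[OF w] by (simp add: \<epsilon>_def)
    then have "(\<Sum>j\<le>d. norm (coeff (q w) j)) \<le> M"
      unfolding M_def q_def coeff_eval_coeffs by (intro sum_mono norm_poly_le_sum_coeffs)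
    then have "norm (coeff (q w) d * F w) \<le> M"
      by (rule lead_coeff_mult_root_le[OF F(2)[OF w] degq[OF w] d0])
    then show ?thesis by (simp add: q_def d_def)
  qed
  show ?thesis
    by (rule that[of F R \<rho> "lead_coeff Q" M])
       (use holF F_real per bound lc0 jk Q(3) in \<open>auto simp: U_def \<rho>_def d_def\<close>)
qed

section \<open>Analyticity at 0 through holomorphic extensions\<close>

lemma analytic_at_0_iff_holomorphic:
  "analytic_at_0 f \<longleftrightarrow>
     (\<exists>r>0. \<exists>h. h holomorphic_on ball 0 r \<and> (\<forall>t. 0 < t \<and> t < r \<longrightarrow> h (of_real t) = of_real (f t)))"
proof
  assume "analytic_at_0 f"
  then obtain a where a: "\<forall>\<^sub>F t in nhds 0. summable (\<lambda>k. a k * t ^ k)"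
      "\<forall>\<^sub>F t in at_right 0. f t = (\<Sum>k. a k * t ^ k)"
    unfolding analytic_at_0_def by blast
  obtain e where e: "e > 0" "\<And>t. dist t 0 < e \<Longrightarrow> summable (\<lambda>k. a k * t ^ k)"
    using a(1) unfolding eventually_nhds_metric by blast
  obtain e' where e': "e' > 0" "\<And>t. 0 < t \<Longrightarrow> t < e' \<Longrightarrow> f t = (\<Sum>k. a k * t ^ k)"
    using a(2) unfolding eventually_at_right_field by blast
  define s where "s = e / 2"
  have s0: "s > 0" using e by (simp add: s_def)
  define h where "h z = (\<Sum>k. complex_of_real (a k) * z ^ k)" for z
  have "summable (\<lambda>k. a k * s ^ k)" using e by (simp add: s_def)
  then have "summable (\<lambda>k. complex_of_real (a k * s ^ k))" by (rule summable_of_real)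
  then have sumb: "summable (\<lambda>k. complex_of_real (a k) * of_real s ^ k)" by simp
  have sums: "(\<lambda>k. complex_of_real (a k) * z ^ k) sums h z" if "z \<in> ball 0 s" for z
    unfolding h_def by (intro summable_sums powser_inside[OF sumb]) (use that s0 in auto)
  have "h holomorphic_on ball 0 s"
    by (rule power_series_holomorphic[where a = "\<lambda>k. complex_of_real (a k)"]) (use sums in simp)
  moreover have "h (of_real t) = of_real (f t)" if t: "0 < t" "t < min s e'" for t
  proof -
    have "summable (\<lambda>k. a k * t ^ k)" using e t by (simp add: s_def)
    then have "(\<lambda>k. complex_of_real (a k * t ^ k)) sums of_real (\<Sum>k. a k * t ^ k)"
      by (intro sums_of_real summable_sums)
    moreover have "(\<lambda>k. complex_of_real (a k * t ^ k)) sums h (of_real t)"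
      using sums[of "of_real t"] t by simp
    ultimately show ?thesis using sums_unique2 e'(2)[of t] t by fastforce
  qed
  ultimately show "\<exists>r>0. \<exists>h. h holomorphic_on ball 0 r \<and>
      (\<forall>t. 0 < t \<and> t < r \<longrightarrow> h (of_real t) = of_real (f t))"
    using s0 e' by (intro exI[of _ "min s e'"] conjI exI[of _ h])
      (auto elim: holomorphic_on_subset)
next
  assume "\<exists>r>0. \<exists>h. h holomorphic_on ball 0 r \<and> (\<forall>t. 0 < t \<and> t < r \<longrightarrow> h (of_real t) = of_real (f t))"
  then obtain r h where r: "r > 0" and h: "h holomorphic_on ball 0 r"
      "\<And>t. 0 < t \<Longrightarrow> t < r \<Longrightarrow> h (of_real t) = of_real (f t)"
    by blast
  \<comment> \<open>\<open>h\<close> is real on small positive arguments, so replacing its Taylor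
    coefficients by their real parts does not change its values there.\<close>
  define a where "a k = Re ((deriv ^^ k) h 0 / fact k)" for k
  have sums: "(\<lambda>k. a k * t ^ k) sums Re (h (of_real t))" if "\<bar>t\<bar> < r" for t
  proof -
    have "(\<lambda>k. (deriv ^^ k) h 0 / fact k * (of_real t - 0) ^ k) sums h (of_real t)"
      by (rule holomorphic_power_series[OF h(1)]) (use that in simp)
    then have "(\<lambda>k. Re ((deriv ^^ k) h 0 / fact k * (of_real t - 0) ^ k)) sums Re (h (of_real t))"
      by (rule sums_Re)
    moreover have "Re ((deriv ^^ k) h 0 / fact k * (of_real t - 0) ^ k) = a k * t ^ k" for k
    proof -
      have "(of_real t - 0) ^ k = complex_of_real (t ^ k)" by simp
      then show ?thesis unfolding a_def by (simp only: Re_complex_of_real Im_complex_of_real times_complex.simps mult_zero_right diff_zero)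
    qed
    ultimately show ?thesis by simp
  qed
  show "analytic_at_0 f"
    unfolding analytic_at_0_def
  proof (intro exI[of _ a] conjI)
    show "\<forall>\<^sub>F t in nhds 0. summable (\<lambda>k. a k * t ^ k)"
      unfolding eventually_nhds_metric using r sums
      by (intro exI[of _ r]) (auto intro: sums_summable)
    show "\<forall>\<^sub>F t in at_right 0. f t = (\<Sum>k. a k * t ^ k)"
      unfolding eventually_at_right_field using r sums h(2)
      by (intro exI[of _ r]) (auto simp: sums_iff)
  qed
qed

text \<open>A quotient of holomorphic functions has at worst a pole at 0. At a pole the modulus
  tends to infinity from every direction, in particular along the positive reals, where
  \<open>f\<close> is bounded; so the singularity is removable.\<close>

lemma analytic_at_0_quotient:
  fixes f :: "real \<Rightarrow> real"
  assumes r: "r > 0" and hol: "a holomorphic_on ball 0 r" "b holomorphic_on ball 0 r"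
    and b0: "\<And>t. 0 < t \<Longrightarrow> t < r \<Longrightarrow> b (of_real t) \<noteq> 0"
    and quot: "\<And>t. 0 < t \<Longrightarrow> t < r \<Longrightarrow> of_real (f t) * b (of_real t) = a (of_real t)"
    and bdd: "\<And>t. 0 < t \<Longrightarrow> t < r \<Longrightarrow> \<bar>f t\<bar> \<le> M"
  shows "analytic_at_0 f"
proof -
  obtain s where s: "s > 0" "s \<le> r" and bs: "\<And>z. z \<in> ball 0 s - {0} \<Longrightarrow> b z \<noteq> 0"
  proof (cases "b 0 = 0")
    case True
    show ?thesis
    proof (rule isolated_zeros[OF hol(2) open_ball connected_ball _ True, of "of_real (r / 2)"])
      show "b (of_real (r / 2)) \<noteq> 0" using r by (intro b0) auto
      fix s assume s: "0 < s" "\<And>z. z \<in> ball 0 s - {0} \<Longrightarrow> b z \<noteq> 0"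
      show ?thesis by (rule that[of "min s r"]) (use s r in auto)
    qed (use r in auto)
  next
    case False
    have "continuous_on (ball 0 r) b" using hol(2) by (rule holomorphic_on_imp_continuous_on)
    then have "isCont b 0" using r by (simp add: continuous_on_eq_continuous_at)
    then obtain s where "s > 0" "\<forall>z. dist 0 z < s \<longrightarrow> b z \<noteq> 0"
      using continuous_at_avoid[of 0 b 0] False by auto
    then show ?thesis using r by (intro that[of "min s r"]) auto
  qed
  define G where "G z = a z / b z" for z
  have sub: "ball 0 s \<subseteq> ball 0 r" using s by auto
  have holG: "G holomorphic_on ball 0 s - {0}"
    unfolding G_def using hol sub bs
    by (intro holomorphic_on_divide) (auto elim!: holomorphic_on_subset)
  have G_real: "G (of_real t) = of_real (f t)" if "0 < t" "t < s" for t
    using quot[of t] b0[of t] that s by (simp add: G_def field_simps)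
  have "a analytic_on ball 0 r" "b analytic_on ball 0 r"
    using hol by (simp_all add: analytic_on_open)
  then have an: "a analytic_on {0}" "b analytic_on {0}"
    using r by (auto elim!: analytic_on_subset)
  have "not_essential G 0" unfolding G_def
    using an by (intro not_essential_divide not_essential_analytic isolated_singularity_at_analytic)
  moreover have "\<not> is_pole G 0"
  proof
    assume "is_pole G 0"
    then have "filterlim G at_infinity (at 0)" by (simp add: is_pole_def)
    then have "\<forall>\<^sub>F z in at 0. norm (G z) \<ge> \<bar>M\<bar> + 1"
      unfolding filterlim_at_infinity[OF order_refl] by (simp add: add_nonneg_pos)
    then obtain e where e: "e > 0" "\<And>z. z \<noteq> 0 \<Longrightarrow> norm z < e \<Longrightarrow> norm (G z) \<ge> \<bar>M\<bar> + 1"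
      unfolding eventually_at by auto
    define t where "t = min e s / 2"
    have t: "0 < t" "t < e" "t < s" using e s by (auto simp: t_def)
    then have "norm (G (of_real t)) \<ge> \<bar>M\<bar> + 1" by (intro e(2)) auto
    then show False using G_real[OF t(1,3)] bdd[of t] t s by simp
  qed
  ultimately obtain c where "G \<midarrow>0\<rightarrow> c" unfolding not_essential_def by blast
  then have "(\<lambda>z. if z = 0 then c else G z) holomorphic_on ball 0 s"
    by (rule removable_singularity[OF holG open_ball])
  then show ?thesis
    unfolding analytic_at_0_iff_holomorphic using s G_real
    by (intro exI[of _ s] conjI exI[of _ "\<lambda>z. if z = 0 then c else G z"]) auto
qed

section \<open>From the logarithmic half-plane back to a disc\<close>

lemma periodic_int_turns:
  assumes per: "\<And>w. w \<in> left_half R \<Longrightarrow> F (w + turns \<rho>) = F w" and w: "w \<in> left_half R"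
  shows "F (w + of_int k * turns \<rho>) = F w"
proof -
  have nat: "F (w + of_nat j * turns \<rho>) = F w" if "w \<in> left_half R" for w j
  proof (induction j)
    case (Suc j)
    have "F (w + of_nat (Suc j) * turns \<rho>) = F ((w + of_nat j * turns \<rho>) + turns \<rho>)"
      by (simp add: algebra_simps)
    also have "\<dots> = F (w + of_nat j * turns \<rho>)"
      by (rule per) (use that in \<open>simp add: turns_def\<close>)
    finally show ?case using Suc by simp
  qed simp
  show ?thesis
  proof (cases "k \<ge> 0")
    case True
    then show ?thesis using nat[OF w, of "nat k"] by simp
  next
    case False
    define w' where "w' = w + of_int k * turns \<rho>"
    have "w' \<in> left_half R" using w by (simp add: w'_def turns_def)
    then have "F (w' + of_nat (nat (- k)) * turns \<rho>) = F w'" by (rule nat)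
    moreover have w: "w' + of_nat (nat (- k)) * turns \<rho> = w" using False by (simp add: w'_def)
    ultimately have "F w = F w'" by (simp only: w)
    then show ?thesis by (simp add: w'_def)
  qed
qed

text \<open>With \<mu> = z^\<rho>, another choice of \<open>log z\<close> changes
  \<open>\<rho> * log z\<close> by a multiple of \<open>turns \<rho>\<close>, a period of
  \<open>F\<close>. The radius \<open>exp (R / \<rho>)\<close> corresponds to the boundary
  \<open>Re w = R\<close>.\<close>

lemma periodic_descends_to_disc:
  assumes F: "F holomorphic_on left_half R" and \<rho>: "\<rho> \<ge> 1"
    and per: "\<And>w. w \<in> left_half R \<Longrightarrow> F (w + turns \<rho>) = F w"
  obtains r where "r > 0" "(\<lambda>z. F (of_nat \<rho> * Ln z)) holomorphic_on ball 0 r - {0}"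
    "\<And>z. z \<in> ball 0 r - {0} \<Longrightarrow> of_nat \<rho> * Ln z \<in> left_half R"
proof -
  define r where "r = exp (R / \<rho>)"
  have lt: "of_nat \<rho> * w \<in> left_half R" if "exp w \<in> ball 0 r" for w
  proof -
    have "exp (Re w) < exp (R / \<rho>)" using that by (simp add: r_def)
    then have "Re w < R / \<rho>" by simp
    then show ?thesis using \<rho> by (simp add: field_simps)
  qed
  have dom: "of_nat \<rho> * Ln z \<in> left_half R" if "z \<in> ball 0 r - {0}" for z
    using lt[of "Ln z"] that by simp
  define G where "G z = F (of_nat \<rho> * Ln z)" for z
  have "G field_differentiable at z0" if z0: "z0 \<in> ball 0 r - {0}" for z0
  proof -
    define N where "N = ball z0 (norm z0) \<inter> ball 0 r"
    \<comment> \<open>A logarithm holomorphic near \<open>z0\<close> even if \<open>z0\<close> lies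
      on the cut of \<open>Ln\<close>: on \<open>N\<close> the quotient \<open>z / z0\<close> has
      positive real part.\<close>
    define w where "w z = Ln (z / z0) + Ln z0" for z
    have z0': "z0 \<in> N" "open N" using z0 by (auto simp: N_def)
    have re: "z / z0 \<notin> \<real>\<^sub>\<le>\<^sub>0" "z \<noteq> 0" "z \<in> ball 0 r" if z: "z \<in> N" for z
    proof -
      have "norm (z0 - z) < norm z0" "z0 \<noteq> 0" using z z0 by (auto simp: N_def dist_norm)
      then have "norm ((z0 - z) / z0) < 1" by (simp add: norm_divide)
      then have "norm (1 - z / z0) < 1" using \<open>z0 \<noteq> 0\<close> by (simp add: diff_divide_distrib)
      then have "Re (1 - z / z0) < 1" using complex_Re_le_cmod le_less_trans by blast
      then show "z / z0 \<notin> \<real>\<^sub>\<le>\<^sub>0" "z \<noteq> 0" by (auto simp: complex_nonpos_Reals_iff)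
      show "z \<in> ball 0 r" using z by (simp add: N_def)
    qed
    have expw: "exp (w z) = z" if "z \<in> N" for z
      using re(2)[OF that] z0 by (simp add: w_def exp_add)
    have "w holomorphic_on N"
      unfolding w_def using re(1) z0 by (intro holomorphic_intros) auto
    moreover have "of_nat \<rho> * w z \<in> left_half R" if "z \<in> N" for z
      using lt[of "w z"] expw[OF that] re(3)[OF that] by simp
    ultimately have "(\<lambda>z. F (of_nat \<rho> * w z)) holomorphic_on N"
      by (intro holomorphic_on_compose_gen[OF _ F, unfolded o_def] holomorphic_intros) auto
    moreover have "F (of_nat \<rho> * w z) = G z" if z: "z \<in> N" for z
    proof -
      have "exp (w z) = exp (Ln z)" using expw[OF z] re(2)[OF z] by simp
      then obtain k :: int where "w z = Ln z + (of_int (2 * k) * pi) * \<i>"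
        unfolding exp_eq by blast
      then have "of_nat \<rho> * w z = of_nat \<rho> * Ln z + of_int k * turns \<rho>"
        by (simp add: turns_def algebra_simps)
      moreover have Ln: "of_nat \<rho> * Ln z \<in> left_half R" using dom re[OF z] by simp
      have "F (of_nat \<rho> * Ln z + of_int k * turns \<rho>) = F (of_nat \<rho> * Ln z)"
        by (rule periodic_int_turns[where R = R]; (erule per | rule Ln))
      ultimately show ?thesis unfolding G_def by simp
    qed
    ultimately have "G holomorphic_on N" by (rule holomorphic_transform)
    then show ?thesis using z0' holomorphic_on_imp_differentiable_at by blast
  qed
  then have "G holomorphic_on ball 0 r - {0}"
    by (auto simp: holomorphic_on_def intro: field_differentiable_at_within)
  then show ?thesis using that[of r] dom by (simp add: r_def G_def[abs_def])
qed

text \<open>The product with \<open>c\<close> is bounded near 0, so it extends by Riemann's theorem;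
  dividing by \<open>c\<close> could leave a pole, which boundedness of \<open>f\<close> on the
  positive reals excludes.\<close>

lemma branch_analytic_at_0:
  fixes f :: "real \<Rightarrow> real"
  assumes F: "F holomorphic_on left_half R"
    and F_real: "\<And>x. x < R \<Longrightarrow> F (of_real x) = of_real (f (exp x))"
    and \<rho>: "\<rho> \<ge> 1" and per: "\<And>w. w \<in> left_half R \<Longrightarrow> F (w + turns \<rho>) = F w"
    and c: "c \<noteq> 0" and M: "\<And>w. w \<in> left_half R \<Longrightarrow> norm (poly c (exp w) * F w) \<le> M"
    and bdd: "e0 > 0" "\<And>x. 0 < x \<Longrightarrow> x < e0 \<Longrightarrow> \<bar>f x\<bar> \<le> K"
  shows "analytic_at_0 (\<lambda>t. f (t ^ \<rho>))"
proof -
  obtain r where r: "r > 0" and holG: "(\<lambda>z. F (of_nat \<rho> * Ln z)) holomorphic_on ball 0 r - {0}"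
    and dom: "\<And>z. z \<in> ball 0 r - {0} \<Longrightarrow> of_nat \<rho> * Ln z \<in> left_half R"
    using periodic_descends_to_disc[OF F \<rho> per] by blast
  define G where "G z = F (of_nat \<rho> * Ln z)" for z
  have exp_dom: "exp (of_nat \<rho> * Ln z) = z ^ \<rho>" if "z \<noteq> 0" for z
    using that by (simp add: exp_of_nat_mult)
  define B where "B z = poly c (z ^ \<rho>) * G z" for z
  have "(\<lambda>z. poly c (z ^ \<rho>)) holomorphic_on S" for S
    unfolding poly_altdef by (intro holomorphic_intros)
  note hol_c = this
  have holB: "B holomorphic_on ball 0 r - {0}"
    unfolding B_def G_def by (intro holomorphic_on_mult hol_c holG)
  have "norm (B z) \<le> M" if "z \<in> ball 0 r - {0}" for z
    using M[OF dom[OF that]] exp_dom[of z] that by (simp add: B_def G_def)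
  then have "\<forall>\<^sub>F z in at 0. norm (B z) \<le> M"
    unfolding eventually_at using r by (intro exI[of _ r]) auto
  then obtain g where g: "g holomorphic_on ball 0 r" "\<And>z. z \<in> ball 0 r - {0} \<Longrightarrow> g z = B z"
    using holomorphic_on_extend_bounded[OF holB] r by auto
  obtain e where e: "e > 0" "\<And>z. z \<noteq> 0 \<Longrightarrow> norm z < e \<Longrightarrow> poly c z \<noteq> 0"
    using poly_nonzero_punctured_nhd[OF c] by blast
  define s where "s = min r (min 1 (min e e0))"
  have pow: "t ^ \<rho> < e" "t ^ \<rho> < e0" if "0 < t" "t < s" for t
  proof -
    have "t ^ \<rho> \<le> t ^ 1" using that \<rho> by (intro power_decreasing) (auto simp: s_def)
    then show "t ^ \<rho> < e" "t ^ \<rho> < e0" using that by (auto simp: s_def)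
  qed
  have G_real: "G (of_real t) = of_real (f (t ^ \<rho>))" if "0 < t" "t < s" for t
  proof -
    have "of_nat \<rho> * Ln (of_real t) = complex_of_real (\<rho> * ln t)"
      using that by (simp add: Ln_of_real)
    moreover have "\<rho> * ln t < R"
      using dom[of "of_real t"] that by (simp add: s_def Ln_of_real)
    moreover have "exp (\<rho> * ln t) = t ^ \<rho>" using that by (simp add: exp_of_nat_mult)
    ultimately show ?thesis using F_real[of "\<rho> * ln t"] by (simp only: G_def)
  qed
  show ?thesis
  proof (rule analytic_at_0_quotient[of s g "\<lambda>z. poly c (z ^ \<rho>)" _ K])
    show "s > 0" using r e bdd(1) by (simp add: s_def)
    show "g holomorphic_on ball 0 s"
      by (rule holomorphic_on_subset[OF g(1)]) (simp add: s_def subset_ball)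
    show "(\<lambda>z. poly c (z ^ \<rho>)) holomorphic_on ball 0 s" by (rule hol_c)
    fix t assume t: "0 < t" "t < s"
    show "poly c (of_real t ^ \<rho>) \<noteq> 0"
      using e(2)[of "of_real t ^ \<rho>"] pow(1)[OF t] t by (simp add: norm_power)
    show "of_real (f (t ^ \<rho>)) * poly c (of_real t ^ \<rho>) = g (of_real t)"
      using g(2)[of "of_real t"] t G_real[OF t] by (simp add: B_def s_def)
    show "\<bar>f (t ^ \<rho>)\<bar> \<le> K" using bdd(2) pow(2)[OF t] t by simp
  qed
qed

text \<open>A linear combination with generic coefficients has no more periods than its terms have in
  common.\<close>

lemma common_period:
  fixes F :: "nat \<Rightarrow> complex \<Rightarrow> complex"
  assumes hol: "\<And>i. i < m \<Longrightarrow> F i holomorphic_on left_half R"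
    and comb: "\<And>u :: nat \<Rightarrow> real. \<exists>\<rho>\<in>{1..D}. \<exists>R'. \<forall>w\<in>left_half R'.
      (\<Sum>i<m. of_real (u i) * F i (w + turns \<rho>)) = (\<Sum>i<m. of_real (u i) * F i w)"
  shows "\<exists>\<rho>\<in>{1..D}. \<forall>i<m. \<forall>w\<in>left_half R. F i (w + turns \<rho>) = F i w"
proof (rule ccontr)
  assume "\<not> ?thesis"
  then have "\<forall>\<rho>\<in>{1..D}. \<exists>w. w \<in> left_half R \<and> (\<exists>i<m. F i (w + turns \<rho>) \<noteq> F i w)" by blast
  then obtain w where w: "\<forall>\<rho>\<in>{1..D}. w \<rho> \<in> left_half R \<and> (\<exists>i<m. F i (w \<rho> + turns \<rho>) \<noteq> F i (w \<rho>))"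
    by (rule bchoice[THEN exE])
  \<comment> \<open>The coefficients \<open>u i = s ^ i\<close> turn the defect of the linear form
    at \<open>w \<rho>\<close> into the value at \<open>s\<close> of the polynomial
    \<open>p \<rho>\<close>, nonzero if \<rho> is not a common period. A real \<open>s\<close>
    avoiding the finitely many roots detects all failures at once.\<close>
  define p where "p \<rho> = (\<Sum>i<m. monom (F i (w \<rho> + turns \<rho>) - F i (w \<rho>)) i)" for \<rho>
  have "p \<rho> \<noteq> 0" if \<rho>: "\<rho> \<in> {1..D}" for \<rho>
  proof -
    obtain i where i: "i < m" "F i (w \<rho> + turns \<rho>) \<noteq> F i (w \<rho>)" using w \<rho> by blast
    have "coeff (p \<rho>) i = F i (w \<rho> + turns \<rho>) - F i (w \<rho>)"
      using i(1) by (simp add: p_def coeff_sum sum.delta)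
    then show ?thesis using i(2) by auto
  qed
  then have "(\<Prod>\<rho>\<in>{1..D}. p \<rho>) \<noteq> 0" by simp
  then have "finite {z. poly (\<Prod>\<rho>\<in>{1..D}. p \<rho>) z = 0}" by (rule poly_roots_finite)
  then have "finite (complex_of_real -` {z. poly (\<Prod>\<rho>\<in>{1..D}. p \<rho>) z = 0})"
    by (rule finite_vimageI) (simp add: inj_of_real)
  then obtain s :: real where "s \<notin> complex_of_real -` {z. poly (\<Prod>\<rho>\<in>{1..D}. p \<rho>) z = 0}"
    using ex_new_if_finite[OF infinite_UNIV_char_0] by blast
  then have s: "poly (p \<rho>) (of_real s) \<noteq> 0" if "\<rho> \<in> {1..D}" for \<rho>
    using that by (simp add: poly_prod)
  obtain \<rho> R' where \<rho>: "\<rho> \<in> {1..D}" and eq: "\<And>v. v \<in> left_half R' \<Longrightarrow>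
      (\<Sum>i<m. of_real (s ^ i) * F i (v + turns \<rho>)) = (\<Sum>i<m. of_real (s ^ i) * F i v)"
    using comb[of "\<lambda>i. s ^ i"] by blast
  have hol_shift: "(\<lambda>v. F i (v + turns \<rho>)) holomorphic_on left_half R" if "i < m" for i
    by (rule holomorphic_on_compose_gen[OF _ hol[OF that], unfolded o_def])
       (auto intro!: holomorphic_intros)
  \<comment> \<open>Periodicity is granted only on \<open>left_half R'\<close>, which need not
    contain \<open>w \<rho>\<close>; the identity theorem carries it there.\<close>
  have "(\<Sum>i<m. of_real (s ^ i) * F i (w \<rho> + turns \<rho>)) = (\<Sum>i<m. of_real (s ^ i) * F i (w \<rho>))"
  proof (rule analytic_continuation_open[of "left_half (min R R')" "left_half R"
        "\<lambda>v. \<Sum>i<m. of_real (s ^ i) * F i (v + turns \<rho>)" "\<lambda>v. \<Sum>i<m. of_real (s ^ i) * F i v"])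
    show "open (left_half (min R R'))" "open (left_half R)" by (rule open_halfspace_Re_lt)+
    have "complex_of_real (min R R' - 1) \<in> left_half (min R R')" by (auto simp: min_def)
    then show "left_half (min R R') \<noteq> {}" by blast
    show "connected (left_half R)" by (intro convex_connected convex_halfspace_Re_lt)
    show "(\<lambda>v. \<Sum>i<m. of_real (s ^ i) * F i (v + turns \<rho>)) holomorphic_on left_half R"
         "(\<lambda>v. \<Sum>i<m. of_real (s ^ i) * F i v) holomorphic_on left_half R"
      by (intro holomorphic_intros hol hol_shift; simp)+
    show "w \<rho> \<in> left_half R" using w \<rho> by blast
  qed (use eq in auto)
  then have "poly (p \<rho>) (of_real s) = 0"
    by (simp add: p_def poly_sum poly_monom algebra_simps sum_subtractf)
  then show False using s[OF \<rho>] by simp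
qed

text \<open>The individual branches \<open>F i\<close> are used without their own periods. The
  branch found for a linear form is the same combination of the \<open>F i\<close>, so its period
  passes to that combination, and \<open>common_period\<close> finds one \<rho> for all
  \<open>i\<close>.\<close>

theorem puiseux_family:
  fixes f :: "nat \<Rightarrow> real \<Rightarrow> real"
  assumes e0: "e0 > 0" and cont: "\<And>i. i < m \<Longrightarrow> continuous_on {0<..<e0} (f i)"
    and bdd: "\<And>i x. i < m \<Longrightarrow> 0 < x \<Longrightarrow> x < e0 \<Longrightarrow> \<bar>f i x\<bar> \<le> K"
    and alg: "\<And>u :: nat \<Rightarrow> real. \<exists>P. P \<noteq> 0 \<and> degree P \<le> D \<and> annihilates (\<lambda>x. \<Sum>i<m. u i * f i x) P"
  shows "\<exists>\<rho>\<in>{1..D}. \<forall>i<m. analytic_at_0 (\<lambda>t. f i (t ^ \<rho>))"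
proof -
  define branch where "branch i R F c M \<longleftrightarrow> F holomorphic_on left_half R \<and>
      (\<forall>x<R. F (of_real x) = of_real (f i (exp x))) \<and>
      c \<noteq> 0 \<and> (\<forall>w\<in>left_half R. norm (poly c (exp w) * F w) \<le> M)" for i R F c M
  have "\<exists>T. branch i (fst T) (fst (snd T)) (fst (snd (snd T))) (snd (snd (snd T)))" if i: "i < m" for i
  proof -
    obtain P where P: "P \<noteq> 0" "annihilates (\<lambda>x. \<Sum>j<m. (if j = i then 1 else 0) * f j x) P"
      using alg[of "\<lambda>j. if j = i then 1 else 0"] by blast
    have "(\<lambda>x. \<Sum>j<m. (if j = i then 1 else 0) * f j x) = f i"
    proof
      fix x
      have "(\<Sum>j<m. (if j = i then 1 else 0) * f j x) = (\<Sum>j<m. if j = i then f j x else 0)"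
        by (rule sum.cong) auto
      then show "(\<Sum>j<m. (if j = i then 1 else 0) * f j x) = f i x" using i by simp
    qed
    then have "annihilates (f i) P" using P by simp
    then obtain R F \<rho> c M where "F holomorphic_on left_half R"
        "\<And>x. x < R \<Longrightarrow> F (of_real x) = of_real (f i (exp x))" "\<rho> \<ge> 1" "\<rho> \<le> degree P"
        "\<And>w. w \<in> left_half R \<Longrightarrow> F (w + turns \<rho>) = F w"
        "c \<noteq> 0" "\<And>w. w \<in> left_half R \<Longrightarrow> norm (poly c (exp w) * F w) \<le> M"
      by (rule puiseux_branch[OF e0 cont[OF i] _ P(1)]) blast
    then have "branch i R F c M" by (simp add: branch_def)
    then show ?thesis by (intro exI[of _ "(R, F, c, M)"]) simp
  qed
  then have "\<forall>i\<in>{..<m}. \<exists>T. branch i (fst T) (fst (snd T)) (fst (snd (snd T))) (snd (snd (snd T)))"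
    by blast
  then obtain T where T: "\<forall>i\<in>{..<m}. branch i (fst (T i)) (fst (snd (T i)))
      (fst (snd (snd (T i)))) (snd (snd (snd (T i))))"
    by (rule bchoice[THEN exE])
  define R where "R i = fst (T i)" for i
  define F where "F i = fst (snd (T i))" for i
  define c where "c i = fst (snd (snd (T i)))" for i
  define M where "M i = snd (snd (snd (T i)))" for i
  have br: "branch i (R i) (F i) (c i) (M i)" if "i < m" for i
    using T that by (simp add: R_def F_def c_def M_def)
  have F: "F i holomorphic_on left_half (R i)"
    and F_real: "\<And>x. x < R i \<Longrightarrow> F i (of_real x) = of_real (f i (exp x))"
    and c: "c i \<noteq> 0"
    and M: "\<And>w. w \<in> left_half (R i) \<Longrightarrow> norm (poly (c i) (exp w) * F i w) \<le> M i"
    if "i < m" for i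
    using br[OF that] unfolding branch_def by blast+
  define R0 where "R0 = Min (insert 0 (R ` {..<m}))"
  have R0: "R0 \<le> R i" if "i < m" for i using that by (simp add: R0_def)
  have holF: "F i holomorphic_on left_half R0" if "i < m" for i
    by (rule holomorphic_on_subset[OF F[OF that]]) (use R0[OF that] in auto)
  have "\<exists>\<rho>\<in>{1..D}. \<exists>R'. \<forall>w\<in>left_half R'.
      (\<Sum>i<m. of_real (u i) * F i (w + turns \<rho>)) = (\<Sum>i<m. of_real (u i) * F i w)"
    for u :: "nat \<Rightarrow> real"
  proof -
    obtain P where P: "P \<noteq> 0" "degree P \<le> D" "annihilates (\<lambda>x. \<Sum>i<m. u i * f i x) P"
      using alg[of u] by blast
    have "continuous_on {0<..<e0} (\<lambda>x. \<Sum>i<m. u i * f i x)"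
      by (intro continuous_intros cont) auto
    then obtain R' H \<rho> where H: "H holomorphic_on left_half R'"
      "\<And>x. x < R' \<Longrightarrow> H (of_real x) = of_real (\<Sum>i<m. u i * f i (exp x))"
      "\<rho> \<ge> 1" "\<rho> \<le> degree P" "\<And>w. w \<in> left_half R' \<Longrightarrow> H (w + turns \<rho>) = H w"
      by (rule puiseux_branch[OF e0 _ P(3,1)]) blast
    define R1 where "R1 = min R0 R'"
    \<comment> \<open>Both terms restrict to the same real function on the real ray, so
      \<open>E\<close> vanishes on a set with a limit point.\<close>
    define E where "E w = H w - (\<Sum>i<m. of_real (u i) * F i w)" for w
    have E0: "E w = 0" if w: "w \<in> left_half R1" for w
    proof (rule analytic_continuation[of E "left_half R1" "of_real ` {..<R1}" "of_real (R1 - 1)"])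
      have "H holomorphic_on left_half R1"
        by (rule holomorphic_on_subset[OF H(1)]) (auto simp: R1_def)
      moreover have "F i holomorphic_on left_half R1" if "i < m" for i
        by (rule holomorphic_on_subset[OF holF[OF that]]) (auto simp: R1_def)
      ultimately show "E holomorphic_on left_half R1" unfolding E_def
        by (intro holomorphic_intros) auto
      show "open (left_half R1)" by (rule open_halfspace_Re_lt)
      show "connected (left_half R1)" by (intro convex_connected convex_halfspace_Re_lt)
      show "complex_of_real ` {..<R1} \<subseteq> left_half R1" "complex_of_real (R1 - 1) \<in> left_half R1" by auto
      show "complex_of_real (R1 - 1) islimpt complex_of_real ` {..<R1}"
        unfolding islimpt_approachable
      proof (intro allI impI)
        fix e :: real assume "e > 0"
        then show "\<exists>z\<in>complex_of_real ` {..<R1}. z \<noteq> of_real (R1 - 1) \<and> dist z (of_real (R1 - 1)) < e"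
          by (intro bexI[of _ "of_real (R1 - 1 - e / 2)"] imageI)
             (auto simp del: of_real_diff simp add: dist_of_real dist_real_def)
      qed
      show "E z = 0" if "z \<in> of_real ` {..<R1}" for z
        using that H(2) F_real R0 by (auto simp: E_def R1_def less_le_trans)
    qed (rule w)
    have "(\<Sum>i<m. of_real (u i) * F i (w + turns \<rho>)) = (\<Sum>i<m. of_real (u i) * F i w)"
      if w: "w \<in> left_half R1" for w
    proof -
      have "w + turns \<rho> \<in> left_half R1" "w \<in> left_half R'" using w by (auto simp: R1_def)
      then show ?thesis using E0[of "w + turns \<rho>"] E0[OF w] H(5)[of w] by (simp add: E_def)
    qed
    then show ?thesis using H(3,4) P(2) by (intro bexI[of _ \<rho>] exI[of _ R1]) auto
  qed
  then obtain \<rho> where \<rho>: "\<rho> \<in> {1..D}" "\<And>i w. i < m \<Longrightarrow> w \<in> left_half R0 \<Longrightarrow> F i (w + turns \<rho>) = F i w"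
    using common_period[of m F R0 D] holF by blast
  have "analytic_at_0 (\<lambda>t. f i (t ^ \<rho>))" if i: "i < m" for i
    by (rule branch_analytic_at_0[of "F i" R0 "f i" \<rho> "c i" "M i" e0 K])
       (use holF[OF i] F_real[OF i] R0[OF i] \<rho> c[OF i] M[OF i] e0 bdd[OF i] i in auto)
  then show ?thesis using \<rho>(1) by blast
qed

section \<open>Elimination by dimension counting\<close>

lemma homogeneous_system_nontrivial:
  fixes c :: "'i \<Rightarrow> 'b \<Rightarrow> real"
  assumes "finite B" "finite I" "card B < card I"
  shows "\<exists>q. (\<exists>i\<in>I. q i \<noteq> 0) \<and> (\<forall>b\<in>B. (\<Sum>i\<in>I. q i * c i b) = 0)"
  using assms
proof (induction B arbitrary: I c rule: finite_induct)
  case empty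
  then have "I \<noteq> {}" by auto
  then show ?case by (intro exI[of _ "\<lambda>_. 1"]) auto
next
  case (insert b B)
  show ?case
  proof (cases "\<forall>i\<in>I. c i b = 0")
    case True
    have "card B < card I" using insert by simp
    then obtain q where "\<exists>i\<in>I. q i \<noteq> 0" "\<forall>b\<in>B. (\<Sum>i\<in>I. q i * c i b) = 0"
      using insert.IH[OF insert.prems(1), of c] by blast
    then show ?thesis using True by (intro exI[of _ q]) simp
  next
    case False
    then obtain p where p: "p \<in> I" "c p b \<noteq> 0" by blast
    define I' where "I' = I - {p}"
    \<comment> \<open>Gaussian elimination: equation \<open>b\<close> is solved for the unknown
      \<open>p\<close>, and \<open>c'\<close> is the system left for the other unknowns.\<close>
    define c' where "c' i x = c i x - c i b * (c p x / c p b)" for i x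
    have I': "finite I'" "p \<notin> I'" "I = insert p I'" using insert.prems p by (auto simp: I'_def)
    have "card B < card I'" using insert I' by simp
    then obtain q where q: "\<exists>i\<in>I'. q i \<noteq> 0" "\<forall>x\<in>B. (\<Sum>i\<in>I'. q i * c' i x) = 0"
      using insert.IH[OF I'(1), of c'] by blast
    define q' where "q' = q(p := - (\<Sum>i\<in>I'. q i * c i b) / c p b)"
    have "(\<Sum>i\<in>I. q' i * c i x) = (\<Sum>i\<in>I'. q i * c' i x)" for x
    proof -
      have "(\<Sum>i\<in>I'. q' i * c i x) = (\<Sum>i\<in>I'. q i * c i x)"
        using I'(2) by (intro sum.cong) (auto simp: q'_def)
      then have "(\<Sum>i\<in>I. q' i * c i x) = (\<Sum>i\<in>I'. q i * c i x) - (\<Sum>i\<in>I'. q i * c i b) * (c p x / c p b)"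
        unfolding I'(3) sum.insert[OF I'(1,2)] by (simp add: q'_def)
      also have "\<dots> = (\<Sum>i\<in>I'. q i * c' i x)"
        by (simp add: c'_def right_diff_distrib sum_subtractf sum_distrib_right mult.assoc del: times_divide_eq_right)
      finally show ?thesis .
    qed
    moreover have "c' i b = 0" for i using p(2) by (simp add: c'_def)
    moreover have "\<exists>i\<in>I. q' i \<noteq> 0" using q(1) I'(2,3) by (auto simp: q'_def)
    ultimately show ?thesis using q(2) by (intro exI[of _ q']) simp
  qed
qed

section \<open>Functions polynomial of bounded degree in each variable separately\<close>

definition sep_poly :: "nat \<Rightarrow> nat \<Rightarrow> ((nat \<Rightarrow> real) \<Rightarrow> real) \<Rightarrow> bool" where
  "sep_poly N E f \<longleftrightarrow>
     (\<forall>i<N. \<forall>y. \<exists>p :: real poly. degree p \<le> E \<and> (\<forall>t. f (y(i := t)) = poly p t))"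

lemma sep_poly_mono: "sep_poly N E f \<Longrightarrow> E \<le> E' \<Longrightarrow> sep_poly N E' f"
  unfolding sep_poly_def by (meson order_trans)

lemma sep_poly_const: "sep_poly N E (\<lambda>_. c)"
  unfolding sep_poly_def by (auto intro!: exI[of _ "[:c:]"])

lemma sep_poly_var: "sep_poly N 1 (\<lambda>y. y j)"
  unfolding sep_poly_def
proof (intro allI impI)
  fix i y
  show "\<exists>p :: real poly. degree p \<le> 1 \<and> (\<forall>t. (y(i := t)) j = poly p t)"
  proof (cases "i = j")
    case True
    then show ?thesis by (intro exI[of _ "[:0, 1:]"]) simp
  next
    case False
    then show ?thesis by (intro exI[of _ "[:y j:]"]) simp
  qed
qed

lemma sep_poly_add:
  assumes "sep_poly N E f" "sep_poly N E g"
  shows "sep_poly N E (\<lambda>y. f y + g y)"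
  unfolding sep_poly_def
proof (intro allI impI)
  fix i y assume "i < N"
  then obtain p q where "degree p \<le> E" "\<forall>t. f (y(i := t)) = poly p t"
      "degree q \<le> E" "\<forall>t. g (y(i := t)) = poly q t"
    using assms unfolding sep_poly_def by meson
  then show "\<exists>p. degree p \<le> E \<and> (\<forall>t. f (y(i := t)) + g (y(i := t)) = poly p t)"
    by (intro exI[of _ "p + q"]) (simp add: degree_add_le)
qed

lemma sep_poly_mult:
  assumes "sep_poly N E f" "sep_poly N E' g"
  shows "sep_poly N (E + E') (\<lambda>y. f y * g y)"
  unfolding sep_poly_def
proof (intro allI impI)
  fix i y assume "i < N"
  then obtain p q where "degree p \<le> E" "\<forall>t. f (y(i := t)) = poly p t"
      "degree q \<le> E'" "\<forall>t. g (y(i := t)) = poly q t"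
    using assms unfolding sep_poly_def by meson
  then show "\<exists>p. degree p \<le> E + E' \<and> (\<forall>t. f (y(i := t)) * g (y(i := t)) = poly p t)"
    by (intro exI[of _ "p * q"]) (auto intro: order_trans[OF degree_mult_le])
qed

lemma sep_poly_cmult: "sep_poly N E f \<Longrightarrow> sep_poly N E (\<lambda>y. c * f y)"
  using sep_poly_mult[OF sep_poly_const[of N 0 c]] by simp

lemma sep_poly_diff:
  assumes "sep_poly N E f" "sep_poly N E g"
  shows "sep_poly N E (\<lambda>y. f y - g y)"
  using sep_poly_add[OF assms(1) sep_poly_cmult[OF assms(2), of "-1"]] by simp

lemma sep_poly_sum:
  assumes "\<And>i. i \<in> I \<Longrightarrow> sep_poly N E (f i)"
  shows "sep_poly N E (\<lambda>y. \<Sum>i\<in>I. f i y)"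
  using assms
  by (induction I rule: infinite_finite_induct) (auto intro: sep_poly_const sep_poly_add)

lemma sep_poly_prod:
  assumes "\<And>i. i \<in> I \<Longrightarrow> sep_poly N E (f i)"
  shows "sep_poly N (card I * E) (\<lambda>y. \<Prod>i\<in>I. f i y)"
  using assms
proof (induction I rule: infinite_finite_induct)
  case (insert i I)
  then have "sep_poly N (E + card I * E) (\<lambda>y. f i y * (\<Prod>i\<in>I. f i y))"
    by (intro sep_poly_mult) auto
  then show ?case using insert.hyps by simp
qed (auto intro: sep_poly_const)

lemma sep_poly_power:
  assumes "sep_poly N E f"
  shows "sep_poly N (k * E) (\<lambda>y. f y ^ k)"
  using sep_poly_prod[of "{..<k}" N E "\<lambda>_. f"] assms by simp

text \<open>The coordinates are released from the grid one at a time: with the others fixed, a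
  polynomial of degree at most \<open>E\<close> vanishes at the \<open>E + 1\<close> points 0, ...,
  \<open>E\<close>, hence identically.\<close>

lemma sep_poly_eq_0:
  assumes f: "sep_poly N E f"
    and grid: "\<And>y. (\<forall>i\<ge>N. y i = 0) \<Longrightarrow> (\<forall>i<N. y i \<in> real ` {..E}) \<Longrightarrow> f y = 0"
    and y: "\<forall>i\<ge>N. y i = 0"
  shows "f y = 0"
proof -
  have "k \<le> N \<Longrightarrow> (\<forall>i\<ge>N. y i = 0) \<Longrightarrow> (\<forall>i. k \<le> i \<and> i < N \<longrightarrow> y i \<in> real ` {..E}) \<Longrightarrow> f y = 0" for k y
  proof (induction k arbitrary: y)
    case 0
    then show ?case using grid by simp
  next
    case (Suc k)
    obtain p where p: "degree p \<le> E" "\<And>t. f (y(k := t)) = poly p t"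
      using f Suc.prems(1) unfolding sep_poly_def by (meson Suc_le_lessD)
    have "poly p t = 0" if "t \<in> real ` {..E}" for t
    proof -
      have "f (y(k := t)) = 0" using Suc that by (intro Suc.IH) auto
      then show ?thesis using p(2) by simp
    qed
    then have sub: "real ` {..E} \<subseteq> {t. poly p t = 0}" by blast
    have "p = 0"
    proof (rule ccontr)
      assume p0: "p \<noteq> 0"
      have "card (real ` {..E}) \<le> card {t. poly p t = 0}"
        by (rule card_mono[OF poly_roots_finite[OF p0] sub])
      also have "\<dots> \<le> E" using card_poly_roots_bound[OF p0] p(1) by simp
      finally show False by (simp add: card_image)
    qed
    then show ?case using p(2)[of "y k"] by simp
  qed
  from this[of N y] show ?thesis using y by simp
qed

lemma finite_grid: "finite {y :: nat \<Rightarrow> real. (\<forall>i\<ge>N. y i = 0) \<and> (\<forall>i<N. y i \<in> real ` {..E})}"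
  and card_grid_le: "card {y :: nat \<Rightarrow> real. (\<forall>i\<ge>N. y i = 0) \<and> (\<forall>i<N. y i \<in> real ` {..E})} \<le> (E + 1) ^ N"
proof -
  let ?G = "{y :: nat \<Rightarrow> real. (\<forall>i\<ge>N. y i = 0) \<and> (\<forall>i<N. y i \<in> real ` {..E})}"
  define e where "e g i = (if i < N then real (g i) else 0)" for g :: "nat \<Rightarrow> nat" and i
  define S where "S = PiE {..<N} (\<lambda>_. {..E})"
  have S: "finite S" "card S = (E + 1) ^ N" by (auto simp: S_def card_PiE intro: finite_PiE)
  have "?G \<subseteq> e ` S"
  proof
    fix y assume y: "y \<in> ?G"
    define g where "g = restrict (\<lambda>i. nat \<lfloor>y i\<rfloor>) {..<N}"
    have "g \<in> S" using y by (force simp: g_def S_def)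
    moreover have "e g = y" using y by (force simp: e_def g_def)
    ultimately show "y \<in> e ` S" by blast
  qed
  note sub = this
  show "finite ?G" by (rule finite_subset[OF sub]) (use S in simp)
  have "card ?G \<le> card (e ` S)" by (rule card_mono[OF _ sub]) (use S in simp)
  also have "\<dots> \<le> card S" by (rule card_image_le) (rule S)
  finally show "card ?G \<le> (E + 1) ^ N" by (simp only: S)
qed

text \<open>Extensional functions, so that each exponent vector is represented by exactly one
  function and the set is finite.\<close>

definition exponents :: "nat \<Rightarrow> nat \<Rightarrow> (nat \<Rightarrow> nat) set" where
  "exponents m D = PiE {..<m} (\<lambda>_. {..D})"

lemma finite_exponents [simp]: "finite (exponents m D)"
  by (simp add: exponents_def finite_PiE)

lemma card_exponents: "card (exponents m D) = (D + 1) ^ m"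
  by (simp add: exponents_def card_PiE)

text \<open>Dimension count: there are more monomials in \<open>H\<^sub>0, \<dots>, H\<^sub>m\<^sub>-\<^sub>1, y\<^sub>m, l\<close> with
  exponents at most \<open>D\<close> than points in a grid on which polynomials of their degree are determined.\<close>

lemma algebraic_relation:
  fixes H :: "nat \<Rightarrow> (nat \<Rightarrow> real) \<Rightarrow> real"
  assumes mn: "m \<ge> 1" "n \<ge> 1"
    and H: "\<And>i. i < m \<Longrightarrow> sep_poly (m + 1) n (H i)" and l: "sep_poly (m + 1) 1 l"
    and D: "D = (3 * n * m) ^ (m + 1)"
  obtains q :: "(nat \<Rightarrow> nat) \<Rightarrow> nat \<Rightarrow> nat \<Rightarrow> real"
  where "\<exists>\<alpha>\<in>exponents m D. \<exists>\<gamma>\<le>D. \<exists>\<beta>\<le>D. q \<alpha> \<gamma> \<beta> \<noteq> 0"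
    "\<And>y. \<forall>i>m. y i = 0 \<Longrightarrow> (\<Sum>\<alpha>\<in>exponents m D. \<Sum>\<gamma>\<le>D. \<Sum>\<beta>\<le>D.
       q \<alpha> \<gamma> \<beta> * ((\<Prod>i<m. H i y ^ \<alpha> i) * y m ^ \<gamma> * l y ^ \<beta>)) = 0"
proof -
  define I where "I = exponents m D \<times> {..D} \<times> {..D}"
  \<comment> \<open>Degree of a monomial in each single variable: at most \<open>D * n\<close> from
    each of the \<open>m\<close> powers of \<open>H\<close>, and \<open>D\<close> from each of the
    last two factors.\<close>
  define E where "E = m * (D * n) + D + D"
  define G where "G = {y :: nat \<Rightarrow> real. (\<forall>i\<ge>m + 1. y i = 0) \<and> (\<forall>i<m + 1. y i \<in> real ` {..E})}"
  define mon where "mon = (\<lambda>(\<alpha>, \<gamma>, \<beta>) y. (\<Prod>i<m. H i y ^ \<alpha> i) * y m ^ \<gamma> * l y ^ \<beta>)"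
  have sep: "sep_poly (m + 1) E (mon t)" if t: "t \<in> I" for t
  proof -
    obtain \<alpha> \<gamma> \<beta> where t': "t = (\<alpha>, \<gamma>, \<beta>)" "\<And>i. i < m \<Longrightarrow> \<alpha> i \<le> D" "\<gamma> \<le> D" "\<beta> \<le> D"
      using t by (auto simp: I_def exponents_def PiE_iff)
    have "sep_poly (m + 1) (D * n) (\<lambda>y. H i y ^ \<alpha> i)" if "i < m" for i
      by (rule sep_poly_mono[OF sep_poly_power[OF H[OF that]]]) (use t'(2)[OF that] in simp)
    then have "sep_poly (m + 1) (card {..<m} * (D * n)) (\<lambda>y. \<Prod>i<m. H i y ^ \<alpha> i)"
      by (intro sep_poly_prod) simp
    moreover have "sep_poly (m + 1) D (\<lambda>y. y m ^ \<gamma>)"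
      by (rule sep_poly_mono[OF sep_poly_power[OF sep_poly_var]]) (use t' in simp)
    moreover have "sep_poly (m + 1) D (\<lambda>y. l y ^ \<beta>)"
      by (rule sep_poly_mono[OF sep_poly_power[OF l]]) (use t' in simp)
    ultimately show ?thesis
      unfolding mon_def t'(1) E_def by (simp add: sep_poly_mult)
  qed
  have "E + 1 \<le> 3 * n * m * (D + 1)"
  proof -
    have 1: "1 \<le> n * m" using mn by simp
    have "2 * D * 1 \<le> 2 * D * (n * m)" using 1 by (rule mult_le_mono2)
    moreover have "E = n * m * D + 2 * D * 1" by (simp add: E_def)
    ultimately have "E \<le> n * m * D + 2 * D * (n * m)" by linarith
    moreover have "3 * n * m * (D + 1) = n * m * D + 2 * D * (n * m) + 3 * (n * m)"
      by (simp add: algebra_simps)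
    ultimately show ?thesis using 1 by linarith
  qed
  \<comment> \<open>This fixes \<open>D\<close>: since \<open>(3 * n * m) ^ (m + 1) = D\<close>, the
    grid has at most \<open>D * (D + 1) ^ (m + 1)\<close> points, fewer than the
    \<open>(D + 1) ^ (m + 2)\<close> monomials.\<close>
  then have "(E + 1) ^ (m + 1) \<le> (3 * n * m * (D + 1)) ^ (m + 1)" by (rule power_mono) simp
  also have "\<dots> = D * (D + 1) ^ (m + 1)" unfolding D power_mult_distrib ..
  also have "\<dots> < (D + 1) * (D + 1) ^ (m + 1)" by simp
  also have "\<dots> = card I"
    by (simp add: I_def card_exponents card_cartesian_product algebra_simps)
  finally have "card G < card I"
    using card_grid_le[of "m + 1" E] unfolding G_def by simp
  moreover have "finite I" "finite G"
    using finite_grid[of "m + 1" E] by (auto simp: I_def G_def)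
  ultimately obtain q where q: "\<exists>t\<in>I. q t \<noteq> 0" "\<forall>y\<in>G. (\<Sum>t\<in>I. q t * mon t y) = 0"
    using homogeneous_system_nontrivial[of G I mon] by blast
  have "(\<Sum>t\<in>I. q t * mon t y) = 0" if "\<forall>i\<ge>m + 1. y i = 0" for y
    by (rule sep_poly_eq_0[where f = "\<lambda>y. \<Sum>t\<in>I. q t * mon t y", OF sep_poly_sum[OF sep_poly_cmult[OF sep]]])
       (use q(2) that in \<open>auto simp: G_def\<close>)
  then have "(\<Sum>\<alpha>\<in>exponents m D. \<Sum>\<gamma>\<le>D. \<Sum>\<beta>\<le>D.
       q (\<alpha>, \<gamma>, \<beta>) * ((\<Prod>i<m. H i y ^ \<alpha> i) * y m ^ \<gamma> * l y ^ \<beta>)) = 0" if "\<forall>i>m. y i = 0" for y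
    using that by (simp add: I_def mon_def sum.cartesian_product' Suc_le_eq)
  moreover have "\<exists>\<alpha>\<in>exponents m D. \<exists>\<gamma>\<le>D. \<exists>\<beta>\<le>D. q (\<alpha>, \<gamma>, \<beta>) \<noteq> 0"
    using q(1) by (auto simp: I_def)
  ultimately show ?thesis using that[of "\<lambda>\<alpha> \<gamma> \<beta>. q (\<alpha>, \<gamma>, \<beta>)"] by blast
qed

text \<open>On a curve where each H_i is \<open>s\<close> times a continuous function, the relation
  is \<open>s ^ k\<close> times a continuous function \<open>K\<close>, so \<open>K\<close> vanishes
  for \<open>s \<noteq> 0\<close> and hence at 0. The power of 0 keeps exactly the terms of total
  degree \<open>k\<close>.\<close>

lemma leading_form_vanishes:
  fixes q :: "(nat \<Rightarrow> nat) \<Rightarrow> nat \<Rightarrow> nat \<Rightarrow> real"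
  assumes low: "\<And>\<alpha> \<gamma> \<beta>. \<alpha> \<in> A \<Longrightarrow> \<gamma> \<le> D \<Longrightarrow> \<beta> \<le> D \<Longrightarrow> (\<Sum>i<m. \<alpha> i) < k \<Longrightarrow> q \<alpha> \<gamma> \<beta> = 0"
    and zero: "\<And>s. (\<Sum>\<alpha>\<in>A. \<Sum>\<gamma>\<le>D. \<Sum>\<beta>\<le>D.
       q \<alpha> \<gamma> \<beta> * ((\<Prod>i<m. (s * h i s) ^ \<alpha> i) * \<tau> ^ \<gamma> * T s ^ \<beta>)) = 0"
    and h: "\<And>i. i < m \<Longrightarrow> isCont (h i) 0" and T: "isCont T 0"
  shows "(\<Sum>\<alpha>\<in>A. \<Sum>\<gamma>\<le>D. \<Sum>\<beta>\<le>D.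
       q \<alpha> \<gamma> \<beta> * (0 ^ ((\<Sum>i<m. \<alpha> i) - k) * (\<Prod>i<m. h i 0 ^ \<alpha> i) * \<tau> ^ \<gamma> * T 0 ^ \<beta>)) = 0"
proof -
  define K where "K s = (\<Sum>\<alpha>\<in>A. \<Sum>\<gamma>\<le>D. \<Sum>\<beta>\<le>D.
       q \<alpha> \<gamma> \<beta> * (s ^ ((\<Sum>i<m. \<alpha> i) - k) * (\<Prod>i<m. h i s ^ \<alpha> i) * \<tau> ^ \<gamma> * T s ^ \<beta>))" for s
  have "s ^ k * K s = (\<Sum>\<alpha>\<in>A. \<Sum>\<gamma>\<le>D. \<Sum>\<beta>\<le>D.
       q \<alpha> \<gamma> \<beta> * ((\<Prod>i<m. (s * h i s) ^ \<alpha> i) * \<tau> ^ \<gamma> * T s ^ \<beta>))" for s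
    unfolding K_def sum_distrib_left
  proof (intro sum.cong refl)
    fix \<alpha> \<gamma> \<beta> assume *: "\<alpha> \<in> A" "\<gamma> \<in> {..D}" "\<beta> \<in> {..D}"
    show "s ^ k * (q \<alpha> \<gamma> \<beta> * (s ^ ((\<Sum>i<m. \<alpha> i) - k) * (\<Prod>i<m. h i s ^ \<alpha> i) * \<tau> ^ \<gamma> * T s ^ \<beta>)) =
        q \<alpha> \<gamma> \<beta> * ((\<Prod>i<m. (s * h i s) ^ \<alpha> i) * \<tau> ^ \<gamma> * T s ^ \<beta>)"
    proof (cases "(\<Sum>i<m. \<alpha> i) < k")
      case True
      then show ?thesis using low * by simp
    next
      case False
      then have 1: "s ^ k * s ^ ((\<Sum>i<m. \<alpha> i) - k) = s ^ (\<Sum>i<m. \<alpha> i)"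
        by (simp flip: power_add)
      have 2: "(\<Prod>i<m. (s * h i s) ^ \<alpha> i) = s ^ (\<Sum>i<m. \<alpha> i) * (\<Prod>i<m. h i s ^ \<alpha> i)"
        by (simp add: power_mult_distrib prod.distrib power_sum)
      show ?thesis unfolding 2 1[symmetric] by (simp only: mult_ac)
    qed
  qed
  then have "s ^ k * K s = 0" for s by (simp only: zero)
  then have K0: "K s = 0" if "s \<noteq> 0" for s
    using that by (metis mult_eq_0_iff power_not_zero)
  have "isCont K 0" unfolding K_def using h T by (intro continuous_intros) auto
  then have "(K \<longlongrightarrow> K 0) (at 0)" by (simp add: isCont_def)
  moreover have "(K \<longlongrightarrow> 0) (at 0)"
    by (rule tendsto_eventually) (auto simp: eventually_at_filter K0)
  ultimately have "K 0 = 0" using tendsto_unique[OF at_neq_bot] by blast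
  then show ?thesis by (simp add: K_def)
qed

lemma digits_unique:
  fixes \<alpha> \<beta> :: "nat \<Rightarrow> nat"
  assumes "(\<Sum>i<m. \<alpha> i * b ^ i) = (\<Sum>i<m. \<beta> i * b ^ i)" "\<And>i. i < m \<Longrightarrow> \<alpha> i < b" "\<And>i. i < m \<Longrightarrow> \<beta> i < b"
  shows "\<forall>i<m. \<alpha> i = \<beta> i"
  using assms
proof (induction m arbitrary: \<alpha> \<beta>)
  case (Suc m)
  have split: "(\<Sum>i<Suc m. \<alpha> i * b ^ i) = \<alpha> 0 + b * (\<Sum>i<m. \<alpha> (Suc i) * b ^ i)" for \<alpha> :: "nat \<Rightarrow> nat"
    unfolding sum.lessThan_Suc_shift by (simp add: sum_distrib_left mult_ac)
  have eq: "\<alpha> 0 + b * (\<Sum>i<m. \<alpha> (Suc i) * b ^ i) = \<beta> 0 + b * (\<Sum>i<m. \<beta> (Suc i) * b ^ i)"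
    using Suc.prems(1) by (simp only: split)
  have b: "\<alpha> 0 < b" "\<beta> 0 < b" using Suc.prems(2,3) by auto
  have 0: "\<alpha> 0 = \<beta> 0" using arg_cong[OF eq, of "\<lambda>x. x mod b"] b by simp
  then have "(\<Sum>i<m. \<alpha> (Suc i) * b ^ i) = (\<Sum>i<m. \<beta> (Suc i) * b ^ i)" using eq b by simp
  then have "\<forall>i<m. \<alpha> (Suc i) = \<beta> (Suc i)"
    using Suc.prems(2,3) by (intro Suc.IH) auto
  then show ?case using 0 less_Suc_eq_0_disj by auto
qed simp

text \<open>The Kronecker substitution \<open>a\<^sub>i = x ^ (D + 1) ^ i\<close> separates the exponents.\<close>

lemma nonvanishing_point:
  fixes q :: "(nat \<Rightarrow> nat) \<Rightarrow> real"
  assumes "\<alpha> \<in> exponents m D" "q \<alpha> \<noteq> 0"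
  obtains a :: "nat \<Rightarrow> real" where "(\<Sum>\<alpha>\<in>exponents m D. q \<alpha> * (\<Prod>i<m. a i ^ \<alpha> i)) \<noteq> 0"
proof -
  define e where "e \<alpha> = (\<Sum>i<m. \<alpha> i * (D + 1) ^ i)" for \<alpha> :: "nat \<Rightarrow> nat"
  have inj: "\<beta> = \<beta>'" if "e \<beta> = e \<beta>'" "\<beta> \<in> exponents m D" "\<beta>' \<in> exponents m D" for \<beta> \<beta>'
  proof (rule PiE_ext[of \<beta> "{..<m}" "\<lambda>_. {..D}"])
    fix i assume "i \<in> {..<m}"
    have "\<beta> i < D + 1" "\<beta>' i < D + 1" if "i < m" for i
      using \<open>\<beta> \<in> exponents m D\<close> \<open>\<beta>' \<in> exponents m D\<close> that by (auto simp: exponents_def PiE_iff less_Suc_eq_le)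
    then have "\<forall>i<m. \<beta> i = \<beta>' i"
      using that(1) unfolding e_def by (intro digits_unique) auto
    then show "\<beta> i = \<beta>' i" using \<open>i \<in> {..<m}\<close> by simp
  qed (use that in \<open>auto simp: exponents_def\<close>)
  define p where "p = (\<Sum>\<beta>\<in>exponents m D. monom (q \<beta>) (e \<beta>))"
  have "coeff p (e \<alpha>) = (\<Sum>\<beta>\<in>exponents m D. if \<beta> = \<alpha> then q \<beta> else 0)"
    unfolding p_def coeff_sum by (intro sum.cong) (use inj assms in auto)
  also have "\<dots> = q \<alpha>" using assms by simp
  finally have "p \<noteq> 0" using assms by auto
  then obtain x where x: "poly p x \<noteq> 0" using poly_all_0_iff_0 by blast
  have "(\<Prod>i<m. (x ^ ((D + 1) ^ i)) ^ \<beta> i) = x ^ e \<beta>" for \<beta>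
    by (simp add: e_def power_sum mult.commute flip: power_mult)
  then show ?thesis
    using x by (intro that[of "\<lambda>i. x ^ ((D + 1) ^ i)"]) (simp add: p_def poly_sum poly_monom)
qed

text \<open>The hypothesis \<open>path\<close> provides, for every \<tau> and all speeds
  \<open>a\<close>, a curve through the point over \<tau> along which H_i is \<open>a i * s\<close>
  to first order. On it the relation degenerates to its lowest form in H evaluated at
  \<open>a\<close>, a polynomial in \<tau> and \<open>L \<tau>\<close> alone.\<close>

theorem elimination:
  fixes H :: "nat \<Rightarrow> (nat \<Rightarrow> real) \<Rightarrow> real" and L :: "real \<Rightarrow> real"
  assumes mn: "m \<ge> 1" "n \<ge> 1"
    and H: "\<And>i. i < m \<Longrightarrow> sep_poly (m + 1) n (H i)" and l: "sep_poly (m + 1) 1 l"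
    and D: "D = (3 * n * m) ^ (m + 1)"
    and path: "\<And>\<tau> a. \<tau> > 0 \<Longrightarrow> \<exists>\<eta> h. (\<forall>s. \<eta> s m = \<tau> \<and> (\<forall>i>m. \<eta> s i = 0)) \<and>
      (\<forall>i<m. (\<forall>s. H i (\<eta> s) = s * h i s) \<and> isCont (h i) 0 \<and> h i 0 = a i) \<and>
      isCont (\<lambda>s. l (\<eta> s)) 0 \<and> l (\<eta> 0) = L \<tau>"
  obtains p :: "nat \<Rightarrow> nat \<Rightarrow> real" where "\<exists>\<gamma>\<le>D. \<exists>\<beta>\<le>D. p \<gamma> \<beta> \<noteq> 0"
    "\<And>\<tau>. \<tau> > 0 \<Longrightarrow> (\<Sum>\<gamma>\<le>D. \<Sum>\<beta>\<le>D. p \<gamma> \<beta> * (\<tau> ^ \<gamma> * L \<tau> ^ \<beta>)) = 0"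
proof -
  define A where "A = exponents m D"
  obtain q :: "(nat \<Rightarrow> nat) \<Rightarrow> nat \<Rightarrow> nat \<Rightarrow> real"
    where q0: "\<exists>\<alpha>\<in>A. \<exists>\<gamma>\<le>D. \<exists>\<beta>\<le>D. q \<alpha> \<gamma> \<beta> \<noteq> 0"
    and q: "\<And>y. \<forall>i>m. y i = 0 \<Longrightarrow> (\<Sum>\<alpha>\<in>A. \<Sum>\<gamma>\<le>D. \<Sum>\<beta>\<le>D.
       q \<alpha> \<gamma> \<beta> * ((\<Prod>i<m. H i y ^ \<alpha> i) * y m ^ \<gamma> * l y ^ \<beta>)) = 0"
    using algebraic_relation[where H = H, OF mn H l D] unfolding A_def by blast
  define N where "N k \<longleftrightarrow> (\<exists>\<alpha>\<in>A. \<exists>\<gamma>\<le>D. \<exists>\<beta>\<le>D. q \<alpha> \<gamma> \<beta> \<noteq> 0 \<and> (\<Sum>i<m. \<alpha> i) = k)" for k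
  define k where "k = (LEAST k. N k)"
  have "\<exists>k. N k" using q0 unfolding N_def by blast
  then have "N k" unfolding k_def by (rule LeastI_ex)
  then obtain \<alpha> \<gamma> \<beta> where \<alpha>: "\<alpha> \<in> A" "\<gamma> \<le> D" "\<beta> \<le> D" "q \<alpha> \<gamma> \<beta> \<noteq> 0" "(\<Sum>i<m. \<alpha> i) = k"
    unfolding N_def by blast
  have low: "q \<alpha> \<gamma> \<beta> = 0" if "\<alpha> \<in> A" "\<gamma> \<le> D" "\<beta> \<le> D" "(\<Sum>i<m. \<alpha> i) < k" for \<alpha> \<gamma> \<beta>
    using not_less_Least[of "\<Sum>i<m. \<alpha> i" N] that unfolding k_def N_def by blast
  \<comment> \<open>As \<open>0 ^ 0 = 1\<close>, this is 1 in total degree \<open>k\<close> and 0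
    above. Truncated subtraction also gives 1 below \<open>k\<close>, but there \<open>q\<close>
    vanishes by \<open>low\<close>.\<close>
  define w where "w \<alpha> = (0::real) ^ ((\<Sum>i<m. \<alpha> i) - k)" for \<alpha> :: "nat \<Rightarrow> nat"
  \<comment> \<open>The speeds are fixed before any \<tau>, so that \<open>p\<close> does not depend
    on \<tau>; one nonzero coefficient is enough.\<close>
  obtain a where a: "(\<Sum>\<alpha>\<in>A. (q \<alpha> \<gamma> \<beta> * w \<alpha>) * (\<Prod>i<m. a i ^ \<alpha> i)) \<noteq> 0"
    using nonvanishing_point[of \<alpha> m D "\<lambda>\<alpha>. q \<alpha> \<gamma> \<beta> * w \<alpha>"] \<alpha> unfolding A_def w_def by auto
  define p where "p \<gamma> \<beta> = (\<Sum>\<alpha>\<in>A. (q \<alpha> \<gamma> \<beta> * w \<alpha>) * (\<Prod>i<m. a i ^ \<alpha> i))" for \<gamma> \<beta>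
  have "(\<Sum>\<gamma>\<le>D. \<Sum>\<beta>\<le>D. p \<gamma> \<beta> * (\<tau> ^ \<gamma> * L \<tau> ^ \<beta>)) = 0" if \<tau>: "\<tau> > 0" for \<tau>
  proof -
    obtain \<eta> h where \<eta>: "\<And>s. \<eta> s m = \<tau>" "\<And>s. \<forall>i>m. \<eta> s i = 0"
      and h: "\<And>i s. i < m \<Longrightarrow> H i (\<eta> s) = s * h i s" "\<And>i. i < m \<Longrightarrow> isCont (h i) 0" "\<And>i. i < m \<Longrightarrow> h i 0 = a i"
      and T: "isCont (\<lambda>s. l (\<eta> s)) 0" "l (\<eta> 0) = L \<tau>"
      using path[OF \<tau>, of a] by blast
    have "(\<Sum>\<alpha>\<in>A. \<Sum>\<gamma>\<le>D. \<Sum>\<beta>\<le>D.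
       q \<alpha> \<gamma> \<beta> * ((\<Prod>i<m. (s * h i s) ^ \<alpha> i) * \<tau> ^ \<gamma> * l (\<eta> s) ^ \<beta>)) = 0" for s
    proof -
      have "(\<Prod>i<m. (s * h i s) ^ \<alpha> i) = (\<Prod>i<m. H i (\<eta> s) ^ \<alpha> i)" for \<alpha>
        by (rule prod.cong) (simp_all add: h(1))
      then show ?thesis using q[OF \<eta>(2)] \<eta>(1) by simp
    qed
    from leading_form_vanishes[OF low this h(2) T(1)]
    have "(\<Sum>\<alpha>\<in>A. \<Sum>\<gamma>\<le>D. \<Sum>\<beta>\<le>D.
       q \<alpha> \<gamma> \<beta> * (w \<alpha> * (\<Prod>i<m. a i ^ \<alpha> i) * \<tau> ^ \<gamma> * L \<tau> ^ \<beta>)) = 0"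
      by (simp add: w_def T(2) h(3))
    moreover have "(\<Sum>\<gamma>\<le>D. \<Sum>\<beta>\<le>D. p \<gamma> \<beta> * (\<tau> ^ \<gamma> * L \<tau> ^ \<beta>)) =
        (\<Sum>\<gamma>\<le>D. \<Sum>\<beta>\<le>D. \<Sum>\<alpha>\<in>A. q \<alpha> \<gamma> \<beta> * (w \<alpha> * (\<Prod>i<m. a i ^ \<alpha> i) * \<tau> ^ \<gamma> * L \<tau> ^ \<beta>))"
      unfolding p_def sum_distrib_right by (intro sum.cong refl) (simp add: mult_ac)
    moreover have "\<dots> = (\<Sum>\<alpha>\<in>A. \<Sum>\<gamma>\<le>D. \<Sum>\<beta>\<le>D. q \<alpha> \<gamma> \<beta> * (w \<alpha> * (\<Prod>i<m. a i ^ \<alpha> i) * \<tau> ^ \<gamma> * L \<tau> ^ \<beta>))"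
      by (rule trans[OF sum.cong[OF refl sum.swap] sum.swap])
    ultimately show ?thesis by simp
  qed
  then show ?thesis using that[of p] \<alpha>(2,3) a unfolding p_def by blast
qed

text \<open>Multiplication by \<open>\<mu> ^ D\<close> clears the powers of \<open>1 / \<mu>\<close>
  and leaves the degree in \<open>f\<close> unchanged.\<close>

lemma annihilator_of_relation:
  fixes p :: "nat \<Rightarrow> nat \<Rightarrow> real"
  assumes nz: "\<exists>\<gamma>\<le>D. \<exists>\<beta>\<le>D. p \<gamma> \<beta> \<noteq> 0"
    and rel: "\<And>\<mu>. \<mu> > 0 \<Longrightarrow> (\<Sum>\<gamma>\<le>D. \<Sum>\<beta>\<le>D. p \<gamma> \<beta> * ((1 / \<mu>) ^ \<gamma> * f \<mu> ^ \<beta>)) = 0"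
  shows "\<exists>P. P \<noteq> 0 \<and> degree P \<le> D \<and> annihilates f P"
proof -
  define P :: "complex poly poly" where
    "P = (\<Sum>\<beta>\<le>D. monom (\<Sum>\<gamma>\<le>D. monom (of_real (p \<gamma> \<beta>)) (D - \<gamma>)) \<beta>)"
  obtain \<gamma> \<beta> where gb: "\<gamma> \<le> D" "\<beta> \<le> D" "p \<gamma> \<beta> \<noteq> 0" using nz by blast
  have coeffP: "coeff P j = (if j \<le> D then (\<Sum>\<gamma>\<le>D. monom (of_real (p \<gamma> j)) (D - \<gamma>)) else 0)" for j
    by (simp add: P_def coeff_sum)
  have "coeff (coeff P \<beta>) (D - \<gamma>) = (\<Sum>\<gamma>'\<le>D. coeff (monom (of_real (p \<gamma>' \<beta>)) (D - \<gamma>')) (D - \<gamma>))"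
    using gb by (simp add: coeffP coeff_sum)
  also have "\<dots> = (\<Sum>\<gamma>'\<le>D. if \<gamma>' = \<gamma> then of_real (p \<gamma>' \<beta>) else 0)"
    by (rule sum.cong) (use gb in auto)
  also have "\<dots> \<noteq> 0" using gb by simp
  finally have "P \<noteq> 0" by auto
  moreover have "degree P \<le> D" by (rule degree_le) (simp add: coeffP)
  moreover have "poly (eval_coeffs P (of_real \<mu>)) (of_real (f \<mu>)) = 0" if \<mu>: "\<mu> > 0" for \<mu>
  proof -
    have sp: "eval_coeffs P x = (\<Sum>\<beta>\<le>D. monom (\<Sum>\<gamma>\<le>D. of_real (p \<gamma> \<beta>) * x ^ (D - \<gamma>)) \<beta>)" for x
      by (rule poly_eqI) (simp add: coeffP coeff_sum poly_sum poly_monom)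
    have "poly (eval_coeffs P (of_real \<mu>)) (of_real (f \<mu>)) =
        of_real (\<Sum>\<beta>\<le>D. (\<Sum>\<gamma>\<le>D. p \<gamma> \<beta> * \<mu> ^ (D - \<gamma>)) * f \<mu> ^ \<beta>)"
      by (simp add: sp poly_sum poly_monom)
    also have "(\<Sum>\<beta>\<le>D. (\<Sum>\<gamma>\<le>D. p \<gamma> \<beta> * \<mu> ^ (D - \<gamma>)) * f \<mu> ^ \<beta>) =
        \<mu> ^ D * (\<Sum>\<gamma>\<le>D. \<Sum>\<beta>\<le>D. p \<gamma> \<beta> * ((1 / \<mu>) ^ \<gamma> * f \<mu> ^ \<beta>))"
      unfolding sum_distrib_left sum_distrib_right
      by (subst sum.swap, intro sum.cong refl)
         (use \<mu> in \<open>simp add: power_diff power_one_over field_simps\<close>)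
    finally show ?thesis using rel[OF \<mu>] by simp
  qed
  then have "annihilates f P"
    unfolding annihilates_def eventually_at_right_field by (intro exI[of _ 1]) simp
  ultimately show ?thesis by blast
qed

section \<open>Positive definite matrices and the Frobenius norm\<close>

lemma mult_mat_entry:
  assumes "A \<in> carrier_mat n n" "B \<in> carrier_mat n n" "i < n" "j < n"
  shows "(A * B) $$ (i, j) = (\<Sum>k<n. A $$ (i, k) * B $$ (k, j))"
  using assms by (simp add: scalar_prod_def atLeast0LessThan)

lemma mat_trace_mult:
  assumes "A \<in> carrier_mat n n" "B \<in> carrier_mat n n"
  shows "mat_trace (A * B) = (\<Sum>i<n. \<Sum>j<n. A $$ (i, j) * B $$ (j, i))"
proof -
  have "mat_trace (A * B) = (\<Sum>i<n. (A * B) $$ (i, i))" using assms by (simp add: mat_trace_def)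
  also have "\<dots> = (\<Sum>i<n. \<Sum>j<n. A $$ (i, j) * B $$ (j, i))"
    by (intro sum.cong refl mult_mat_entry[OF assms]) auto
  finally show ?thesis .
qed

lemma mat_trace_mult_commute:
  assumes "A \<in> carrier_mat n n" "B \<in> carrier_mat n n"
  shows "mat_trace (A * B) = mat_trace (B * A)"
  unfolding mat_trace_mult[OF assms] mat_trace_mult[OF assms(2,1)]
  by (subst sum.swap) (simp add: mult.commute)

lemma mat_trace_add:
  assumes "A \<in> carrier_mat n n" "B \<in> carrier_mat n n"
  shows "mat_trace (A + B) = mat_trace A + mat_trace B"
  using assms by (simp add: mat_trace_def sum.distrib)

lemma mat_trace_minus:
  assumes "A \<in> carrier_mat n n" "B \<in> carrier_mat n n"
  shows "mat_trace (A - B) = mat_trace A - mat_trace B"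
  using assms by (simp add: mat_trace_def sum_subtractf)

lemma mat_trace_smult:
  assumes "A \<in> carrier_mat n n"
  shows "mat_trace (c \<cdot>\<^sub>m A) = c * mat_trace A"
  using assms by (simp add: mat_trace_def sum_distrib_left)

lemma mat_trace_one: "mat_trace (1\<^sub>m n) = real n"
  by (simp add: mat_trace_def)

definition frobenius_sq :: "real mat \<Rightarrow> real" where
  "frobenius_sq M = (\<Sum>i<dim_row M. \<Sum>j<dim_col M. (M $$ (i, j))\<^sup>2)"

lemma frobenius_sq_nonneg: "frobenius_sq M \<ge> 0"
  by (simp add: frobenius_sq_def sum_nonneg)

lemma frobenius_sq_eq_trace:
  assumes "M \<in> carrier_mat n n"
  shows "frobenius_sq M = mat_trace (M * transpose_mat M)"
proof -
  have "transpose_mat M \<in> carrier_mat n n" using assms by simp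
  then show ?thesis
    using assms unfolding mat_trace_mult[OF assms \<open>transpose_mat M \<in> carrier_mat n n\<close>]
    by (auto simp: frobenius_sq_def power2_eq_square intro!: sum.cong)
qed

lemma frobenius_sq_transpose: "frobenius_sq (transpose_mat M) = frobenius_sq M"
  unfolding frobenius_sq_def by (subst sum.swap) simp

lemma entry_square_le_frobenius_sq:
  assumes "M \<in> carrier_mat n n" "i < n" "j < n"
  shows "(M $$ (i, j))\<^sup>2 \<le> frobenius_sq M"
proof -
  have "(M $$ (i, j))\<^sup>2 \<le> (\<Sum>j<n. (M $$ (i, j))\<^sup>2)"
    using assms by (intro member_le_sum[of j "{..<n}" "\<lambda>j. (M $$ (i, j))\<^sup>2"]) auto
  also have "\<dots> \<le> (\<Sum>i<n. \<Sum>j<n. (M $$ (i, j))\<^sup>2)"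
    using assms by (intro member_le_sum[of i "{..<n}" "\<lambda>i. \<Sum>j<n. (M $$ (i, j))\<^sup>2"]) (auto intro: sum_nonneg)
  finally show ?thesis using assms by (simp add: frobenius_sq_def)
qed

lemma frobenius_sq_mult_le:
  assumes A: "A \<in> carrier_mat n n" and B: "B \<in> carrier_mat n n"
  shows "frobenius_sq (A * B) \<le> frobenius_sq A * frobenius_sq B"
proof -
  define a where "a i = (\<Sum>k<n. (A $$ (i, k))\<^sup>2)" for i
  define c where "c j = (\<Sum>k<n. (B $$ (k, j))\<^sup>2)" for j
  have "frobenius_sq (A * B) = (\<Sum>i<n. \<Sum>j<n. ((A * B) $$ (i, j))\<^sup>2)" using A B by (simp add: frobenius_sq_def)
  also have "\<dots> = (\<Sum>i<n. \<Sum>j<n. (\<Sum>k<n. A $$ (i, k) * B $$ (k, j))\<^sup>2)"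
    by (intro sum.cong refl) (simp only: lessThan_iff mult_mat_entry[OF A B])
  also have "\<dots> \<le> (\<Sum>i<n. \<Sum>j<n. a i * c j)"
    unfolding a_def c_def by (intro sum_mono Cauchy_Schwarz_ineq_sum)
  also have "\<dots> = (\<Sum>i<n. a i) * (\<Sum>j<n. c j)" by (simp add: sum_product)
  also have "(\<Sum>j<n. c j) = frobenius_sq B" unfolding c_def frobenius_sq_def using B by (subst sum.swap) simp
  also have "(\<Sum>i<n. a i) = frobenius_sq A" unfolding a_def frobenius_sq_def using A by simp
  finally show ?thesis .
qed

text \<open>Cholesky factorisation by induction: splitting off the last pivot leaves the Schur
  complement \<open>P'\<close>, which is again positive definite.\<close>

lemma pos_def_gram_entries:
  fixes P :: "nat \<Rightarrow> nat \<Rightarrow> real"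
  assumes sym: "\<And>i j. i < n \<Longrightarrow> j < n \<Longrightarrow> P i j = P j i"
    and pd: "\<And>v. \<exists>i<n. v i \<noteq> 0 \<Longrightarrow> (\<Sum>i<n. \<Sum>j<n. v i * P i j * v j) > 0"
  shows "\<exists>L. \<forall>i<n. \<forall>j<n. P i j = (\<Sum>k<n. L i k * L j k)"
  using assms
proof (induction n arbitrary: P)
  case (Suc n)
  have expand: "(\<Sum>i<Suc n. \<Sum>j<Suc n. w i * P i j * w j) =
      (\<Sum>i<n. \<Sum>j<n. w i * P i j * w j) + 2 * w n * (\<Sum>i<n. w i * P i n) + (w n)\<^sup>2 * P n n" for w
  proof -
    have "(\<Sum>j<n. w n * P n j * w j) = w n * (\<Sum>i<n. w i * P i n)"
      unfolding sum_distrib_left using Suc.prems(1) by (intro sum.cong) auto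
    moreover have "(\<Sum>i<n. w i * P i n * w n) = w n * (\<Sum>i<n. w i * P i n)"
      by (simp add: sum_distrib_left mult_ac)
    ultimately show ?thesis by (simp add: sum.distrib power2_eq_square)
  qed
  define p where "p = P n n"
  have p: "p > 0"
    using Suc.prems(2)[of "\<lambda>i. if i = n then 1 else 0"] unfolding expand by (auto simp: p_def)
  define P' where "P' i j = P i j - P i n * P j n / p" for i j
  have pd': "(\<Sum>i<n. \<Sum>j<n. v i * P' i j * v j) > 0" if v: "\<exists>i<n. v i \<noteq> 0" for v
  proof -
    define \<sigma> where "\<sigma> = (\<Sum>i<n. v i * P i n)"
    \<comment> \<open>The last coordinate minimises the form for given \<open>v\<close>; the minimum
      is the form of the Schur complement at \<open>v\<close>.\<close>
    define w where "w i = (if i < n then v i else - \<sigma> / p)" for i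
    have "0 < (\<Sum>i<Suc n. \<Sum>j<Suc n. w i * P i j * w j)"
      by (rule Suc.prems(2)) (use v in \<open>auto simp: w_def intro: less_SucI\<close>)
    also have "\<dots> = (\<Sum>i<n. \<Sum>j<n. v i * P i j * v j) + 2 * (- \<sigma> / p) * \<sigma> + (- \<sigma> / p)\<^sup>2 * p"
      unfolding expand by (simp add: w_def \<sigma>_def p_def)
    also have "\<dots> = (\<Sum>i<n. \<Sum>j<n. v i * P i j * v j) - \<sigma> * \<sigma> / p"
      using p by (simp add: field_simps power2_eq_square)
    also have "\<sigma> * \<sigma> / p = (\<Sum>i<n. \<Sum>j<n. v i * (P i n * P j n / p) * v j)"
      unfolding \<sigma>_def sum_product sum_divide_distrib by (intro sum.cong refl) simp
    also have "(\<Sum>i<n. \<Sum>j<n. v i * P i j * v j) - \<dots> = (\<Sum>i<n. \<Sum>j<n. v i * P' i j * v j)"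
      by (simp add: P'_def left_diff_distrib right_diff_distrib sum_subtractf)
    finally show ?thesis .
  qed
  have "\<exists>L. \<forall>i<n. \<forall>j<n. P' i j = (\<Sum>k<n. L i k * L j k)"
    by (rule Suc.IH) (use Suc.prems(1) pd' in \<open>auto simp: P'_def mult.commute\<close>)
  then obtain L where L: "\<And>i j. i < n \<Longrightarrow> j < n \<Longrightarrow> P' i j = (\<Sum>k<n. L i k * L j k)" by blast
  define L' where "L' i k = (if k = n then P i n / sqrt p else if i = n then 0 else L i k)" for i k
  have last: "L' i n * L' j n = P i n * P j n / p" for i j
    using p by (simp add: L'_def)
  have "P i j = (\<Sum>k<Suc n. L' i k * L' j k)" if ij: "i < Suc n" "j < Suc n" for i j
  proof (cases "i < n \<and> j < n")
    case True
    then have "(\<Sum>k<n. L' i k * L' j k) = P' i j" unfolding L[OF conjunct1[OF True] conjunct2[OF True]]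
      by (intro sum.cong) (auto simp: L'_def)
    then show ?thesis by (simp add: last P'_def)
  next
    case False
    then have "(\<Sum>k<n. L' i k * L' j k) = 0" using ij by (intro sum.neutral) (auto simp: L'_def)
    moreover have "P i n * P j n / p = P i j"
    proof (cases "i = n")
      case True
      then show ?thesis using p Suc.prems(1)[of j n] ij by (simp add: p_def)
    next
      case False
      then show ?thesis using p \<open>\<not> (i < n \<and> j < n)\<close> ij by (simp add: p_def less_Suc_eq)
    qed
    ultimately show ?thesis by (simp add: last)
  qed
  then show ?case by blast
qed simp

lemma quadratic_form_entries:
  assumes "P \<in> carrier_mat n n" "v \<in> carrier_vec n"
  shows "v \<bullet> (P *\<^sub>v v) = (\<Sum>i<n. \<Sum>j<n. v $ i * P $$ (i, j) * v $ j)"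
proof -
  have "v \<bullet> (P *\<^sub>v v) = (\<Sum>i<n. v $ i * (\<Sum>j<n. P $$ (i, j) * v $ j))"
    using assms by (simp add: scalar_prod_def atLeast0LessThan)
  then show ?thesis by (simp add: sum_distrib_left mult.assoc)
qed

lemma pos_def_gram:
  assumes "pos_def n P"
  obtains L where "L \<in> carrier_mat n n" "P = L * transpose_mat L"
proof -
  have P: "P \<in> carrier_mat n n" "transpose_mat P = P" using assms by (auto simp: pos_def_def sym_mats_def)
  have "\<exists>L. \<forall>i<n. \<forall>j<n. P $$ (i, j) = (\<Sum>k<n. L i k * L j k)"
  proof (rule pos_def_gram_entries)
    fix i j assume "i < n" "j < n"
    then show "P $$ (i, j) = P $$ (j, i)" using P by (metis carrier_matD index_transpose_mat(1))
  next
    fix v :: "nat \<Rightarrow> real" assume v: "\<exists>i<n. v i \<noteq> 0"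
    have "vec n v \<noteq> 0\<^sub>v n"
    proof
      assume "vec n v = 0\<^sub>v n"
      then have "vec n v $ i = 0" if "i < n" for i using that by simp
      then show False using v by auto
    qed
    then have "vec n v \<bullet> (P *\<^sub>v vec n v) > 0" using assms by (auto simp: pos_def_def)
    then show "(\<Sum>i<n. \<Sum>j<n. v i * P $$ (i, j) * v j) > 0"
      using quadratic_form_entries[OF P(1), of "vec n v"] by simp
  qed
  then obtain L where L: "\<And>i j. i < n \<Longrightarrow> j < n \<Longrightarrow> P $$ (i, j) = (\<Sum>k<n. L i k * L j k)" by blast
  define M where "M = mat n n (\<lambda>(i, k). L i k)"
  have M: "M \<in> carrier_mat n n" "transpose_mat M \<in> carrier_mat n n" by (auto simp: M_def)
  show ?thesis
  proof (rule that[OF M(1)])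
    show "P = M * transpose_mat M"
    proof (rule eq_matI)
      fix i j assume "i < dim_row (M * transpose_mat M)" "j < dim_col (M * transpose_mat M)"
      then have ij: "i < n" "j < n" using M by auto
      show "P $$ (i, j) = (M * transpose_mat M) $$ (i, j)"
        unfolding mult_mat_entry[OF M ij] L[OF ij] using ij by (simp add: M_def)
    qed (use P M in auto)
  qed
qed

text \<open>\<open>N = L\<^sup>T S\<close> is the inverse of \<open>L\<close> and satisfies
  \<open>S = N\<^sup>T N\<close>, so the traces of a matrix and of its inverse measure the Cholesky
  factor and its inverse.\<close>

lemma pos_def_factors:
  assumes P: "pos_def n P" and S: "S \<in> carrier_mat n n" and PS: "P * S = 1\<^sub>m n"
  obtains L N where "L \<in> carrier_mat n n" "N \<in> carrier_mat n n" "P = L * transpose_mat L"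
    "N * L = 1\<^sub>m n" "L * N = 1\<^sub>m n" "frobenius_sq L = mat_trace P" "frobenius_sq N = mat_trace S"
proof -
  obtain L where L: "L \<in> carrier_mat n n" "P = L * transpose_mat L" using pos_def_gram[OF P] .
  define T where "T = transpose_mat L"
  have T: "T \<in> carrier_mat n n" using L by (simp add: T_def)
  define N where "N = T * S"
  have N: "N \<in> carrier_mat n n" using T S by (simp add: N_def)
  have LN: "L * N = 1\<^sub>m n"
    using PS assoc_mult_mat[OF L(1) T S] by (simp add: N_def L(2) T_def)
  have NL: "N * L = 1\<^sub>m n" by (rule mat_mult_left_right_inverse[OF L(1) N LN])
  have NT: "transpose_mat N * T = 1\<^sub>m n"
    using arg_cong[OF LN, of transpose_mat] transpose_mult[OF L(1) N] by (simp add: T_def)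
  have "transpose_mat N * N = transpose_mat N * (T * S)" by (simp add: N_def)
  also have "\<dots> = S"
    using assoc_mult_mat[of "transpose_mat N" n n T n S n] N T S NT by simp
  finally have "S = transpose_mat N * N" by simp
  then have "mat_trace S = frobenius_sq N"
    using frobenius_sq_eq_trace[of "transpose_mat N" n] N by (simp add: frobenius_sq_transpose)
  then show ?thesis
    using that[OF L(1) N L(2) NL LN] frobenius_sq_eq_trace[OF L(1)] L(2) by simp
qed

text \<open>Cyclicity of the trace, applied to the square \<open>M M\<^sup>T\<close> with
  \<open>M = L\<^sup>T V K\<close>.\<close>

lemma trace_gram_product:
  assumes "L \<in> carrier_mat n n" "K \<in> carrier_mat n n" "V \<in> carrier_mat n n" "transpose_mat V = V"
  shows "mat_trace ((L * transpose_mat L) * V * (K * transpose_mat K) * V) =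
    frobenius_sq (transpose_mat L * V * K)"
proof -
  define T where "T = transpose_mat L"
  define W where "W = transpose_mat K"
  have TW: "T \<in> carrier_mat n n" "W \<in> carrier_mat n n" using assms by (auto simp: T_def W_def)
  note c = assms(1-3) TW
  define M where "M = T * V * K"
  have M: "M \<in> carrier_mat n n" using c by (simp add: M_def)
  have "transpose_mat M = W * (V * L)"
    unfolding M_def using c assms(4)
    by (simp add: transpose_mult[of _ n n _ n] T_def W_def)
  then have "frobenius_sq M = mat_trace (M * (W * (V * L)))" using frobenius_sq_eq_trace[OF M] by simp
  also have "M * (W * (V * L)) = (M * W * V) * L" using c M by (simp add: assoc_mult_mat[of _ n n _ n _ n])
  also have "mat_trace \<dots> = mat_trace (L * (M * W * V))"
    by (rule mat_trace_mult_commute[of _ n]) (use c M in auto)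
  also have "L * (M * W * V) = (L * T) * V * (K * W) * V"
    using c by (simp add: M_def assoc_mult_mat[of _ n n _ n _ n])
  finally show ?thesis by (simp add: M_def T_def W_def)
qed

text \<open>With \<open>P1 = L L\<^sup>T\<close> and \<open>P2 = K K\<^sup>T\<close> the trace on the right is the squared Frobenius norm
  of \<open>L\<^sup>T V K\<close>, from which \<open>V\<close> is recovered by multiplication with the inverse factors.\<close>

lemma frobenius_sq_le_trace:
  assumes "pos_def n P1" "S1 \<in> carrier_mat n n" "P1 * S1 = 1\<^sub>m n"
    and "pos_def n P2" "S2 \<in> carrier_mat n n" "P2 * S2 = 1\<^sub>m n"
    and V: "V \<in> carrier_mat n n" "transpose_mat V = V"
  shows "frobenius_sq V \<le> mat_trace S1 * mat_trace S2 * mat_trace (P1 * V * P2 * V)"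
proof -
  obtain L N where L: "L \<in> carrier_mat n n" "N \<in> carrier_mat n n" "P1 = L * transpose_mat L"
    "N * L = 1\<^sub>m n" "L * N = 1\<^sub>m n" "frobenius_sq N = mat_trace S1"
    using pos_def_factors[OF assms(1-3)] .
  obtain K R where K: "K \<in> carrier_mat n n" "R \<in> carrier_mat n n" "P2 = K * transpose_mat K"
    "R * K = 1\<^sub>m n" "K * R = 1\<^sub>m n" "frobenius_sq R = mat_trace S2"
    using pos_def_factors[OF assms(4-6)] .
  define T where "T = transpose_mat L"
  define U where "U = transpose_mat N"
  have TU: "T \<in> carrier_mat n n" "U \<in> carrier_mat n n" using L by (auto simp: T_def U_def)
  have UT: "U * T = 1\<^sub>m n"
    using arg_cong[OF L(5), of transpose_mat] transpose_mult[OF L(1,2)] by (simp add: T_def U_def)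
  define M where "M = T * V * K"
  have M: "M \<in> carrier_mat n n" using V K TU by (simp add: M_def)
  have "U * M * R = (U * T) * V * (K * R)"
    using TU V K by (simp add: M_def assoc_mult_mat[of _ n n _ n _ n])
  also have "\<dots> = V" using UT K(5) V by simp
  finally have "frobenius_sq V = frobenius_sq (U * M * R)" by simp
  also have "\<dots> \<le> frobenius_sq (U * M) * frobenius_sq R" by (rule frobenius_sq_mult_le) (use TU M K in auto)
  also have "\<dots> \<le> frobenius_sq U * frobenius_sq M * frobenius_sq R"
    by (intro mult_right_mono frobenius_sq_mult_le frobenius_sq_nonneg) (use TU M in auto)
  also have "\<dots> = mat_trace S1 * mat_trace S2 * frobenius_sq M"
    using L(6) K(6) by (simp add: U_def frobenius_sq_transpose)
  also have "frobenius_sq M = mat_trace (P1 * V * P2 * V)"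
    unfolding M_def T_def L(3) K(3) by (rule trace_gram_product[symmetric]) (use L K V in auto)
  finally show ?thesis .
qed

text \<open>For \<open>X = L L\<^sup>T\<close> and \<open>S = K K\<^sup>T\<close> the trace of
  \<open>X * S\<close> is the squared norm of \<open>L\<^sup>T K\<close>; multiplying by the inverse
  of \<open>K\<close>, of squared norm tr \<open>P\<close>, recovers
  \<open>L\<^sup>T\<close>.\<close>

lemma trace_pos_def_mult:
  assumes X: "pos_def n X" and S: "pos_def n S" and P: "P \<in> carrier_mat n n" "S * P = 1\<^sub>m n"
  shows "mat_trace (X * S) \<ge> 0" "mat_trace X \<le> mat_trace (X * S) * mat_trace P"
proof -
  obtain L where L: "L \<in> carrier_mat n n" "X = L * transpose_mat L" using pos_def_gram[OF X] .
  obtain K R where K: "K \<in> carrier_mat n n" "R \<in> carrier_mat n n" "S = K * transpose_mat K"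
    "R * K = 1\<^sub>m n" "K * R = 1\<^sub>m n" "frobenius_sq R = mat_trace P"
    using pos_def_factors[OF S P] .
  define T where "T = transpose_mat L"
  have T: "T \<in> carrier_mat n n" using L by (simp add: T_def)
  have "mat_trace (X * 1\<^sub>m n * S * 1\<^sub>m n) = frobenius_sq (T * 1\<^sub>m n * K)"
    unfolding L(2) K(3) T_def by (rule trace_gram_product) (use L K in auto)
  moreover have "X \<in> carrier_mat n n" "S \<in> carrier_mat n n"
    using X S by (auto simp: pos_def_def sym_mats_def)
  ultimately have eq: "mat_trace (X * S) = frobenius_sq (T * K)" using T K by simp
  then show "mat_trace (X * S) \<ge> 0" by (simp add: frobenius_sq_nonneg)
  have "mat_trace X = frobenius_sq T" unfolding L(2) T_def frobenius_sq_transpose by (rule frobenius_sq_eq_trace[OF L(1), symmetric])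
  also have "T = T * K * R" using T K by (simp add: assoc_mult_mat[of _ n n _ n _ n])
  also have "frobenius_sq (T * K * R) \<le> frobenius_sq (T * K) * frobenius_sq R" by (rule frobenius_sq_mult_le) (use T K in auto)
  finally show "mat_trace X \<le> mat_trace (X * S) * mat_trace P" by (simp add: eq K(6))
qed

lemma pos_def_entry_le_trace:
  assumes X: "pos_def n X" and ij: "i < n" "j < n"
  shows "\<bar>X $$ (i, j)\<bar> \<le> mat_trace X"
proof -
  obtain L where L: "L \<in> carrier_mat n n" "X = L * transpose_mat L" using pos_def_gram[OF X] .
  have tr: "mat_trace X = frobenius_sq L" using frobenius_sq_eq_trace[OF L(1)] L(2) by simp
  have "(X $$ (i, j))\<^sup>2 \<le> frobenius_sq X"
    using X ij by (intro entry_square_le_frobenius_sq) (auto simp: pos_def_def sym_mats_def)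
  also have "\<dots> \<le> frobenius_sq L * frobenius_sq (transpose_mat L)"
    unfolding L(2) by (rule frobenius_sq_mult_le) (use L in auto)
  also have "\<dots> = (mat_trace X)\<^sup>2" by (simp add: tr frobenius_sq_transpose power2_eq_square)
  finally show ?thesis using frobenius_sq_nonneg[of L] by (simp add: tr abs_le_square_iff[symmetric])
qed

section \<open>Analytic functions, determinants and adjugates\<close>

lemma analytic_at_0_const: "analytic_at_0 (\<lambda>_. c)"
  unfolding analytic_at_0_iff_holomorphic
  by (intro exI[of _ 1] conjI exI[of _ "\<lambda>_. of_real c"]) auto

lemma analytic_at_0_id: "analytic_at_0 (\<lambda>t. t)"
  unfolding analytic_at_0_iff_holomorphic
  by (intro exI[of _ 1] conjI exI[of _ "\<lambda>z. z"]) auto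

lemma analytic_at_0_pair:
  assumes "analytic_at_0 f" "analytic_at_0 g" and "e > 0"
  obtains r F G where "r > 0" "r \<le> e" "F holomorphic_on ball 0 r" "G holomorphic_on ball 0 r"
    "\<And>t. 0 < t \<Longrightarrow> t < r \<Longrightarrow> F (of_real t) = of_real (f t) \<and> G (of_real t) = of_real (g t)"
proof -
  obtain r1 F where F: "r1 > 0" "F holomorphic_on ball 0 r1"
      "\<And>t. 0 < t \<Longrightarrow> t < r1 \<Longrightarrow> F (of_real t) = of_real (f t)"
    using assms(1) unfolding analytic_at_0_iff_holomorphic by blast
  obtain r2 G where G: "r2 > 0" "G holomorphic_on ball 0 r2"
      "\<And>t. 0 < t \<Longrightarrow> t < r2 \<Longrightarrow> G (of_real t) = of_real (g t)"
    using assms(2) unfolding analytic_at_0_iff_holomorphic by blast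
  show ?thesis
  proof (rule that[of "min e (min r1 r2)" F G])
    show "F holomorphic_on ball 0 (min e (min r1 r2))" "G holomorphic_on ball 0 (min e (min r1 r2))"
      using F(2) G(2) by (auto elim!: holomorphic_on_subset)
  qed (use F G assms(3) in auto)
qed

lemma analytic_at_0_add:
  assumes "analytic_at_0 f" "analytic_at_0 g"
  shows "analytic_at_0 (\<lambda>t. f t + g t)"
proof (rule analytic_at_0_pair[OF assms, of 1])
  fix r F G assume "r > 0" "F holomorphic_on ball 0 r" "G holomorphic_on ball 0 r"
    "\<And>t. 0 < t \<Longrightarrow> t < r \<Longrightarrow> F (of_real t) = of_real (f t) \<and> G (of_real t) = of_real (g t)"
  then show ?thesis unfolding analytic_at_0_iff_holomorphic
    by (intro exI[of _ r] conjI exI[of _ "\<lambda>z. F z + G z"] holomorphic_on_add) auto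
qed simp

lemma analytic_at_0_mult:
  assumes "analytic_at_0 f" "analytic_at_0 g"
  shows "analytic_at_0 (\<lambda>t. f t * g t)"
proof (rule analytic_at_0_pair[OF assms, of 1])
  fix r F G assume "r > 0" "F holomorphic_on ball 0 r" "G holomorphic_on ball 0 r"
    "\<And>t. 0 < t \<Longrightarrow> t < r \<Longrightarrow> F (of_real t) = of_real (f t) \<and> G (of_real t) = of_real (g t)"
  then show ?thesis unfolding analytic_at_0_iff_holomorphic
    by (intro exI[of _ r] conjI exI[of _ "\<lambda>z. F z * G z"] holomorphic_on_mult) auto
qed simp

lemma analytic_at_0_divide_bounded:
  assumes an: "analytic_at_0 a" "analytic_at_0 b" and e: "e > 0"
    and f: "\<And>t. 0 < t \<Longrightarrow> t < e \<Longrightarrow> b t \<noteq> 0 \<and> f t * b t = a t \<and> \<bar>f t\<bar> \<le> M"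
  shows "analytic_at_0 f"
proof (rule analytic_at_0_pair[OF an e])
  fix r F G assume r: "r > 0" "r \<le> e" "F holomorphic_on ball 0 r" "G holomorphic_on ball 0 r"
    and eq: "\<And>t. 0 < t \<Longrightarrow> t < r \<Longrightarrow> F (of_real t) = of_real (a t) \<and> G (of_real t) = of_real (b t)"
  show ?thesis
    by (rule analytic_at_0_quotient[OF r(1,3,4), of f M]) (use r f eq in \<open>auto simp flip: of_real_mult\<close>)
qed

text \<open>Determinants and adjugates are polynomial in the entries, so they stay in any class
  closed under ring operations; used for analyticity and for continuity at 0.\<close>

locale function_ring =
  fixes Q :: "('a \<Rightarrow> real) \<Rightarrow> bool"
  assumes const: "Q (\<lambda>_. c)"
    and add: "Q f \<Longrightarrow> Q g \<Longrightarrow> Q (\<lambda>x. f x + g x)"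
    and mult: "Q f \<Longrightarrow> Q g \<Longrightarrow> Q (\<lambda>x. f x * g x)"
begin

lemma sum: "(\<And>i. i \<in> I \<Longrightarrow> Q (f i)) \<Longrightarrow> Q (\<lambda>x. \<Sum>i\<in>I. f i x)"
  by (induction I rule: infinite_finite_induct) (auto intro: const add)

lemma prod: "(\<And>i. i \<in> I \<Longrightarrow> Q (f i)) \<Longrightarrow> Q (\<lambda>x. \<Prod>i\<in>I. f i x)"
  by (induction I rule: infinite_finite_induct) (auto intro: const mult)

lemma det:
  assumes M: "\<And>x. M x \<in> carrier_mat n n" and entry: "\<And>i j. i < n \<Longrightarrow> j < n \<Longrightarrow> Q (\<lambda>x. M x $$ (i, j))"
  shows "Q (\<lambda>x. det (M x))"
  unfolding det_def'[OF M]
proof (intro sum mult const prod)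
  fix p i assume "p \<in> {p. p permutes {0..<n}}" "i \<in> {0..<n}"
  then show "Q (\<lambda>x. M x $$ (i, p i))" using permutes_in_image by (intro entry) fastforce+
qed

lemma adj:
  assumes M: "\<And>x. M x \<in> carrier_mat n n" and entry: "\<And>i j. i < n \<Longrightarrow> j < n \<Longrightarrow> Q (\<lambda>x. M x $$ (i, j))"
    and ij: "i < n" "j < n"
  shows "Q (\<lambda>x. adj_mat (M x) $$ (i, j))"
proof -
  have dims: "dim_row (M x) = n" "dim_col (M x) = n" for x using M by auto
  have "Q (\<lambda>x. (- 1) ^ (j + i) * det (mat_delete (M x) j i))"
  proof (intro mult const det[of _ "n - 1"])
    show "mat_delete (M x) j i \<in> carrier_mat (n - 1) (n - 1)" for x
      using mat_delete_carrier[OF M] .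
    fix a b assume "a < n - 1" "b < n - 1"
    then show "Q (\<lambda>x. mat_delete (M x) j i $$ (a, b))"
      by (auto simp: mat_delete_def dims intro!: entry)
  qed
  then show ?thesis using ij by (simp add: adj_mat_def dims cofactor_def)
qed

end

interpretation analytic_ring: function_ring analytic_at_0
  by unfold_locales (auto intro: analytic_at_0_const analytic_at_0_add analytic_at_0_mult)

interpretation cont_ring: function_ring "\<lambda>f :: real \<Rightarrow> real. isCont f 0"
  by unfold_locales (auto intro: continuous_intros)

text \<open>Degrees add up under products, so this is read off the Leibniz formula: each term
  multiplies \<open>n\<close> entries of degree at most 1.\<close>

lemma sep_poly_det:
  assumes M: "\<And>y. M y \<in> carrier_mat n n"
    and entry: "\<And>i j. i < n \<Longrightarrow> j < n \<Longrightarrow> sep_poly N 1 (\<lambda>y. M y $$ (i, j))"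
  shows "sep_poly N n (\<lambda>y. det (M y))"
  unfolding det_def'[OF M]
proof (intro sep_poly_sum sep_poly_cmult)
  fix p assume p: "p \<in> {p. p permutes {0..<n}}"
  have "sep_poly N (card {0..<n} * 1) (\<lambda>y. \<Prod>i = 0..<n. M y $$ (i, p i))"
    using p permutes_in_image by (intro sep_poly_prod entry) fastforce+
  then show "sep_poly N n (\<lambda>y. \<Prod>i = 0..<n. M y $$ (i, p i))" by simp
qed

lemma sep_poly_adj:
  assumes M: "\<And>y. M y \<in> carrier_mat n n"
    and entry: "\<And>i j. i < n \<Longrightarrow> j < n \<Longrightarrow> sep_poly N 1 (\<lambda>y. M y $$ (i, j))"
    and ij: "i < n" "j < n"
  shows "sep_poly N n (\<lambda>y. adj_mat (M y) $$ (i, j))"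
proof -
  have dims: "dim_row (M y) = n" "dim_col (M y) = n" for y using M by auto
  have "sep_poly N (n - 1) (\<lambda>y. (- 1) ^ (j + i) * det (mat_delete (M y) j i))"
  proof (intro sep_poly_cmult sep_poly_det)
    show "mat_delete (M y) j i \<in> carrier_mat (n - 1) (n - 1)" for y
      using mat_delete_carrier[OF M] .
    fix a b assume "a < n - 1" "b < n - 1"
    then show "sep_poly N 1 (\<lambda>y. mat_delete (M y) j i $$ (a, b))"
      by (auto simp: mat_delete_def dims intro!: entry[unfolded One_nat_def])
  qed
  then have "sep_poly N n (\<lambda>y. (- 1) ^ (j + i) * det (mat_delete (M y) j i))"
    by (rule sep_poly_mono) simp
  then show ?thesis using ij by (simp add: adj_mat_def dims cofactor_def)
qed

lemma pos_def_carrier: "pos_def n M \<Longrightarrow> M \<in> carrier_mat n n"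
  by (simp add: pos_def_def sym_mats_def)

lemma pos_def_smult:
  assumes "pos_def n M" "c > 0"
  shows "pos_def n (c \<cdot>\<^sub>m M)"
proof -
  have M: "M \<in> carrier_mat n n" "transpose_mat M = M" using assms by (auto simp: pos_def_def sym_mats_def)
  have "transpose_mat (c \<cdot>\<^sub>m M) = c \<cdot>\<^sub>m transpose_mat M" by (rule eq_matI) auto
  then have "transpose_mat (c \<cdot>\<^sub>m M) = c \<cdot>\<^sub>m M" by (simp only: M(2))
  moreover have "v \<bullet> ((c \<cdot>\<^sub>m M) *\<^sub>v v) = c * (v \<bullet> (M *\<^sub>v v))" if "v \<in> carrier_vec n" for v
    using M(1) that unfolding quadratic_form_entries[OF M(1) that]
    by (subst quadratic_form_entries[of _ n]) (auto simp: sum_distrib_left mult_ac intro!: sum.cong)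
  ultimately show ?thesis
    using assms M by (auto simp: pos_def_def sym_mats_def)
qed

lemma pos_def_one: "pos_def n (1\<^sub>m n)"
proof -
  have "v \<bullet> v > 0" if "v \<in> carrier_vec n" "v \<noteq> 0\<^sub>v n" for v :: "real vec"
  proof -
    have "\<exists>i<n. v $ i \<noteq> 0"
    proof (rule ccontr)
      assume "\<not> ?thesis"
      then have "v = 0\<^sub>v n" using that(1) by (intro eq_vecI) auto
      then show False using that(2) by simp
    qed
    then obtain i where i: "i < n" "v $ i \<noteq> 0" by blast
    have "0 < (v $ i)\<^sup>2" using i by simp
    also have "\<dots> \<le> (\<Sum>i<n. (v $ i)\<^sup>2)"
      using i by (intro member_le_sum[of i "{..<n}" "\<lambda>i. (v $ i)\<^sup>2"]) auto
    also have "\<dots> = v \<bullet> v" using that by (simp add: scalar_prod_def atLeast0LessThan power2_eq_square)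
    finally show ?thesis .
  qed
  then show ?thesis by (auto simp: pos_def_def sym_mats_def)
qed

lemma inverse_mat_exists:
  fixes J :: "real mat"
  assumes J: "J \<in> carrier_mat m m" and "det J \<noteq> 0"
  obtains W where "W \<in> carrier_mat m m" "W * J = 1\<^sub>m m" "J * W = 1\<^sub>m m"
proof -
  define W where "W = (1 / det J) \<cdot>\<^sub>m adj_mat J"
  have W: "W \<in> carrier_mat m m" using adj_mat(1)[OF J] by (simp add: W_def)
  have "J * W = (1 / det J) \<cdot>\<^sub>m (J * adj_mat J)"
    unfolding W_def by (rule mult_smult_distrib[OF J adj_mat(1)[OF J]])
  also have "\<dots> = 1\<^sub>m m" using adj_mat(2)[OF J] assms(2) by (auto intro!: eq_matI)
  finally have JW: "J * W = 1\<^sub>m m" .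
  then show ?thesis using that[OF W mat_mult_left_right_inverse[OF J W JW]] by simp
qed

section \<open>The central path\<close>

locale central_path =
  fixes m n :: nat and A :: "nat \<Rightarrow> real mat" and b :: "real vec" and C :: "real mat"
    and \<xi> :: "real \<Rightarrow> real mat \<times> real vec \<times> real mat"
  assumes m: "m \<ge> 1" and n: "n \<ge> 1"
    and A_sym: "i < m \<Longrightarrow> A i \<in> sym_mats n" and C_sym: "C \<in> sym_mats n"
    and indep: "lin_indep_family n m A"
    and path: "is_central_path n m A b C \<xi>"
begin

definition "X \<mu> = fst (\<xi> \<mu>)"
definition "y \<mu> = fst (snd (\<xi> \<mu>))"
definition "S \<mu> = snd (snd (\<xi> \<mu>))"

abbreviation "comb \<equiv> lin_comb n m A"

lemma path_point:
  assumes "\<mu> > 0"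
  shows "X \<mu> \<in> sym_mats n" "y \<mu> \<in> carrier_vec m" "S \<mu> \<in> sym_mats n"
    "i < m \<Longrightarrow> trace_inner (A i) (X \<mu>) = b $ i" "comb (y \<mu>) + S \<mu> = C"
    "pos_def n (X \<mu>)" "pos_def n (S \<mu>)" "X \<mu> * S \<mu> = \<mu> \<cdot>\<^sub>m 1\<^sub>m n"
proof -
  have "\<xi> \<mu> = (X \<mu>, y \<mu>, S \<mu>)" by (simp add: X_def y_def S_def)
  then have "strictly_feasible n m A b C (X \<mu>, y \<mu>, S \<mu>) \<and> X \<mu> * S \<mu> = \<mu> \<cdot>\<^sub>m 1\<^sub>m n"
    using path assms unfolding is_central_path_def by fastforce
  then show "X \<mu> \<in> sym_mats n" "y \<mu> \<in> carrier_vec m" "S \<mu> \<in> sym_mats n"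
    "i < m \<Longrightarrow> trace_inner (A i) (X \<mu>) = b $ i" "comb (y \<mu>) + S \<mu> = C"
    "pos_def n (X \<mu>)" "pos_def n (S \<mu>)" "X \<mu> * S \<mu> = \<mu> \<cdot>\<^sub>m 1\<^sub>m n"
    unfolding strictly_feasible_def by blast+
qed

lemma A_carrier: "i < m \<Longrightarrow> A i \<in> carrier_mat n n" and C_carrier: "C \<in> carrier_mat n n"
  using A_sym C_sym by (auto simp: sym_mats_def)

lemma X_carrier: "\<mu> > 0 \<Longrightarrow> X \<mu> \<in> carrier_mat n n" and S_carrier: "\<mu> > 0 \<Longrightarrow> S \<mu> \<in> carrier_mat n n"
  using path_point by (auto simp: sym_mats_def)

lemma comb_carrier [simp]: "comb v \<in> carrier_mat n n"
  by (simp add: lin_comb_def)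

lemma comb_dims [simp]: "dim_row (comb v) = n" "dim_col (comb v) = n"
  by (simp_all add: lin_comb_def)

lemma comb_transpose: "transpose_mat (comb v) = comb v"
proof (rule eq_matI)
  fix j k assume jk: "j < dim_row (comb v)" "k < dim_col (comb v)"
  have "A i $$ (j, k) = A i $$ (k, j)" if "i < m" for i
    using A_sym[OF that] jk by (auto simp: sym_mats_def lin_comb_def) (metis carrier_matD index_transpose_mat(1))
  then show "transpose_mat (comb v) $$ (j, k) = comb v $$ (j, k)"
    using jk by (auto simp: lin_comb_def intro!: sum.cong)
qed (simp_all add: lin_comb_def)

lemma trace_comb:
  assumes M: "M \<in> carrier_mat n n"
  shows "mat_trace (comb v * M) = (\<Sum>i<m. v $ i * mat_trace (A i * M))"
proof -
  have "mat_trace (comb v * M) = (\<Sum>j<n. \<Sum>k<n. \<Sum>i<m. v $ i * (A i $$ (j, k) * M $$ (k, j)))"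
    unfolding mat_trace_mult[OF comb_carrier M]
    by (intro sum.cong refl) (simp add: lin_comb_def sum_distrib_right mult.assoc)
  also have "\<dots> = (\<Sum>i<m. \<Sum>j<n. \<Sum>k<n. v $ i * (A i $$ (j, k) * M $$ (k, j)))"
    by (rule trans[OF sum.cong[OF refl sum.swap] sum.swap])
  also have "\<dots> = (\<Sum>i<m. v $ i * mat_trace (A i * M))"
    by (intro sum.cong refl) (simp add: mat_trace_mult[OF A_carrier M] sum_distrib_left)
  finally show ?thesis .
qed

section \<open>Boundedness and continuity along the path\<close>

lemma S_eq: "\<mu> > 0 \<Longrightarrow> S \<mu> = C - comb (y \<mu>)"
  using path_point(5)[of \<mu>] S_carrier[of \<mu>] by (intro eq_matI) auto

text \<open>Differences of the X-parts are orthogonal to every \<open>A i\<close>, differences of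
  the S-parts lie in their span; so tr (X \<mu> - X \<nu>)(S \<mu> - S \<nu>) = 0, and the diagonal
  terms are \<open>n * \<mu>\<close> and \<open>n * \<nu>\<close>.\<close>

lemma trace_X_S:
  fixes \<mu> \<nu> :: real
  assumes \<mu>: "\<mu> > 0" and \<nu>: "\<nu> > 0"
  shows "mat_trace (X \<mu> * S \<nu>) + mat_trace (X \<nu> * S \<mu>) = n * (\<mu> + \<nu>)"
proof -
  have *: "mat_trace (X \<mu> * S \<nu>) = mat_trace (C * X \<mu>) - (\<Sum>i<m. y \<nu> $ i * b $ i)"
    if \<mu>: "\<mu> > 0" and \<nu>: "\<nu> > 0" for \<mu> \<nu>
  proof -
    note c = X_carrier[OF \<mu>] C_carrier comb_carrier[of "y \<nu>"]
    have "mat_trace (X \<mu> * S \<nu>) = mat_trace (S \<nu> * X \<mu>)"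
      by (rule mat_trace_mult_commute[OF X_carrier[OF \<mu>] S_carrier[OF \<nu>]])
    also have "S \<nu> * X \<mu> = C * X \<mu> - comb (y \<nu>) * X \<mu>"
      unfolding S_eq[OF \<nu>] by (rule minus_mult_distrib_mat[OF c(2,3,1)])
    also have "mat_trace \<dots> = mat_trace (C * X \<mu>) - mat_trace (comb (y \<nu>) * X \<mu>)"
      by (rule mat_trace_minus) (use c in auto)
    also have "mat_trace (comb (y \<nu>) * X \<mu>) = (\<Sum>i<m. y \<nu> $ i * b $ i)"
      unfolding trace_comb[OF c(1)]
      by (intro sum.cong refl) (use path_point(4)[OF \<mu>] in \<open>simp add: trace_inner_def\<close>)
    finally show ?thesis .
  qed
  have diag: "mat_trace (X \<mu> * S \<mu>) = \<mu> * n" if "\<mu> > 0" for \<mu>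
    unfolding path_point(8)[OF that] by (simp add: mat_trace_smult[of _ n] mat_trace_one)
  show ?thesis
    using *[OF \<mu> \<nu>] *[OF \<nu> \<mu>] *[OF \<mu> \<mu>] *[OF \<nu> \<nu>] diag[OF \<mu>] diag[OF \<nu>]
    by (simp add: algebra_simps)
qed

text \<open>The inverse of \<open>S \<mu>\<close>.\<close>

definition "P \<mu> = (1 / \<mu>) \<cdot>\<^sub>m X \<mu>"

lemma P_facts:
  fixes \<mu> :: real
  assumes "\<mu> > 0"
  shows "P \<mu> \<in> carrier_mat n n" "pos_def n (P \<mu>)" "P \<mu> * S \<mu> = 1\<^sub>m n" "S \<mu> * P \<mu> = 1\<^sub>m n"
proof -
  show P: "P \<mu> \<in> carrier_mat n n" using X_carrier[OF assms] by (simp add: P_def)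
  show "pos_def n (P \<mu>)" unfolding P_def by (rule pos_def_smult) (use path_point assms in auto)
  have "P \<mu> * S \<mu> = (1 / \<mu>) \<cdot>\<^sub>m (X \<mu> * S \<mu>)"
    unfolding P_def by (rule mult_smult_assoc_mat[OF X_carrier S_carrier]) (use assms in auto)
  also have "\<dots> = 1\<^sub>m n" using path_point(8)[OF assms] assms by (auto intro!: eq_matI)
  finally show PS: "P \<mu> * S \<mu> = 1\<^sub>m n" .
  show "S \<mu> * P \<mu> = 1\<^sub>m n" by (rule mat_mult_left_right_inverse[OF P S_carrier[OF assms] PS])
qed

lemma P_one: "P 1 = X 1"
  by (auto simp: P_def intro!: eq_matI)

text \<open>The point at \<mu> = 1 serves as reference: in \<open>trace_X_S\<close> with \<nu> = 1
  both summands are nonnegative, so each is at most \<open>n * (\<mu> + 1)\<close>, and pairing with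
  a fixed positive definite matrix controls the trace.\<close>

lemma fixes \<mu> :: real
  assumes \<mu>: "\<mu> > 0"
  shows trace_X_le: "mat_trace (X \<mu>) \<le> n * (\<mu> + 1) * mat_trace (X 1)"
  and trace_S_le: "mat_trace (S \<mu>) \<le> n * (\<mu> + 1) * mat_trace (S 1)"
  and trace_X_nonneg: "mat_trace (X \<mu>) \<ge> 0"
  and trace_S_nonneg: "mat_trace (S \<mu>) \<ge> 0"
proof -
  have nonneg: "mat_trace M \<ge> 0" if M: "pos_def n M" for M
    using trace_pos_def_mult(1)[OF M pos_def_one, of "1\<^sub>m n"] pos_def_carrier[OF M] by simp
  have one: "(0::real) < 1" by simp
  show "mat_trace (X \<mu>) \<ge> 0" "mat_trace (S \<mu>) \<ge> 0" using nonneg path_point[OF \<mu>] by auto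
  have X1S1: "X 1 * S 1 = 1\<^sub>m n" "S 1 * X 1 = 1\<^sub>m n" using P_facts[OF one] by (simp_all add: P_one)
  have 0: "mat_trace (X \<mu> * S 1) + mat_trace (X 1 * S \<mu>) = n * (\<mu> + 1)"
    using trace_X_S[OF \<mu> one] by simp
  note XS = trace_pos_def_mult[OF path_point(6)[OF \<mu>] path_point(7)[OF one] X_carrier[OF one] X1S1(2)]
  note SX = trace_pos_def_mult[OF path_point(7)[OF \<mu>] path_point(6)[OF one] S_carrier[OF one] X1S1(1)]
  have comm: "mat_trace (S \<mu> * X 1) = mat_trace (X 1 * S \<mu>)"
    by (rule mat_trace_mult_commute[OF S_carrier[OF \<mu>] X_carrier[OF one]])
  have "mat_trace (X \<mu> * S 1) \<le> n * (\<mu> + 1)" "mat_trace (S \<mu> * X 1) \<le> n * (\<mu> + 1)"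
    using 0 XS(1) SX(1) comm by auto
  then show "mat_trace (X \<mu>) \<le> n * (\<mu> + 1) * mat_trace (X 1)"
    "mat_trace (S \<mu>) \<le> n * (\<mu> + 1) * mat_trace (S 1)"
    using XS(2) SX(2) nonneg[OF path_point(6)[OF one]] nonneg[OF path_point(7)[OF one]]
    by (auto intro: order_trans mult_right_mono)
qed

text \<open>A quantitative form of continuity, since the bound tends to 0 as \<mu> tends to \<nu>.
  The weighted norm tr (P \<mu> V P \<nu> V) of \<open>V = S \<mu> - S \<nu>\<close> equals tr
  \<open>a\<close> + tr \<open>c\<close> - 2n because \<open>a * c = 1\<close>, and
  \<open>trace_X_S\<close> makes \<mu> - \<nu> a factor of it.\<close>

lemma frobenius_sq_S_diff_le:
  fixes \<mu> \<nu> :: real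
  assumes \<mu>: "\<mu> > 0" and \<nu>: "\<nu> > 0"
  shows "frobenius_sq (S \<mu> - S \<nu>) \<le> (n * (\<mu> + 1) * mat_trace (S 1)) * (n * (\<nu> + 1) * mat_trace (S 1)) *
    (\<bar>\<mu> - \<nu>\<bar> / \<mu> * (n * (\<mu> + \<nu>) / \<nu> + n))"
proof -
  define V where "V = S \<mu> - S \<nu>"
  define a where "a = P \<mu> * S \<nu>"
  define c where "c = P \<nu> * S \<mu>"
  define q where "q = mat_trace (X \<nu> * S \<mu>)"
  note car = P_facts(1)[OF \<mu>] P_facts(1)[OF \<nu>] S_carrier[OF \<mu>] S_carrier[OF \<nu>] X_carrier[OF \<mu>] X_carrier[OF \<nu>]
  have V: "V \<in> carrier_mat n n" "a \<in> carrier_mat n n" "c \<in> carrier_mat n n"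
    using car by (auto simp: V_def a_def c_def)
  have Vt: "transpose_mat V = V"
    using path_point(3)[OF \<mu>] path_point(3)[OF \<nu>] transpose_minus[of "S \<mu>" n n "S \<nu>"]
    by (auto simp: V_def sym_mats_def)
  have PV: "P \<mu> * V = 1\<^sub>m n - a" "P \<nu> * V = c - 1\<^sub>m n"
    unfolding V_def a_def c_def using car P_facts[OF \<mu>] P_facts[OF \<nu>]
    by (simp_all add: mult_minus_distrib_mat[of _ n n _ n])
  have "a * c = P \<mu> * (S \<nu> * P \<nu>) * S \<mu>"
    using car by (simp add: a_def c_def assoc_mult_mat[of _ n n _ n _ n])
  also have "\<dots> = 1\<^sub>m n" using car P_facts[OF \<mu>] P_facts[OF \<nu>] by simp
  finally have ac: "a * c = 1\<^sub>m n" .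
  have "P \<mu> * V * P \<nu> * V = (P \<mu> * V) * (P \<nu> * V)"
    using car V by (simp add: assoc_mult_mat[of _ n n _ n _ n])
  also have "\<dots> = (1\<^sub>m n - a) * c - (1\<^sub>m n - a) * 1\<^sub>m n"
    unfolding PV by (rule mult_minus_distrib_mat[of _ n n _ n]) (use V in auto)
  also have "(1\<^sub>m n - a) * c = c - 1\<^sub>m n"
    using minus_mult_distrib_mat[of "1\<^sub>m n" n n a c n] V ac by simp
  also have "(1\<^sub>m n - a) * 1\<^sub>m n = 1\<^sub>m n - a" using V by simp
  finally have "mat_trace (P \<mu> * V * P \<nu> * V) = mat_trace c - n - (n - mat_trace a)"
    using mat_trace_minus[OF minus_carrier_mat[OF one_carrier_mat] minus_carrier_mat[OF V(2)], of c "1\<^sub>m n"]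
      mat_trace_minus[of c n "1\<^sub>m n"]
      mat_trace_minus[of "1\<^sub>m n" n a] V by (simp add: mat_trace_one)
  moreover have "mat_trace a = mat_trace (X \<mu> * S \<nu>) / \<mu>"
    unfolding a_def P_def using mult_smult_assoc_mat[OF X_carrier[OF \<mu>] S_carrier[OF \<nu>], of "1 / \<mu>"] car
    by (simp add: mat_trace_smult[of _ n])
  moreover have "mat_trace c = q / \<nu>"
    unfolding c_def P_def q_def using mult_smult_assoc_mat[OF X_carrier[OF \<nu>] S_carrier[OF \<mu>], of "1 / \<nu>"] car
    by (simp add: mat_trace_smult[of _ n])
  moreover have p: "mat_trace (X \<mu> * S \<nu>) = n * (\<mu> + \<nu>) - q"
    using trace_X_S[OF \<mu> \<nu>] by (simp add: q_def)
  ultimately have tr: "mat_trace (P \<mu> * V * P \<nu> * V) = (\<mu> - \<nu>) / \<mu> * (q / \<nu> - n)"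
    using \<mu> \<nu> by (simp add: field_simps)
  have "mat_trace (X \<mu> * S \<nu>) \<ge> 0" "q \<ge> 0" unfolding q_def
    by (rule trace_pos_def_mult(1)[OF path_point(6)[OF \<mu>] path_point(7)[OF \<nu>] P_facts(1,4)[OF \<nu>]],
        rule trace_pos_def_mult(1)[OF path_point(6)[OF \<nu>] path_point(7)[OF \<mu>] P_facts(1,4)[OF \<mu>]])
  then have q: "0 \<le> q" "q \<le> n * (\<mu> + \<nu>)" using p by auto
  then have "q / \<nu> \<le> n * (\<mu> + \<nu>) / \<nu>" "0 \<le> q / \<nu>" using \<nu> by (simp_all add: divide_right_mono)
  then have bd: "\<bar>q / \<nu> - n\<bar> \<le> n * (\<mu> + \<nu>) / \<nu> + n" by linarith
  define r where "r = \<bar>\<mu> - \<nu>\<bar> / \<mu> * (n * (\<mu> + \<nu>) / \<nu> + n)"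
  define k where "k = (n * (\<mu> + 1) * mat_trace (S 1)) * (n * (\<nu> + 1) * mat_trace (S 1))"
  have "mat_trace (P \<mu> * V * P \<nu> * V) \<le> \<bar>(\<mu> - \<nu>) / \<mu> * (q / \<nu> - n)\<bar>"
    unfolding tr by (rule abs_ge_self)
  also have "\<dots> = \<bar>\<mu> - \<nu>\<bar> / \<mu> * \<bar>q / \<nu> - n\<bar>" using \<mu> by (simp add: abs_mult)
  also have "\<dots> \<le> r" unfolding r_def by (rule mult_left_mono[OF bd]) (use \<mu> in simp)
  finally have tr_le: "mat_trace (P \<mu> * V * P \<nu> * V) \<le> r" .
  have r0: "0 \<le> r" unfolding r_def using \<mu> \<nu> by simp
  have ab: "mat_trace (S \<mu>) * mat_trace (S \<nu>) \<le> k"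
    unfolding k_def using \<mu> \<nu> trace_S_nonneg[of 1] trace_S_nonneg[OF \<nu>]
    by (intro mult_mono trace_S_le) auto
  have "frobenius_sq V \<le> mat_trace (S \<mu>) * mat_trace (S \<nu>) * mat_trace (P \<mu> * V * P \<nu> * V)"
    by (rule frobenius_sq_le_trace[OF P_facts(2)[OF \<mu>] S_carrier[OF \<mu>] P_facts(3)[OF \<mu>]
          P_facts(2)[OF \<nu>] S_carrier[OF \<nu>] P_facts(3)[OF \<nu>] V(1) Vt])
  also have "\<dots> \<le> mat_trace (S \<mu>) * mat_trace (S \<nu>) * r"
    by (rule mult_left_mono[OF tr_le]) (use trace_S_nonneg \<mu> \<nu> in simp)
  also have "\<dots> \<le> k * r" by (rule mult_right_mono[OF ab r0])
  finally show ?thesis by (simp only: V_def k_def r_def)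
qed

lemma S_entry_continuous:
  assumes ij: "i < n" "j < n"
  shows "continuous_on {0<..<1} (\<lambda>\<mu>. S \<mu> $$ (i, j))"
proof -
  have "isCont (\<lambda>\<mu>. S \<mu> $$ (i, j)) \<nu>" if \<nu>: "\<nu> > 0" for \<nu> :: real
  proof -
    define B where "B \<mu> = (n * (\<mu> + 1) * mat_trace (S 1)) * (n * (\<nu> + 1) * mat_trace (S 1)) *
      (\<bar>\<mu> - \<nu>\<bar> / \<mu> * (n * (\<mu> + \<nu>) / \<nu> + n))" for \<mu> :: real
    have "isCont (\<lambda>\<mu>. sqrt (B \<mu>)) \<nu>" unfolding B_def using \<nu> by (intro continuous_intros) auto
    then have "((\<lambda>\<mu>. sqrt (B \<mu>)) \<longlongrightarrow> sqrt (B \<nu>)) (at \<nu>)" by (simp add: isCont_def)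
    then have lim: "((\<lambda>\<mu>. sqrt (B \<mu>)) \<longlongrightarrow> 0) (at \<nu>)" by (simp add: B_def)
    have "\<forall>\<^sub>F \<mu> in at \<nu>. \<mu> > 0"
      using order_tendstoD(1)[OF tendsto_ident_at \<nu>] .
    then have "\<forall>\<^sub>F \<mu> in at \<nu>. norm (S \<mu> $$ (i, j) - S \<nu> $$ (i, j)) \<le> sqrt (B \<mu>)"
    proof eventually_elim
      case (elim \<mu>)
      have "(S \<mu> $$ (i, j) - S \<nu> $$ (i, j))\<^sup>2 = ((S \<mu> - S \<nu>) $$ (i, j))\<^sup>2"
        using S_carrier[OF \<nu>] ij by simp
      also have "\<dots> \<le> frobenius_sq (S \<mu> - S \<nu>)"
        using S_carrier[OF \<nu>] S_carrier[OF elim] ij by (intro entry_square_le_frobenius_sq) auto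
      also have "\<dots> \<le> B \<mu>" unfolding B_def by (rule frobenius_sq_S_diff_le[OF elim \<nu>])
      finally show ?case using real_sqrt_le_mono by fastforce
    qed
    then have "((\<lambda>\<mu>. S \<mu> $$ (i, j) - S \<nu> $$ (i, j)) \<longlongrightarrow> 0) (at \<nu>)"
      by (rule Lim_null_comparison[OF _ lim])
    then show ?thesis unfolding isCont_def by (simp add: LIM_zero_iff)
  qed
  then show ?thesis by (intro continuous_at_imp_continuous_on) auto
qed

text \<open>The Gram matrix of the \<open>A i\<close> for the inner product \<open>tr (V Q W Q)\<close>.\<close>

definition gram :: "real mat \<Rightarrow> real mat" where
  "gram Q = mat m m (\<lambda>(i, k). mat_trace (A k * (Q * A i * Q)))"

lemma gram_apply:
  assumes Q: "Q \<in> carrier_mat n n" and v: "v \<in> carrier_vec m" and i: "i < m"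
  shows "(gram Q *\<^sub>v v) $ i = mat_trace (A i * (Q * comb v * Q))"
proof -
  define V where "V = comb v"
  have V: "V \<in> carrier_mat n n" by (simp add: V_def)
  note c = Q V A_carrier[OF i]
  have "(gram Q *\<^sub>v v) $ i = (\<Sum>k<m. v $ k * mat_trace (A k * (Q * A i * Q)))"
    using v i by (simp add: gram_def scalar_prod_def atLeast0LessThan mult.commute)
  also have "\<dots> = mat_trace (comb v * (Q * A i * Q))"
    by (rule trace_comb[symmetric]) (use c in auto)
  also have "comb v * (Q * A i * Q) = (V * Q) * (A i * Q)"
    using c by (simp add: assoc_mult_mat[of _ n n _ n _ n] flip: V_def)
  also have "mat_trace \<dots> = mat_trace ((A i * Q) * (V * Q))"
    by (rule mat_trace_mult_commute[of _ n]) (use c in auto)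
  also have "(A i * Q) * (V * Q) = A i * (Q * V * Q)"
    using c by (simp add: assoc_mult_mat[of _ n n _ n _ n])
  finally show ?thesis by (simp add: V_def)
qed

text \<open>A kernel vector gives a combination \<open>V\<close> of the \<open>A i\<close> with tr
  (Q V Q V) = 0, hence \<open>V = 0\<close> by \<open>frobenius_sq_le_trace\<close>, against linear
  independence.\<close>

lemma gram_inverse:
  assumes Q: "pos_def n Q" and T: "T \<in> carrier_mat n n" "Q * T = 1\<^sub>m n"
  obtains W where "W \<in> carrier_mat m m" "W * gram Q = 1\<^sub>m m" "gram Q * W = 1\<^sub>m m"
proof -
  have Qc: "Q \<in> carrier_mat n n" by (rule pos_def_carrier[OF Q])
  have G: "gram Q \<in> carrier_mat m m" by (simp add: gram_def)
  have "det (gram Q) \<noteq> 0"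
  proof
    assume "det (gram Q) = 0"
    then obtain v where v: "v \<in> carrier_vec m" "v \<noteq> 0\<^sub>v m" "gram Q *\<^sub>v v = 0\<^sub>v m"
      unfolding det_0_iff_vec_prod_zero_field[OF G] by blast
    define V where "V = comb v"
    have V: "V \<in> carrier_mat n n" by (simp add: V_def)
    have "mat_trace (V * (Q * V * Q)) = (\<Sum>i<m. v $ i * mat_trace (A i * (Q * V * Q)))"
      unfolding V_def by (rule trace_comb) (use Qc in auto)
    also have "\<dots> = 0"
      using gram_apply[OF Qc v(1)] v(3) by (intro sum.neutral) (simp add: V_def)
    finally have "mat_trace (V * (Q * V * Q)) = 0" .
    moreover have "mat_trace (V * (Q * V * Q)) = mat_trace (Q * V * Q * V)"
      by (rule mat_trace_mult_commute[of _ n]) (use V Qc in auto)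
    ultimately have "frobenius_sq V \<le> 0"
      using frobenius_sq_le_trace[OF Q T Q T V] comb_transpose[of v] by (simp add: V_def)
    have "V = 0\<^sub>m n n"
    proof (rule eq_matI)
      fix i j assume ij: "i < dim_row (0\<^sub>m n n)" "j < dim_col (0\<^sub>m n n)"
      have "(V $$ (i, j))\<^sup>2 \<le> 0"
        by (rule order_trans[OF entry_square_le_frobenius_sq[OF V] \<open>frobenius_sq V \<le> 0\<close>]) (use ij in auto)
      then show "V $$ (i, j) = 0\<^sub>m n n $$ (i, j)" using ij by simp
    qed (use V in auto)
    then show False using indep v unfolding lin_indep_family_def V_def by blast
  qed
  then show ?thesis using inverse_mat_exists[OF G] that by blast
qed

text \<open>Inverting the ordinary Gram matrix (\<open>Q = 1\<close>) solves
  \<open>comb y = C - S\<close> for \<open>y\<close>; continuity and boundedness pass from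
  \<open>S\<close> to \<open>y\<close> with coefficients independent of \<mu>.\<close>

lemma y_linear_in_S:
  obtains W :: "real mat"
  where "\<And>\<mu> i. \<mu> > 0 \<Longrightarrow> i < m \<Longrightarrow>
    y \<mu> $ i = (\<Sum>k<m. W $$ (i, k) * (\<Sum>p<n. \<Sum>q<n. A k $$ (p, q) * (C $$ (q, p) - S \<mu> $$ (q, p))))"
proof -
  obtain W where W: "W \<in> carrier_mat m m" "W * gram (1\<^sub>m n) = 1\<^sub>m m"
    using gram_inverse[OF pos_def_one one_carrier_mat] by auto
  have G: "gram (1\<^sub>m n) \<in> carrier_mat m m" by (simp add: gram_def)
  have "y \<mu> $ i = (\<Sum>k<m. W $$ (i, k) * (\<Sum>p<n. \<Sum>q<n. A k $$ (p, q) * (C $$ (q, p) - S \<mu> $$ (q, p))))"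
    if \<mu>: "\<mu> > 0" and i: "i < m" for \<mu> i
  proof -
    have yc: "y \<mu> \<in> carrier_vec m" by (rule path_point(2)[OF \<mu>])
    have "comb (y \<mu>) = C - S \<mu>"
      using S_eq[OF \<mu>] C_carrier comb_carrier[of "y \<mu>"] by (intro eq_matI) auto
    then have Gy: "(gram (1\<^sub>m n) *\<^sub>v y \<mu>) $ k =
        (\<Sum>p<n. \<Sum>q<n. A k $$ (p, q) * (C $$ (q, p) - S \<mu> $$ (q, p)))" if "k < m" for k
    proof -
      have CS: "C - S \<mu> \<in> carrier_mat n n" using C_carrier S_carrier[OF \<mu>] by auto
      then have "(gram (1\<^sub>m n) *\<^sub>v y \<mu>) $ k = mat_trace (A k * (C - S \<mu>))"
        using gram_apply[OF one_carrier_mat yc that] \<open>comb (y \<mu>) = C - S \<mu>\<close>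
        by (simp add: left_mult_one_mat[OF CS] right_mult_one_mat[OF CS])
      then show ?thesis
        using S_carrier[OF \<mu>] by (simp add: mat_trace_mult[OF A_carrier[OF that] CS])
    qed
    have "y \<mu> = W *\<^sub>v (gram (1\<^sub>m n) *\<^sub>v y \<mu>)"
      using assoc_mult_mat_vec[OF W(1) G yc] W(2) yc by simp
    then have "y \<mu> $ i = (W *\<^sub>v (gram (1\<^sub>m n) *\<^sub>v y \<mu>)) $ i" by (rule arg_cong)
    also have "\<dots> = (\<Sum>k<m. W $$ (i, k) * (gram (1\<^sub>m n) *\<^sub>v y \<mu>) $ k)"
      using W(1) G i by (simp add: scalar_prod_def atLeast0LessThan)
    finally show ?thesis using Gy by simp
  qed
  then show ?thesis using that by blast
qed

lemma y_continuous:
  assumes "i < m"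
  shows "continuous_on {0<..<1} (\<lambda>\<mu>. y \<mu> $ i)"
proof -
  obtain W where W: "\<And>\<mu> i. \<mu> > 0 \<Longrightarrow> i < m \<Longrightarrow>
    y \<mu> $ i = (\<Sum>k<m. W $$ (i, k) * (\<Sum>p<n. \<Sum>q<n. A k $$ (p, q) * (C $$ (q, p) - S \<mu> $$ (q, p))))"
    using y_linear_in_S by blast
  have "continuous_on {0<..<1} (\<lambda>\<mu>. \<Sum>k<m. W $$ (i, k) *
      (\<Sum>p<n. \<Sum>q<n. A k $$ (p, q) * (C $$ (q, p) - S \<mu> $$ (q, p))))"
    by (intro continuous_intros S_entry_continuous) auto
  then show ?thesis by (rule continuous_on_eq) (use W assms in simp)
qed

lemma S_entry_bounded:
  fixes \<mu> :: real
  assumes "0 < \<mu>" "\<mu> < 1" "i < n" "j < n"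
  shows "\<bar>S \<mu> $$ (i, j)\<bar> \<le> 2 * n * mat_trace (S 1)"
proof -
  have "\<bar>S \<mu> $$ (i, j)\<bar> \<le> mat_trace (S \<mu>)"
    using assms path_point by (intro pos_def_entry_le_trace) auto
  also have "\<dots> \<le> n * (\<mu> + 1) * mat_trace (S 1)" by (rule trace_S_le[OF assms(1)])
  also have "\<dots> \<le> n * 2 * mat_trace (S 1)"
    using assms trace_S_nonneg[of 1] by (intro mult_right_mono mult_left_mono) auto
  finally show ?thesis by simp
qed

lemma X_entry_bounded:
  fixes \<mu> :: real
  assumes "0 < \<mu>" "\<mu> < 1" "i < n" "j < n"
  shows "\<bar>X \<mu> $$ (i, j)\<bar> \<le> 2 * n * mat_trace (X 1)"
proof -
  have "\<bar>X \<mu> $$ (i, j)\<bar> \<le> mat_trace (X \<mu>)"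
    using assms path_point by (intro pos_def_entry_le_trace) auto
  also have "\<dots> \<le> n * (\<mu> + 1) * mat_trace (X 1)" by (rule trace_X_le[OF assms(1)])
  also have "\<dots> \<le> n * 2 * mat_trace (X 1)"
    using assms trace_X_nonneg[of 1] by (intro mult_right_mono mult_left_mono) auto
  finally show ?thesis by simp
qed

lemma y_bounded:
  obtains K where "\<And>\<mu> i. 0 < \<mu> \<Longrightarrow> \<mu> < 1 \<Longrightarrow> i < m \<Longrightarrow> \<bar>y \<mu> $ i\<bar> \<le> K"
proof -
  obtain W where W: "\<And>\<mu> i. \<mu> > 0 \<Longrightarrow> i < m \<Longrightarrow>
    y \<mu> $ i = (\<Sum>k<m. W $$ (i, k) * (\<Sum>p<n. \<Sum>q<n. A k $$ (p, q) * (C $$ (q, p) - S \<mu> $$ (q, p))))"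
    using y_linear_in_S by blast
  define B where "B i = (\<Sum>k<m. \<bar>W $$ (i, k)\<bar> * (\<Sum>p<n. \<Sum>q<n. \<bar>A k $$ (p, q)\<bar> *
    (\<bar>C $$ (q, p)\<bar> + 2 * n * mat_trace (S 1))))" for i
  have B0: "B i \<ge> 0" for i
    unfolding B_def using trace_S_nonneg[of 1] by (intro sum_nonneg mult_nonneg_nonneg add_nonneg_nonneg) auto
  have bd: "\<bar>y \<mu> $ i\<bar> \<le> B i" if "0 < \<mu>" "\<mu> < 1" "i < m" for \<mu> i
    unfolding W[OF that(1,3)] B_def
    by (intro order_trans[OF sum_abs] sum_mono)
       (use S_entry_bounded[OF that(1,2)] in \<open>auto simp: abs_mult intro!: mult_left_mono
          order_trans[OF sum_abs] sum_mono order_trans[OF abs_triangle_ineq4]\<close>)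
  have "B i \<le> (\<Sum>i<m. B i)" if "i < m" for i
    using B0 that by (intro member_le_sum[of i "{..<m}" B]) auto
  then show ?thesis using that[of "\<Sum>i<m. B i"] bd by (meson order_trans)
qed

text \<open>Parameter points are functions \<open>\<eta>\<close> whose first \<open>m\<close> values are the dual variables and whose
  value at \<open>m\<close> is \<open>1 / \<mu>\<close>; \<open>slack\<close> is the dual slack and \<open>residual i\<close> vanishes on the path, where
  \<open>tr (A i * S\<^sup>-\<^sup>1) = b $ i / \<mu>\<close>.\<close>

definition slack :: "(nat \<Rightarrow> real) \<Rightarrow> real mat" where
  "slack \<eta> = mat n n (\<lambda>(j, k). C $$ (j, k) - (\<Sum>i<m. \<eta> i * A i $$ (j, k)))"

definition residual :: "nat \<Rightarrow> (nat \<Rightarrow> real) \<Rightarrow> real" where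
  "residual i \<eta> = mat_trace (A i * adj_mat (slack \<eta>)) - b $ i * (\<eta> m * det (slack \<eta>))"

lemma slack_carrier [simp]: "slack \<eta> \<in> carrier_mat n n"
  by (simp add: slack_def)

lemma sep_poly_slack:
  assumes "j < n" "k < n"
  shows "sep_poly N 1 (\<lambda>\<eta>. slack \<eta> $$ (j, k))"
proof -
  have "sep_poly N 1 (\<lambda>\<eta>. C $$ (j, k) - (\<Sum>i<m. A i $$ (j, k) * \<eta> i))"
    by (intro sep_poly_diff sep_poly_const sep_poly_sum sep_poly_cmult sep_poly_var)
  then show ?thesis using assms by (simp add: slack_def mult.commute)
qed

text \<open>The factor \<open>\<eta> m\<close> adds 1 to the degree \<open>n\<close> of the
  determinant; this is the \<open>n + 1\<close> in the final bound.\<close>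

lemma sep_poly_residual:
  assumes i: "i < m"
  shows "sep_poly N (n + 1) (residual i)"
proof -
  have adj: "adj_mat (slack \<eta>) \<in> carrier_mat n n" for \<eta> using adj_mat(1)[OF slack_carrier] .
  have eq: "residual i = (\<lambda>\<eta>. (\<Sum>j<n. \<Sum>k<n. A i $$ (j, k) * adj_mat (slack \<eta>) $$ (k, j)) -
      b $ i * (\<eta> m * det (slack \<eta>)))"
    by (simp add: residual_def mat_trace_mult[OF A_carrier[OF i] adj] fun_eq_iff)
  have "sep_poly N (1 + n) (\<lambda>\<eta>. \<eta> m * det (slack \<eta>))"
    by (intro sep_poly_mult sep_poly_var sep_poly_det slack_carrier sep_poly_slack)
  then have 1: "sep_poly N (n + 1) (\<lambda>\<eta>. b $ i * (\<eta> m * det (slack \<eta>)))"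
    by (intro sep_poly_cmult) (simp add: add.commute)
  have "sep_poly N (n + 1) (\<lambda>\<eta>. \<Sum>j<n. \<Sum>k<n. A i $$ (j, k) * adj_mat (slack \<eta>) $$ (k, j))"
    by (intro sep_poly_sum sep_poly_cmult sep_poly_mono[OF sep_poly_adj])
       (auto intro: sep_poly_slack[unfolded One_nat_def])
  then show ?thesis unfolding eq by (rule sep_poly_diff[OF _ 1])
qed

lemma det_S_nonzero:
  assumes "\<mu> > 0"
  shows "det (S \<mu>) \<noteq> 0"
proof -
  have "det (S \<mu>) * det (P \<mu>) = 1"
    using det_mult[OF S_carrier[OF assms] P_facts(1)[OF assms]] P_facts(4)[OF assms] by simp
  then show ?thesis by auto
qed

text \<open>Multiply \<open>1 = S P = M P + s V P\<close> by \<open>adj_mat M\<close>. This splits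
  off the multiple of \<open>s\<close> exactly and holds for every \<open>s\<close>, also where
  \<open>M\<close> is singular.\<close>

lemma adj_perturbed:
  fixes \<mu> s :: real
  assumes \<mu>: "\<mu> > 0" and V: "V \<in> carrier_mat n n"
  defines "M \<equiv> S \<mu> - s \<cdot>\<^sub>m V"
  shows "adj_mat M = det M \<cdot>\<^sub>m P \<mu> + s \<cdot>\<^sub>m (adj_mat M * (V * P \<mu>))"
proof -
  note c = S_carrier[OF \<mu>] P_facts(1)[OF \<mu>]
  have M: "M \<in> carrier_mat n n" unfolding M_def by (intro minus_carrier_mat smult_carrier_mat V)
  note adj = adj_mat[OF M]
  have VP: "V * P \<mu> \<in> carrier_mat n n" using V c by simp
  have sV: "s \<cdot>\<^sub>m V \<in> carrier_mat n n" using V by simp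
  have S: "S \<mu> = M + s \<cdot>\<^sub>m V" using c V by (auto simp: M_def intro!: eq_matI)
  have "S \<mu> * P \<mu> = M * P \<mu> + (s \<cdot>\<^sub>m V) * P \<mu>"
    unfolding S by (rule add_mult_distrib_mat[OF M sV c(2)])
  then have SP: "1\<^sub>m n = M * P \<mu> + s \<cdot>\<^sub>m (V * P \<mu>)"
    by (simp only: P_facts(4)[OF \<mu>] mult_smult_assoc_mat[OF V c(2)])
  have "adj_mat M * (M * P \<mu>) = (adj_mat M * M) * P \<mu>"
    by (rule assoc_mult_mat[OF adj(1) M c(2), symmetric])
  then have detP: "adj_mat M * (M * P \<mu>) = det M \<cdot>\<^sub>m P \<mu>"
    by (simp only: adj(3) mult_smult_assoc_mat[OF one_carrier_mat c(2)] left_mult_one_mat[OF c(2)])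
  have "adj_mat M = adj_mat M * (M * P \<mu> + s \<cdot>\<^sub>m (V * P \<mu>))"
    unfolding SP[symmetric] by (rule right_mult_one_mat[OF adj(1), symmetric])
  also have "\<dots> = adj_mat M * (M * P \<mu>) + adj_mat M * (s \<cdot>\<^sub>m (V * P \<mu>))"
    by (rule mult_add_distrib_mat[OF adj(1) mult_carrier_mat[OF M c(2)] smult_carrier_mat[OF VP]])
  also have "\<dots> = det M \<cdot>\<^sub>m P \<mu> + s \<cdot>\<^sub>m (adj_mat M * (V * P \<mu>))"
    by (simp only: detP mult_smult_distrib[OF adj(1) VP])
  finally show ?thesis .
qed

lemma adj_S:
  assumes "\<mu> > 0"
  shows "adj_mat (S \<mu>) = det (S \<mu>) \<cdot>\<^sub>m P \<mu>"
proof -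
  have "S \<mu> - 0 \<cdot>\<^sub>m (0\<^sub>m n n) = S \<mu>" using S_carrier[OF assms] by (intro eq_matI) auto
  moreover have "det (S \<mu>) \<cdot>\<^sub>m P \<mu> + 0 \<cdot>\<^sub>m (adj_mat (S \<mu>) * (0\<^sub>m n n * P \<mu>)) = det (S \<mu>) \<cdot>\<^sub>m P \<mu>"
    using P_facts(1)[OF assms] adj_mat(1)[OF S_carrier[OF assms]] by (intro eq_matI) auto
  ultimately show ?thesis using adj_perturbed[OF assms zero_carrier_mat, of 0] by simp
qed

text \<open>Along the line through a path point in direction \<open>v\<close> the residuals are \<open>s\<close> times continuous
  functions whose values at \<open>s = 0\<close> are \<open>det S\<close> times the image of \<open>v\<close> under the invertible matrix
  \<open>gram\<close>, hence arbitrary.\<close>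

lemma residual_line:
  fixes \<mu> :: real and a :: "nat \<Rightarrow> real"
  assumes \<mu>: "\<mu> > 0"
  shows "\<exists>v h. \<forall>i<m.
    (\<forall>s. residual i (\<lambda>j. if j < m then y \<mu> $ j + s * v $ j else if j = m then 1 / \<mu> else 0)
       = s * h i s) \<and> isCont (h i) 0 \<and> h i 0 = a i"
proof -
  define \<delta> where "\<delta> = det (S \<mu>)"
  have \<delta>: "\<delta> \<noteq> 0" using det_S_nonzero[OF \<mu>] by (simp add: \<delta>_def)
  note c = S_carrier[OF \<mu>] P_facts[OF \<mu>]
  obtain W where W: "W \<in> carrier_mat m m" "gram (P \<mu>) * W = 1\<^sub>m m"
    using gram_inverse[OF c(3) c(1,4)] by blast
  have G: "gram (P \<mu>) \<in> carrier_mat m m" by (simp add: gram_def)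
  \<comment> \<open>The limit of the residual over \<open>s\<close> is \<delta> times
    \<open>gram (P \<mu>) *\<^sub>v v\<close>, so the target speeds are divided by \<delta>
    first.\<close>
  define av where "av = vec m (\<lambda>i. a i / \<delta>)"
  define v where "v = W *\<^sub>v av"
  have av: "av \<in> carrier_vec m" by (simp add: av_def)
  have v: "v \<in> carrier_vec m" using W av by (simp add: v_def)
  have Gv: "gram (P \<mu>) *\<^sub>v v = av"
    using assoc_mult_mat_vec[OF G W(1) av] W(2) av by (simp add: v_def)
  define V where "V = comb v"
  have V: "V \<in> carrier_mat n n" by (simp add: V_def)
  define VP where "VP = V * P \<mu>"
  have VP: "VP \<in> carrier_mat n n" using V c by (simp add: VP_def)
  define M where "M s = S \<mu> - s \<cdot>\<^sub>m V" for s
  have M: "M s \<in> carrier_mat n n" for s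
    unfolding M_def by (intro minus_carrier_mat smult_carrier_mat V)
  define \<eta> where "\<eta> s = (\<lambda>j. if j < m then y \<mu> $ j + s * v $ j else if j = m then 1 / \<mu> else 0)" for s
  have slack: "slack (\<eta> s) = M s" for s
    using c V C_carrier
    by (intro eq_matI)
       (auto simp: slack_def M_def S_eq[OF \<mu>] V_def lin_comb_def \<eta>_def sum.distrib
         sum_distrib_left algebra_simps)
  define h where "h i s = mat_trace (A i * (adj_mat (M s) * VP))" for i s
  have line: "residual i (\<eta> s) = s * h i s" if i: "i < m" for i s
  proof -
    note adj = adj_mat(1)[OF M[of s]]
    \<comment> \<open>This makes the part \<open>det M\<close> times \<open>P \<mu>\<close> of the
      adjugate cancel against the second term of the residual, leaving only the multiple of
      \<open>s\<close>.\<close>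
    have tAP: "mat_trace (A i * P \<mu>) = b $ i / \<mu>"
    proof -
      have "A i * P \<mu> = (1 / \<mu>) \<cdot>\<^sub>m (A i * X \<mu>)"
        unfolding P_def by (rule mult_smult_distrib[OF A_carrier[OF i] X_carrier[OF \<mu>]])
      moreover have "A i * X \<mu> \<in> carrier_mat n n" using A_carrier[OF i] X_carrier[OF \<mu>] by simp
      ultimately show ?thesis
        using path_point(4)[OF \<mu> i] by (simp add: mat_trace_smult trace_inner_def)
    qed
    have AP: "A i * P \<mu> \<in> carrier_mat n n" and AaV: "A i * (adj_mat (M s) * VP) \<in> carrier_mat n n"
      and aV: "adj_mat (M s) * VP \<in> carrier_mat n n"
      using A_carrier[OF i] c adj VP by auto
    have "A i * adj_mat (M s) = A i * (det (M s) \<cdot>\<^sub>m P \<mu> + s \<cdot>\<^sub>m (adj_mat (M s) * VP))"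
      using adj_perturbed[OF \<mu> V, of s] by (simp add: M_def VP_def)
    also have "\<dots> = A i * (det (M s) \<cdot>\<^sub>m P \<mu>) + A i * (s \<cdot>\<^sub>m (adj_mat (M s) * VP))"
      by (rule mult_add_distrib_mat[OF A_carrier[OF i]]) (use c aV in auto)
    also have "\<dots> = det (M s) \<cdot>\<^sub>m (A i * P \<mu>) + s \<cdot>\<^sub>m (A i * (adj_mat (M s) * VP))"
      using mult_smult_distrib[OF A_carrier[OF i] c(2)] mult_smult_distrib[OF A_carrier[OF i] aV] by simp
    finally have "mat_trace (A i * adj_mat (M s)) = det (M s) * (b $ i / \<mu>) + s * h i s"
      using mat_trace_add[OF smult_carrier_mat[OF AP] smult_carrier_mat[OF AaV]]
      by (simp add: mat_trace_smult[OF AP] mat_trace_smult[OF AaV] tAP h_def)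
    then show ?thesis by (simp add: residual_def slack) (simp add: \<eta>_def)
  qed
  have cont: "isCont (h i) 0" if i: "i < m" for i
  proof -
    have "h i s = (\<Sum>j<n. \<Sum>k<n. (VP * A i) $$ (j, k) * adj_mat (M s) $$ (k, j))" for s
    proof -
      note adj = adj_mat(1)[OF M[of s]]
      have "A i * (adj_mat (M s) * VP) = (A i * adj_mat (M s)) * VP"
        using assoc_mult_mat[OF A_carrier[OF i] adj VP] by simp
      then have "h i s = mat_trace (VP * (A i * adj_mat (M s)))"
        unfolding h_def using mat_trace_mult_commute[OF _ VP, of "A i * adj_mat (M s)"] A_carrier[OF i] adj
        by simp
      also have "VP * (A i * adj_mat (M s)) = (VP * A i) * adj_mat (M s)"
        using assoc_mult_mat[OF VP A_carrier[OF i] adj] by simp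
      also have "mat_trace \<dots> = (\<Sum>j<n. \<Sum>k<n. (VP * A i) $$ (j, k) * adj_mat (M s) $$ (k, j))"
        by (rule mat_trace_mult[OF _ adj]) (use VP A_carrier[OF i] in auto)
      finally show ?thesis .
    qed
    then have eq: "h i = (\<lambda>s. \<Sum>j<n. \<Sum>k<n. (VP * A i) $$ (j, k) * adj_mat (M s) $$ (k, j))" by blast
    have "isCont (\<lambda>s. M s $$ (j, k)) 0" if "j < n" "k < n" for j k
    proof -
      have "(\<lambda>s. M s $$ (j, k)) = (\<lambda>s. S \<mu> $$ (j, k) - s * V $$ (j, k))"
        using that c(1) V by (auto simp: M_def fun_eq_iff)
      then show ?thesis by (auto intro!: continuous_intros)
    qed
    then show ?thesis
      unfolding eq by (intro cont_ring.sum cont_ring.mult cont_ring.const cont_ring.adj[where n = n] M) auto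
  qed
  have start: "h i 0 = a i" if i: "i < m" for i
  proof -
    have "M 0 = S \<mu>" using c(1) V by (auto simp: M_def intro!: eq_matI)
    then have "adj_mat (M 0) * VP = \<delta> \<cdot>\<^sub>m (P \<mu> * VP)"
      using mult_smult_assoc_mat[OF c(2) VP, of \<delta>] by (simp add: adj_S[OF \<mu>] \<delta>_def)
    moreover have "P \<mu> * VP = P \<mu> * V * P \<mu>" using assoc_mult_mat[OF c(2) V c(2)] by (simp add: VP_def)
    moreover have PVP: "P \<mu> * V * P \<mu> \<in> carrier_mat n n" using c V by auto
    moreover have "mat_trace (A i * (P \<mu> * V * P \<mu>)) = a i / \<delta>"
      using gram_apply[OF c(2) v i] Gv i by (simp add: V_def av_def)
    moreover have "A i * (\<delta> \<cdot>\<^sub>m (P \<mu> * V * P \<mu>)) = \<delta> \<cdot>\<^sub>m (A i * (P \<mu> * V * P \<mu>))"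
      by (rule mult_smult_distrib[OF A_carrier[OF i] PVP])
    moreover have "A i * (P \<mu> * V * P \<mu>) \<in> carrier_mat n n" using A_carrier[OF i] PVP by simp
    ultimately show ?thesis using \<delta> by (simp add: h_def mat_trace_smult)
  qed
  show ?thesis
    by (intro exI[of _ v] exI[of _ h] allI impI conjI line[unfolded \<eta>_def] cont start)
qed

text \<open>\<open>elimination\<close> is applied with \<tau> = 1 / \<mu> and the residuals as H.
  The degree bound is the same for all \<open>u\<close>, as the search for a common period
  requires.\<close>

lemma y_comb_annihilated:
  fixes u :: "nat \<Rightarrow> real"
  shows "\<exists>Q. Q \<noteq> 0 \<and> degree Q \<le> (3 * (n + 1) * m) ^ (m + 1) \<and>
    annihilates (\<lambda>\<mu>. \<Sum>i<m. u i * y \<mu> $ i) Q"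
proof -
  define D where "D = (3 * (n + 1) * m) ^ (m + 1)"
  define l where "l \<eta> = (\<Sum>i<m. u i * \<eta> i)" for \<eta> :: "nat \<Rightarrow> real"
  define L where "L \<tau> = (\<Sum>i<m. u i * y (1 / \<tau>) $ i)" for \<tau>
  have sl: "sep_poly (m + 1) 1 l"
    unfolding l_def by (intro sep_poly_sum sep_poly_cmult sep_poly_var)
  have path: "\<exists>\<eta> h. (\<forall>s. \<eta> s m = \<tau> \<and> (\<forall>i>m. \<eta> s i = 0)) \<and>
      (\<forall>i<m. (\<forall>s. residual i (\<eta> s) = s * h i s) \<and> isCont (h i) 0 \<and> h i 0 = a i) \<and>
      isCont (\<lambda>s. l (\<eta> s)) 0 \<and> l (\<eta> 0) = L \<tau>" if \<tau>: "\<tau> > 0" for \<tau> a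
  proof -
    have "1 / \<tau> > 0" using \<tau> by simp
    from residual_line[OF this, of a] obtain v h where vh: "\<forall>i<m.
        (\<forall>s. residual i (\<lambda>j. if j < m then y (1 / \<tau>) $ j + s * v $ j
          else if j = m then 1 / (1 / \<tau>) else 0) = s * h i s) \<and> isCont (h i) 0 \<and> h i 0 = a i"
      by (elim exE) (rule that)
    define \<eta> where "\<eta> s = (\<lambda>j. if j < m then y (1 / \<tau>) $ j + s * v $ j
          else if j = m then 1 / (1 / \<tau>) else 0)" for s
    have l\<eta>: "l (\<eta> s) = (\<Sum>i<m. u i * (y (1 / \<tau>) $ i + s * v $ i))" for s
      unfolding l_def by (intro sum.cong) (auto simp: \<eta>_def)
    show ?thesis
    proof (intro exI[of _ \<eta>] exI[of _ h] conjI)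
      show "\<forall>s. \<eta> s m = \<tau> \<and> (\<forall>i>m. \<eta> s i = 0)" by (simp add: \<eta>_def)
      show "\<forall>i<m. (\<forall>s. residual i (\<eta> s) = s * h i s) \<and> isCont (h i) 0 \<and> h i 0 = a i"
        unfolding \<eta>_def by (rule vh)
      show "isCont (\<lambda>s. l (\<eta> s)) 0" unfolding l\<eta> by (intro continuous_intros)
      show "l (\<eta> 0) = L \<tau>" by (simp add: l\<eta> L_def)
    qed
  qed
  obtain p :: "nat \<Rightarrow> nat \<Rightarrow> real" where p: "\<exists>\<gamma>\<le>D. \<exists>\<beta>\<le>D. p \<gamma> \<beta> \<noteq> 0"
    "\<And>\<tau>. \<tau> > 0 \<Longrightarrow> (\<Sum>\<gamma>\<le>D. \<Sum>\<beta>\<le>D. p \<gamma> \<beta> * (\<tau> ^ \<gamma> * L \<tau> ^ \<beta>)) = 0"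
    using elimination[where H = residual and n = "n + 1" and L = L, OF m le_add2 sep_poly_residual sl D_def path]
    by blast
  have "\<exists>Q. Q \<noteq> 0 \<and> degree Q \<le> D \<and> annihilates (\<lambda>\<mu>. \<Sum>i<m. u i * y \<mu> $ i) Q"
  proof (rule annihilator_of_relation[OF p(1)])
    fix \<mu> :: real assume "\<mu> > 0"
    then show "(\<Sum>\<gamma>\<le>D. \<Sum>\<beta>\<le>D. p \<gamma> \<beta> * ((1 / \<mu>) ^ \<gamma> * (\<Sum>i<m. u i * y \<mu> $ i) ^ \<beta>)) = 0"
      using p(2)[of "1 / \<mu>"] by (simp add: L_def)
  qed
  then show ?thesis by (simp add: D_def)
qed

theorem analytic_reparam_bound:
  "\<exists>\<rho>\<in>{1..(3 * (n + 1) * m) ^ (m + 1)}. analytic_reparam n m \<xi> \<rho>"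
proof -
  obtain K where K: "\<And>\<mu> i. 0 < \<mu> \<Longrightarrow> \<mu> < 1 \<Longrightarrow> i < m \<Longrightarrow> \<bar>y \<mu> $ i\<bar> \<le> K" using y_bounded by blast
  have "\<exists>\<rho>\<in>{1..(3 * (n + 1) * m) ^ (m + 1)}. \<forall>i<m. analytic_at_0 (\<lambda>t. y (t ^ \<rho>) $ i)"
  proof (rule puiseux_family[where f = "\<lambda>i \<mu>. y \<mu> $ i"])
    show "(0::real) < 1" by simp
    show "\<bar>y \<mu> $ i\<bar> \<le> K" if "i < m" "0 < \<mu>" "\<mu> < 1" for i \<mu> by (rule K[OF that(2,3,1)])
  qed (rule y_continuous y_comb_annihilated; assumption?)+
  then obtain \<rho> where \<rho>: "\<rho> \<in> {1..(3 * (n + 1) * m) ^ (m + 1)}"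
    and yan: "\<And>i. i < m \<Longrightarrow> analytic_at_0 (\<lambda>t. y (t ^ \<rho>) $ i)"
    by blast
  \<comment> \<open>Unlike \<open>S (t ^ \<rho>)\<close>, this has dimension \<open>n\<close> for
    every real \<open>t\<close>, as the lemmas on determinants and adjugates demand.\<close>
  define Sl where "Sl t = slack (\<lambda>i. y (t ^ \<rho>) $ i)" for t
  have Sl: "Sl t \<in> carrier_mat n n" for t by (simp add: Sl_def)
  have Sl_an: "analytic_at_0 (\<lambda>t. Sl t $$ (j, k))" if "j < n" "k < n" for j k
  proof -
    have "analytic_at_0 (\<lambda>t. C $$ (j, k) + (\<Sum>i<m. (- A i $$ (j, k)) * y (t ^ \<rho>) $ i))"
      by (intro analytic_ring.add analytic_ring.sum analytic_ring.mult analytic_ring.const yan) auto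
    then show ?thesis using that by (simp add: Sl_def slack_def sum_negf mult.commute)
  qed
  have Sl_eq: "Sl t = S (t ^ \<rho>)" if "t > 0" for t
  proof -
    have "t ^ \<rho> > 0" using that by simp
    then show ?thesis using C_carrier
      by (auto simp: Sl_def slack_def S_eq lin_comb_def intro!: eq_matI)
  qed
  have pow: "0 < t ^ \<rho>" "t ^ \<rho> < 1" if "0 < t" "t < 1" for t :: real
    using that \<rho> by (auto simp: power_less_one_iff)
  \<comment> \<open>Division by the constant 1 merely transfers analyticity between functions that
    agree for small positive \<open>t\<close>.\<close>
  have S_an: "analytic_at_0 (\<lambda>t. S (t ^ \<rho>) $$ (j, k))" if jk: "j < n" "k < n" for j k
    by (rule analytic_at_0_divide_bounded[OF Sl_an[OF jk] analytic_at_0_const[of 1],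
          where e = 1 and M = "2 * n * mat_trace (S 1)"])
       (use Sl_eq pow S_entry_bounded jk in auto)
  have X_an: "analytic_at_0 (\<lambda>t. X (t ^ \<rho>) $$ (j, k))" if jk: "j < n" "k < n" for j k
  proof (rule analytic_at_0_divide_bounded[of "\<lambda>t. t ^ \<rho> * adj_mat (Sl t) $$ (j, k)" "\<lambda>t. det (Sl t)" 1 _ "2 * n * mat_trace (X 1)"])
    have "analytic_at_0 (\<lambda>t. t ^ \<rho>)"
      using analytic_ring.prod[of "{..<\<rho>}" "\<lambda>_ t. t"] analytic_at_0_id by simp
    then show "analytic_at_0 (\<lambda>t. t ^ \<rho> * adj_mat (Sl t) $$ (j, k))"
      by (intro analytic_ring.mult analytic_ring.adj[where n = n] Sl Sl_an jk)
    show "analytic_at_0 (\<lambda>t. det (Sl t))"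
      by (intro analytic_ring.det[where n = n] Sl Sl_an)
    fix t :: real assume t: "0 < t" "t < 1"
    note \<mu> = pow(1)[OF t]
    have "adj_mat (Sl t) $$ (j, k) = det (S (t ^ \<rho>)) * (X (t ^ \<rho>) $$ (j, k) / t ^ \<rho>)"
      using X_carrier[OF \<mu>] jk by (simp add: Sl_eq[OF t(1)] adj_S[OF \<mu>] P_def)
    then show "det (Sl t) \<noteq> 0 \<and> X (t ^ \<rho>) $$ (j, k) * det (Sl t) = t ^ \<rho> * adj_mat (Sl t) $$ (j, k) \<and>
        \<bar>X (t ^ \<rho>) $$ (j, k)\<bar> \<le> 2 * n * mat_trace (X 1)"
      using det_S_nonzero[OF \<mu>] t X_entry_bounded[OF pow[OF t] jk] by (simp add: Sl_eq)
  qed simp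
  have "analytic_reparam n m \<xi> \<rho>"
    unfolding analytic_reparam_def curve_analytic_at_0_def
    using \<rho> X_an S_an yan by (simp add: X_def y_def S_def)
  then show ?thesis using \<rho> by blast
qed

end

text \<open>With 3 \<le> 2^2, n + 1 \<le> 2^n and m \<le> 2^m the exponent becomes (2 + n + m)(m +
  1), at most 6 m^2 + 2 n^2 m; hence the constant 6.\<close>

lemma degree_bound_le:
  assumes "m \<ge> 1" "n \<ge> 1"
  shows "real ((3 * (n + 1) * m) ^ (m + 1)) \<le> 2 powr (6 * real (m\<^sup>2 + n\<^sup>2 * m + n ^ 4))"
proof -
  have "n + 1 \<le> 2 ^ n" by (rule order_trans[OF eq_imp_le Suc_leI[OF less_exp]]) simp
  moreover have "m \<le> 2 ^ m" using less_exp[of m] by simp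
  ultimately have "3 * (n + 1) * m \<le> 2\<^sup>2 * 2 ^ n * 2 ^ m" by (intro mult_le_mono) auto
  also have "\<dots> = 2 ^ (2 + n + m)" by (simp add: power_add)
  finally have "(3 * (n + 1) * m) ^ (m + 1) \<le> (2 ^ (2 + n + m)) ^ (m + 1)" by (rule power_mono) simp
  also have "\<dots> = 2 ^ ((2 + n + m) * (m + 1))" by (simp only: power_mult)
  also have "\<dots> \<le> 2 ^ (6 * (m\<^sup>2 + n\<^sup>2 * m + n ^ 4))"
  proof (rule power_increasing)
    have "(2 + n + m) * (m + 1) \<le> (2 + n + m) * (2 * m)" using assms by (intro mult_le_mono2) simp
    also have "\<dots> = 4 * (m * 1) + 2 * (n * 1 * m) + 2 * (m * m)" by (simp add: algebra_simps)
    also have "\<dots> \<le> 4 * (m * m) + 2 * (n * n * m) + 2 * (m * m)"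
      using assms by (intro add_mono mult_le_mono le_refl) auto
    also have "\<dots> \<le> 6 * (m\<^sup>2 + n\<^sup>2 * m + n ^ 4)" by (simp add: power2_eq_square)
    finally show "(2 + n + m) * (m + 1) \<le> 6 * (m\<^sup>2 + n\<^sup>2 * m + n ^ 4)" .
  qed simp
  finally have "real ((3 * (n + 1) * m) ^ (m + 1)) \<le> real (2 ^ (6 * (m\<^sup>2 + n\<^sup>2 * m + n ^ 4)))"
    by (rule of_nat_mono)
  also have "\<dots> = 2 powr (6 * real (m\<^sup>2 + n\<^sup>2 * m + n ^ 4))"
    by (simp add: powr_realpow[symmetric])
  finally show ?thesis .
qed

theorem theorem1:
  shows "\<exists>c::real. c > 0 \<and>
    (\<forall>(m::nat) (n::nat) (A :: nat \<Rightarrow> real mat) (b :: real vec) (C :: real mat)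
       (\<xi> :: real \<Rightarrow> real mat \<times> real vec \<times> real mat).
       m \<ge> 1 \<longrightarrow> n \<ge> 1 \<longrightarrow>
       integral_data n m A b C \<longrightarrow>
       lin_indep_family n m A \<longrightarrow>
       (\<exists>p. strictly_feasible n m A b C p) \<longrightarrow>
       is_central_path n m A b C \<xi> \<longrightarrow>
       (\<exists>\<rho>. analytic_reparam n m \<xi> \<rho>) \<and>
       real (LEAST \<rho>. analytic_reparam n m \<xi> \<rho>)
         \<le> 2 powr (c * real (m\<^sup>2 + n\<^sup>2 * m + n ^ 4)))"
proof (rule exI[of _ 6], intro conjI allI impI)
  fix m n :: nat and A :: "nat \<Rightarrow> real mat" and b :: "real vec" and C :: "real mat"
    and \<xi> :: "real \<Rightarrow> real mat \<times> real vec \<times> real mat"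
  assume mn: "m \<ge> 1" "n \<ge> 1" and data: "integral_data n m A b C"
    and path: "lin_indep_family n m A" "is_central_path n m A b C \<xi>"
  interpret central_path m n A b C \<xi>
    by unfold_locales (use mn data path in \<open>auto simp: integral_data_def\<close>)
  obtain \<rho> where \<rho>: "\<rho> \<le> (3 * (n + 1) * m) ^ (m + 1)" "analytic_reparam n m \<xi> \<rho>"
    using analytic_reparam_bound by auto
  show "\<exists>\<rho>. analytic_reparam n m \<xi> \<rho>" using \<rho>(2) by blast
  have "(LEAST \<rho>. analytic_reparam n m \<xi> \<rho>) \<le> (3 * (n + 1) * m) ^ (m + 1)"
    using Least_le[of "analytic_reparam n m \<xi>", OF \<rho>(2)] \<rho>(1) by (rule order_trans)
  then show "real (LEAST \<rho>. analytic_reparam n m \<xi> \<rho>) \<le> 2 powr (6 * real (m\<^sup>2 + n\<^sup>2 * m + n ^ 4))"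
    using degree_bound_le[OF mn] of_nat_mono order_trans by blast
qed simp

end
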